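(* Let $R$ be an excellent ring and let $I$ be an ideal of $R$. Then there exists an element $f \notin \sqrt{I}$ such that the associated graded ring $\operatorname{gr}_{I_f}(R_f)$ is a Cohen-Macaulay module over $R_f/I_f$. If $R$ is locally equidimensional, we can choose $f \notin \bigcup_{P \in \operatorname{Minh}(I)} P$.
   Context: Rings are commutative with identity; excellent rings are in particular Noetherian. The element $f$ is taken in $R$, $R_f$ denotes the localization of $R$ at the powers of $f$, $I_f = IR_f$, and $\operatorname{gr}_{I_f}(R_f) = \bigoplus_{n\ge 0} I^nR_f/I^{n+1}R_f$. Since this is in general not a finitely generated $R_f/I_f$-module, "$\operatorname{gr}_{I_f}(R_f)$ is a Cohen-Macaulay module over $R_f/I_f$" is understood to mean that every graded component $I^nR_f/I^{n+1}R_f$, $n \ge 0$, is a Cohen-Macaulay $R_f/I_f$-module; a finitely generated module is Cohen-Macaulay if each of its localizations at primes is either zero or has depth equal to its dimension. $R$ is locally equidimensional if for every prime $\mathfrak p$ the local ring $R_{\mathfrak p}$ is equidimensional, i.e. $\dim R_{\mathfrak p}/\mathfrak q = \dim R_{\mathfrak p}$ for every minimal prime $\mathfrak q$ of $R_{\mathfrak p}$. $\operatorname{Minh}(I)$ denotes the set of minimal primes $P$ of $I$ such that $\dim R/P = \dim R/I$.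
   Formalization: The ideal I is assumed to be proper (I ≠ R); for I = R the claim fails, since then the radical of I is all of R and no element f lies outside it. *)

theory Defs
  imports "HOL-Algebra.Algebra" "HOL-Library.Extended_Nat"
begin

section \<open>Localization\<close>

text \<open>Throughout, \<open>S\<close> is a multiplicative subset of the ring. The fraction \<open>a/s\<close> is the set of all
  pairs \<open>(b, t)\<close> with \<open>u t a = u s b\<close> for some \<open>u \<in> S\<close>. Operations on fractions are unions
  over representatives, in the style of \<^const>\<open>rcoset_mult\<close>.\<close>

definition loc_frac :: "('a, 'm) ring_scheme \<Rightarrow> 'a set \<Rightarrow> 'a \<Rightarrow> 'a \<Rightarrow> ('a \<times> 'a) set" where
  "loc_frac R S a s = {(b, t). b \<in> carrier R \<and> t \<in> S \<and>
     (\<exists>u\<in>S. u \<otimes>\<^bsub>R\<^esub> t \<otimes>\<^bsub>R\<^esub> a = u \<otimes>\<^bsub>R\<^esub> s \<otimes>\<^bsub>R\<^esub> b)}"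

definition localization :: "('a, 'm) ring_scheme \<Rightarrow> 'a set \<Rightarrow> ('a \<times> 'a) set ring" where
  "localization R S =
    \<lparr>carrier = {loc_frac R S a s | a s. a \<in> carrier R \<and> s \<in> S},
     monoid.mult = (\<lambda>U V. \<Union>{loc_frac R S (a \<otimes>\<^bsub>R\<^esub> b) (s \<otimes>\<^bsub>R\<^esub> t)
              | a s b t. (a, s) \<in> U \<and> (b, t) \<in> V}),
     one = loc_frac R S \<one>\<^bsub>R\<^esub> \<one>\<^bsub>R\<^esub>,
     ring.zero = loc_frac R S \<zero>\<^bsub>R\<^esub> \<one>\<^bsub>R\<^esub>,
     add = (\<lambda>U V. \<Union>{loc_frac R S ((t \<otimes>\<^bsub>R\<^esub> a) \<oplus>\<^bsub>R\<^esub> (s \<otimes>\<^bsub>R\<^esub> b)) (s \<otimes>\<^bsub>R\<^esub> t)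
              | a s b t. (a, s) \<in> U \<and> (b, t) \<in> V})\<rparr>"

definition loc_map :: "('a, 'm) ring_scheme \<Rightarrow> 'a set \<Rightarrow> 'a \<Rightarrow> ('a \<times> 'a) set" where
  "loc_map R S a = loc_frac R S a \<one>\<^bsub>R\<^esub>"

definition loc_ideal :: "('a, 'm) ring_scheme \<Rightarrow> 'a set \<Rightarrow> 'a set \<Rightarrow> ('a \<times> 'a) set set" where
  "loc_ideal R S I = Idl\<^bsub>localization R S\<^esub> (loc_map R S ` I)"

definition powers :: "('a, 'm) ring_scheme \<Rightarrow> 'a \<Rightarrow> 'a set" where
  "powers R f = {f [^]\<^bsub>R\<^esub> n | n :: nat. True}"

abbreviation local_at :: "('a, 'm) ring_scheme \<Rightarrow> 'a set \<Rightarrow> ('a \<times> 'a) set ring" where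
  "local_at R P \<equiv> localization R (carrier R - P)"

text \<open>The extension of the prime \<open>P\<close>, i.e. the maximal ideal of \<open>local_at R P\<close>.\<close>

abbreviation local_max :: "('a, 'm) ring_scheme \<Rightarrow> 'a set \<Rightarrow> ('a \<times> 'a) set set" where
  "local_max R P \<equiv> loc_ideal R (carrier R - P) P"

definition loc_mfrac ::
  "('a, 'm) ring_scheme \<Rightarrow> 'a set \<Rightarrow> ('a, 'b, 'n) module_scheme \<Rightarrow> 'b \<Rightarrow> 'a \<Rightarrow> ('b \<times> 'a) set" where
  "loc_mfrac R S M x s = {(y, t). y \<in> carrier M \<and> t \<in> S \<and>
     (\<exists>u\<in>S. (u \<otimes>\<^bsub>R\<^esub> t) \<odot>\<^bsub>M\<^esub> x = (u \<otimes>\<^bsub>R\<^esub> s) \<odot>\<^bsub>M\<^esub> y)}"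

text \<open>Module records extend ring records; the unused ring fields are left \<^const>\<open>undefined\<close>.\<close>

definition loc_module ::
  "('a, 'm) ring_scheme \<Rightarrow> 'a set \<Rightarrow> ('a, 'b, 'n) module_scheme
    \<Rightarrow> (('a \<times> 'a) set, ('b \<times> 'a) set) module" where
  "loc_module R S M =
    \<lparr>carrier = {loc_mfrac R S M x s | x s. x \<in> carrier M \<and> s \<in> S},
     monoid.mult = undefined,
     one = undefined,
     ring.zero = loc_mfrac R S M \<zero>\<^bsub>M\<^esub> \<one>\<^bsub>R\<^esub>,
     add = (\<lambda>U V. \<Union>{loc_mfrac R S M ((t \<odot>\<^bsub>M\<^esub> x) \<oplus>\<^bsub>M\<^esub> (s \<odot>\<^bsub>M\<^esub> y)) (s \<otimes>\<^bsub>R\<^esub> t)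
              | x s y t. (x, s) \<in> U \<and> (y, t) \<in> V}),
     smult = (\<lambda>U V. \<Union>{loc_mfrac R S M (a \<odot>\<^bsub>M\<^esub> y) (s \<otimes>\<^bsub>R\<^esub> t)
                | a s y t. (a, s) \<in> U \<and> (y, t) \<in> V})\<rparr>"


section \<open>Primes and Krull dimension\<close>

definition radical :: "('a, 'm) ring_scheme \<Rightarrow> 'a set \<Rightarrow> 'a set" where
  "radical R I = {x \<in> carrier R. \<exists>n::nat. x [^]\<^bsub>R\<^esub> n \<in> I}"

definition minimal_primes :: "('a, 'm) ring_scheme \<Rightarrow> 'a set \<Rightarrow> 'a set set" where
  "minimal_primes R I = {P. primeideal P R \<and> I \<subseteq> P \<and>
     (\<forall>Q. primeideal Q R \<and> I \<subseteq> Q \<and> Q \<subseteq> P \<longrightarrow> Q = P)}"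

definition prime_chain :: "('a, 'm) ring_scheme \<Rightarrow> 'a set list \<Rightarrow> bool" where
  "prime_chain R Ps \<longleftrightarrow> Ps \<noteq> [] \<and> (\<forall>P\<in>set Ps. primeideal P R) \<and> sorted_wrt (\<subset>) Ps"

text \<open>The zero ring gets dimension \<open>0\<close> here (rather than \<open>-\<infinity>\<close>); below, dimensions
  of the zero ring are never compared.\<close>

definition krull_dim :: "('a, 'm) ring_scheme \<Rightarrow> enat" where
  "krull_dim R = (SUP Ps \<in> {Ps. prime_chain R Ps}. enat (length Ps - 1))"

definition Minh :: "('a, 'm) ring_scheme \<Rightarrow> 'a set \<Rightarrow> 'a set set" where
  "Minh R I = {P \<in> minimal_primes R I. krull_dim (R Quot P) = krull_dim (R Quot I)}"

definition equidimensional :: "('a, 'm) ring_scheme \<Rightarrow> bool" where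
  "equidimensional R \<longleftrightarrow>
     (\<forall>Q \<in> minimal_primes R {\<zero>\<^bsub>R\<^esub>}. krull_dim (R Quot Q) = krull_dim R)"

definition locally_equidimensional :: "('a, 'm) ring_scheme \<Rightarrow> bool" where
  "locally_equidimensional R \<longleftrightarrow> (\<forall>P. primeideal P R \<longrightarrow> equidimensional (local_at R P))"


section \<open>Cohen-Macaulay modules\<close>

definition submod_gen ::
  "('a, 'm) ring_scheme \<Rightarrow> ('a, 'b, 'n) module_scheme \<Rightarrow> 'b set \<Rightarrow> 'b set" where
  "submod_gen R M T = \<Inter>{N. submodule N R M \<and> T \<subseteq> N}"

definition fg_module :: "('a, 'm) ring_scheme \<Rightarrow> ('a, 'b, 'n) module_scheme \<Rightarrow> bool" where
  "fg_module R M \<longleftrightarrow> module R M \<and> (\<exists>T\<subseteq>carrier M. finite T \<and> submod_gen R M T = carrier M)"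

text \<open>The submodule \<open>(x\<^sub>1, \<dots>, x\<^sub>k) M\<close>.\<close>

definition seq_submod ::
  "('a, 'm) ring_scheme \<Rightarrow> ('a, 'b, 'n) module_scheme \<Rightarrow> 'a list \<Rightarrow> 'b set" where
  "seq_submod R M xs = submod_gen R M {x \<odot>\<^bsub>M\<^esub> y | x y. x \<in> set xs \<and> y \<in> carrier M}"

text \<open>Each \<open>x\<^sub>i\<close> is a nonzerodivisor on \<open>M/(x\<^sub>1, \<dots>, x\<^bsub>i-1\<^esub>)M\<close>, and \<open>M \<noteq> (x\<^sub>1, \<dots>, x\<^sub>k)M\<close>.\<close>

definition regular_sequence ::
  "('a, 'm) ring_scheme \<Rightarrow> ('a, 'b, 'n) module_scheme \<Rightarrow> 'a list \<Rightarrow> bool" where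
  "regular_sequence R M xs \<longleftrightarrow> set xs \<subseteq> carrier R \<and>
     (\<forall>i<length xs. \<forall>y\<in>carrier M.
        xs ! i \<odot>\<^bsub>M\<^esub> y \<in> seq_submod R M (take i xs) \<longrightarrow> y \<in> seq_submod R M (take i xs)) \<and>
     seq_submod R M xs \<noteq> carrier M"

definition depth ::
  "('a, 'm) ring_scheme \<Rightarrow> 'a set \<Rightarrow> ('a, 'b, 'n) module_scheme \<Rightarrow> enat" where
  "depth R \<mm> M = (SUP xs \<in> {xs. set xs \<subseteq> \<mm> \<and> regular_sequence R M xs}. enat (length xs))"

definition annihilator :: "('a, 'm) ring_scheme \<Rightarrow> ('a, 'b, 'n) module_scheme \<Rightarrow> 'a set" where
  "annihilator R M = {a \<in> carrier R. \<forall>x\<in>carrier M. a \<odot>\<^bsub>M\<^esub> x = \<zero>\<^bsub>M\<^esub>}"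

definition module_dim :: "('a, 'm) ring_scheme \<Rightarrow> ('a, 'b, 'n) module_scheme \<Rightarrow> enat" where
  "module_dim R M = krull_dim (R Quot (annihilator R M))"

definition cohen_macaulay_module ::
  "('a, 'm) ring_scheme \<Rightarrow> ('a, 'b, 'n) module_scheme \<Rightarrow> bool" where
  "cohen_macaulay_module R M \<longleftrightarrow> fg_module R M \<and>
     (\<forall>P. primeideal P R \<longrightarrow>
        (let M\<^sub>P = loc_module R (carrier R - P) M in
           carrier M\<^sub>P = {\<zero>\<^bsub>M\<^sub>P\<^esub>} \<or>
           depth (local_at R P) (local_max R P) M\<^sub>P = module_dim (local_at R P) M\<^sub>P))"


section \<open>The associated graded ring\<close>

primrec ideal_pow :: "('a, 'm) ring_scheme \<Rightarrow> 'a set \<Rightarrow> nat \<Rightarrow> 'a set" where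
  "ideal_pow R I 0 = carrier R"
| "ideal_pow R I (Suc n) = ideal_prod R I (ideal_pow R I n)"

text \<open>The graded component \<open>I\<^sup>n/I\<^sup>n\<^sup>+\<^sup>1\<close> of \<open>gr\<^sub>I(R)\<close>, as a module over \<open>R/I\<close>.\<close>

definition gr_component ::
  "('a, 'm) ring_scheme \<Rightarrow> 'a set \<Rightarrow> nat \<Rightarrow> ('a set, 'a set) module" where
  "gr_component R I n =
    \<lparr>carrier = {ideal_pow R I (Suc n) +>\<^bsub>R\<^esub> x | x. x \<in> ideal_pow R I n},
     monoid.mult = undefined,
     one = undefined,
     ring.zero = ideal_pow R I (Suc n),
     add = set_add R,
     smult = (\<lambda>U V. \<Union>a\<in>U. \<Union>x\<in>V. ideal_pow R I (Suc n) +>\<^bsub>R\<^esub> (a \<otimes>\<^bsub>R\<^esub> x))\<rparr>"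

definition gr_cohen_macaulay :: "('a, 'm) ring_scheme \<Rightarrow> 'a set \<Rightarrow> bool" where
  "gr_cohen_macaulay R I \<longleftrightarrow> (\<forall>n. cohen_macaulay_module (R Quot I) (gr_component R I n))"


section \<open>Regular rings\<close>

definition regular_local_ring :: "('a, 'm) ring_scheme \<Rightarrow> bool" where
  "regular_local_ring R \<longleftrightarrow> cring R \<and> noetherian_ring R \<and>
     (\<exists>\<mm>. {M. maximalideal M R} = {\<mm>} \<and>
        (\<exists>T\<subseteq>carrier R. finite T \<and> Idl\<^bsub>R\<^esub> T = \<mm> \<and> enat (card T) = krull_dim R))"

definition regular_ring :: "('a, 'm) ring_scheme \<Rightarrow> bool" where
  "regular_ring R \<longleftrightarrow> cring R \<and> noetherian_ring R \<and>
     (\<forall>P. primeideal P R \<longrightarrow> regular_local_ring (local_at R P))"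

definition open_regular_locus :: "('a, 'm) ring_scheme \<Rightarrow> bool" where
  "open_regular_locus R \<longleftrightarrow>
     (\<exists>J. ideal J R \<and>
        (\<forall>P. primeideal P R \<longrightarrow> (regular_local_ring (local_at R P) \<longleftrightarrow> \<not> J \<subseteq> P)))"


section \<open>Excellent rings\<close>

subsection \<open>Universally catenary rings and J-2 rings\<close>

definition saturated_chain ::
  "('a, 'm) ring_scheme \<Rightarrow> 'a set \<Rightarrow> 'a set \<Rightarrow> 'a set list \<Rightarrow> bool" where
  "saturated_chain R P Q Ps \<longleftrightarrow> prime_chain R Ps \<and> hd Ps = P \<and> last Ps = Q \<and>
     (\<forall>i. Suc i < length Ps \<longrightarrow> \<not> (\<exists>P'. primeideal P' R \<and> Ps ! i \<subset> P' \<and> P' \<subset> Ps ! Suc i))"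

definition catenary :: "('a, 'm) ring_scheme \<Rightarrow> bool" where
  "catenary R \<longleftrightarrow> (\<forall>P Q. primeideal P R \<and> primeideal Q R \<and> P \<subseteq> Q \<longrightarrow>
     (\<exists>Ps. saturated_chain R P Q Ps \<and>
        (\<forall>Ps'. saturated_chain R P Q Ps' \<longrightarrow> length Ps' = length Ps)))"

definition fg_algebra ::
  "('a, 'm) ring_scheme \<Rightarrow> ('b, 'n) ring_scheme \<Rightarrow> ('a \<Rightarrow> 'b) \<Rightarrow> bool" where
  "fg_algebra R S \<phi> \<longleftrightarrow> cring S \<and> \<phi> \<in> ring_hom R S \<and>
     (\<exists>T\<subseteq>carrier S. finite T \<and> generate_ring S (\<phi> ` carrier R \<union> T) = carrier S)"

text \<open>HOL cannot quantify over all types inside a definition. A finitely generated algebra over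
  \<open>R\<close> is a quotient of some \<open>R[X\<^sub>1, \<dots>, X\<^sub>n]\<close>, so its cardinality is at most that of the type
  \<^typ>\<open>'a list\<close>; hence every such algebra has an isomorphic copy with carrier in \<^typ>\<open>'a list\<close>,
  and quantifying over rings on that type loses nothing.\<close>

definition universally_catenary :: "('a, 'm) ring_scheme \<Rightarrow> bool" where
  "universally_catenary R \<longleftrightarrow> (\<forall>(S :: 'a list ring) \<phi>. fg_algebra R S \<phi> \<longrightarrow> catenary S)"

definition J2_ring :: "('a, 'm) ring_scheme \<Rightarrow> bool" where
  "J2_ring R \<longleftrightarrow> (\<forall>(S :: 'a list ring) \<phi>. fg_algebra R S \<phi> \<longrightarrow> open_regular_locus S)"

subsection \<open>Tensor products of algebras\<close>

text \<open>For \<open>A\<close>-algebras \<open>\<phi> : A \<rightarrow> B\<close> and \<open>\<psi> : A \<rightarrow> C\<close>, the ring \<open>B \<otimes>\<^sub>A C\<close> is the integral monoid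
  ring on the multiplicative monoid \<open>B \<times> C\<close> modulo the ideal generated by the bilinearity
  relations. (That ideal is already the additive subgroup generated by the relations,
  as multiplying a relation by a basis element gives a relation.)\<close>

definition pair_monoid_ring ::
  "('b, 'm) ring_scheme \<Rightarrow> ('c, 'n) ring_scheme \<Rightarrow> ('b \<times> 'c \<Rightarrow> int) ring" where
  "pair_monoid_ring B C =
    \<lparr>carrier = {h. finite {z. h z \<noteq> 0} \<and> {z. h z \<noteq> 0} \<subseteq> carrier B \<times> carrier C},
     monoid.mult = (\<lambda>h k z. \<Sum>(b, c)\<in>{x. h x \<noteq> 0}. \<Sum>(b', c')\<in>{y. k y \<noteq> 0}.
        if z = (b \<otimes>\<^bsub>B\<^esub> b', c \<otimes>\<^bsub>C\<^esub> c') then h (b, c) * k (b', c') else 0),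
     one = (\<lambda>z. if z = (\<one>\<^bsub>B\<^esub>, \<one>\<^bsub>C\<^esub>) then 1 else 0),
     ring.zero = (\<lambda>_. 0),
     add = (\<lambda>h k z. h z + k z)\<rparr>"

definition pair_basis :: "'b \<Rightarrow> 'c \<Rightarrow> 'b \<times> 'c \<Rightarrow> int" where
  "pair_basis b c = (\<lambda>z. if z = (b, c) then 1 else 0)"

definition bilinearity_relations ::
  "('a, 'k) ring_scheme \<Rightarrow> ('b, 'm) ring_scheme \<Rightarrow> ('a \<Rightarrow> 'b)
    \<Rightarrow> ('c, 'n) ring_scheme \<Rightarrow> ('a \<Rightarrow> 'c) \<Rightarrow> ('b \<times> 'c \<Rightarrow> int) set" where
  "bilinearity_relations A B \<phi> C \<psi> =
     {\<lambda>z. pair_basis (b \<oplus>\<^bsub>B\<^esub> b') c z - pair_basis b c z - pair_basis b' c z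
       | b b' c. b \<in> carrier B \<and> b' \<in> carrier B \<and> c \<in> carrier C} \<union>
     {\<lambda>z. pair_basis b (c \<oplus>\<^bsub>C\<^esub> c') z - pair_basis b c z - pair_basis b c' z
       | b c c'. b \<in> carrier B \<and> c \<in> carrier C \<and> c' \<in> carrier C} \<union>
     {\<lambda>z. pair_basis (\<phi> a \<otimes>\<^bsub>B\<^esub> b) c z - pair_basis b (\<psi> a \<otimes>\<^bsub>C\<^esub> c) z
       | a b c. a \<in> carrier A \<and> b \<in> carrier B \<and> c \<in> carrier C}"

definition tensor_ideal ::
  "('a, 'k) ring_scheme \<Rightarrow> ('b, 'm) ring_scheme \<Rightarrow> ('a \<Rightarrow> 'b)
    \<Rightarrow> ('c, 'n) ring_scheme \<Rightarrow> ('a \<Rightarrow> 'c) \<Rightarrow> ('b \<times> 'c \<Rightarrow> int) set" where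
  "tensor_ideal A B \<phi> C \<psi> = Idl\<^bsub>pair_monoid_ring B C\<^esub> (bilinearity_relations A B \<phi> C \<psi>)"

definition tensor_ring ::
  "('a, 'k) ring_scheme \<Rightarrow> ('b, 'm) ring_scheme \<Rightarrow> ('a \<Rightarrow> 'b)
    \<Rightarrow> ('c, 'n) ring_scheme \<Rightarrow> ('a \<Rightarrow> 'c) \<Rightarrow> ('b \<times> 'c \<Rightarrow> int) set ring" where
  "tensor_ring A B \<phi> C \<psi> = pair_monoid_ring B C Quot tensor_ideal A B \<phi> C \<psi>"

definition pure_tensor ::
  "('a, 'k) ring_scheme \<Rightarrow> ('b, 'm) ring_scheme \<Rightarrow> ('a \<Rightarrow> 'b)
    \<Rightarrow> ('c, 'n) ring_scheme \<Rightarrow> ('a \<Rightarrow> 'c) \<Rightarrow> 'b \<Rightarrow> 'c \<Rightarrow> ('b \<times> 'c \<Rightarrow> int) set" where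
  "pure_tensor A B \<phi> C \<psi> b c = tensor_ideal A B \<phi> C \<psi> +>\<^bsub>pair_monoid_ring B C\<^esub> pair_basis b c"

subsection \<open>G-rings\<close>

text \<open>The inverse limit of the rings \<open>A/I\<^sup>n\<close>: sequences of cosets, where the coset modulo \<open>I\<^sup>n\<^sup>+\<^sup>1\<close> is
  contained in the coset modulo \<open>I\<^sup>n\<close>.\<close>

definition completion :: "('a, 'm) ring_scheme \<Rightarrow> 'a set \<Rightarrow> (nat \<Rightarrow> 'a set) ring" where
  "completion A I =
    \<lparr>carrier = {x. \<forall>n. x n \<in> carrier (A Quot ideal_pow A I n) \<and> x (Suc n) \<subseteq> x n},
     monoid.mult = (\<lambda>x y n. x n \<otimes>\<^bsub>A Quot ideal_pow A I n\<^esub> y n),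
     one = (\<lambda>n. \<one>\<^bsub>A Quot ideal_pow A I n\<^esub>),
     ring.zero = (\<lambda>n. \<zero>\<^bsub>A Quot ideal_pow A I n\<^esub>),
     add = (\<lambda>x y n. x n \<oplus>\<^bsub>A Quot ideal_pow A I n\<^esub> y n)\<rparr>"

definition completion_map :: "('a, 'm) ring_scheme \<Rightarrow> 'a set \<Rightarrow> 'a \<Rightarrow> nat \<Rightarrow> 'a set" where
  "completion_map A I a = (\<lambda>n. ideal_pow A I n +>\<^bsub>A\<^esub> a)"

definition residue_field :: "('a, 'm) ring_scheme \<Rightarrow> 'a set \<Rightarrow> ('a \<times> 'a) set set ring" where
  "residue_field A Q = local_at A Q Quot local_max A Q"

definition residue_map :: "('a, 'm) ring_scheme \<Rightarrow> 'a set \<Rightarrow> 'a \<Rightarrow> ('a \<times> 'a) set set" where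
  "residue_map A Q a = local_max A Q +>\<^bsub>local_at A Q\<^esub> loc_map A (carrier A - Q) a"

text \<open>\<open>F\<close> is an algebra over the field \<open>K\<close> via \<open>\<phi>\<close>. A finite extension \<open>L\<close> of \<open>K\<close> is in bijection
  with \<open>K\<^sup>d\<close>, so up to isomorphism its carrier consists of lists over the type of \<open>K\<close>.\<close>

definition geometrically_regular ::
  "('k, 'm) ring_scheme \<Rightarrow> ('b, 'n) ring_scheme \<Rightarrow> ('k \<Rightarrow> 'b) \<Rightarrow> bool" where
  "geometrically_regular K F \<phi> \<longleftrightarrow>
     (\<forall>(L :: 'k list ring) \<psi>.
        field L \<and> \<psi> \<in> ring_hom K L \<and> ring.finite_dimension L (\<psi> ` carrier K) (carrier L)
        \<longrightarrow> regular_ring (tensor_ring K F \<phi> L \<psi>))"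

text \<open>All formal fibres of all localizations at primes are geometrically regular. (The
  completion maps are automatically flat.)\<close>

definition G_ring :: "('a, 'm) ring_scheme \<Rightarrow> bool" where
  "G_ring R \<longleftrightarrow> noetherian_ring R \<and>
     (\<forall>P. primeideal P R \<longrightarrow>
       (let A = local_at R P; \<mm> = local_max R P; A' = completion A \<mm>; \<iota> = completion_map A \<mm> in
         \<forall>Q. primeideal Q A \<longrightarrow>
           (let K = residue_field A Q; \<pi> = residue_map A Q in
             geometrically_regular K (tensor_ring A A' \<iota> K \<pi>)
               (\<lambda>c. pure_tensor A A' \<iota> K \<pi> \<one>\<^bsub>A'\<^esub> c))))"

definition excellent_ring :: "('a, 'm) ring_scheme \<Rightarrow> bool" where
  "excellent_ring R \<longleftrightarrow>
     cring R \<and> noetherian_ring R \<and> universally_catenary R \<and> G_ring R \<and> J2_ring R"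

end

theory Submission
  imports Defs "HOL-Library.List_Lexorder"
begin

text \<open>
  The element \<open>f\<close> is chosen outside every minimal prime of \<open>I\<close>; then it is neither in the radical of \<open>I\<close> nor
  in a member of \<open>Minh(I)\<close>.

  Let \<open>P\<close> be a minimal prime of \<open>I\<close>. The ring \<open>R/P\<close> is regular at its generic point, so by the J-2 property
  \<open>(R/P)\<^sub>Q\<close> is a regular local ring for all primes \<open>Q \<supseteq> P\<close> that omit some fixed element outside \<open>P\<close>
  (\<open>generic_regular\<close>). At such a \<open>Q\<close>, a regular system of parameters is a regular sequence on \<open>(R/P)\<^sub>Q\<close>, of
  length \<open>d = dim (R/P)\<^sub>Q\<close>; this is \<open>regular_prime_tower\<close>, which rests on \<open>principal_ideal_theorem\<close>.

  This sequence has to be carried over to all the modules \<open>(I\<^sup>n/I\<^sup>n\<^sup>+\<^sup>1)\<^sub>Q\<close> at once. Let \<open>g\<^sub>1, \<dots>, g\<^sub>r\<close> generate \<open>I\<close> and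
  order the exponents \<open>\<alpha> \<in> \<nat>\<^sup>r\<close> lexicographically. Adding the monomials \<open>g^\<alpha>\<close> of degree \<open>n\<close> to \<open>I\<^sup>n\<^sup>+\<^sup>1\<close> one by one
  filters \<open>I\<^sup>n/I\<^sup>n\<^sup>+\<^sup>1\<close> with cyclic factors \<open>R/a\<^sub>\<alpha>\<close>, where \<open>a\<^sub>\<alpha>\<close> consists of the \<open>c \<in> R\<close> such that \<open>c g^\<alpha>\<close> lies in the
  previous step. Multiplication by monomials shows that \<open>a\<^sub>\<alpha>\<close> increases with \<open>\<alpha>\<close> in the componentwise order. By
  Dickson's lemma and the ascending chain condition, only finitely many ideals \<open>a\<^sub>\<alpha>\<close> occur for all \<open>n\<close> together
  (\<open>finite_monotone_ideals\<close>). Each \<open>R/a\<^sub>\<alpha>\<close> has a finite filtration with factors \<open>R/p\<close>, \<open>p \<supseteq> I\<close> prime, and inverting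
  one more element outside \<open>P\<close> kills all factors except those with \<open>p = P\<close>. Hence locally the sequence is
  regular on every \<open>I\<^sup>n/I\<^sup>n\<^sup>+\<^sup>1\<close>, by induction along the filtrations (\<open>generic_loc_regular_pow\<close>).

  The neighbourhoods of the minimal primes are glued by \<open>f = \<Sum> e\<^sub>P f\<^sub>P\<close>, where \<open>f\<^sub>P \<notin> P\<close> is the element found for \<open>P\<close>
  and \<open>e\<^sub>P \<notin> P\<close> lies in all the other minimal primes (\<open>generic_gr_loc_regular\<close>). A prime \<open>Q \<supseteq> I\<close> with
  \<open>f \<notin> Q\<close> contains exactly one minimal prime \<open>P\<close> of \<open>I\<close> and omits \<open>f\<^sub>P\<close>. Therefore the dimension of \<open>(R/I)\<^sub>Q\<close>
  is \<open>d\<close>, and a nonzero \<open>(I\<^sup>n/I\<^sup>n\<^sup>+\<^sup>1)\<^sub>Q\<close> has depth at least \<open>d\<close>. Since depth is at most dimension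
  (\<open>length_regular_sequence_le_dim\<close>), both are \<open>d\<close>.

  The arguments take place in \<open>R\<close> itself: a statement about a localization at \<open>Q\<close> is phrased with
  \<open>Q\<close>-saturated ideals of \<open>R\<close>. It is transported to \<open>(R\<^sub>f/I\<^sub>f)\<^sub>p\<close> along a homomorphism for which every element of the
  target is a fraction of images (\<open>frac_hom\<close>).
\<close>

section \<open>Ideals and saturation\<close>

text \<open>Closure under negation comes for free, as \<open>-x = (-1) x\<close>.\<close>

lemma (in cring) ideal_of_closure:
  assumes "I \<subseteq> carrier R" "\<zero> \<in> I"
    "\<And>x y. x \<in> I \<Longrightarrow> y \<in> I \<Longrightarrow> x \<oplus> y \<in> I"
    "\<And>r x. r \<in> carrier R \<Longrightarrow> x \<in> I \<Longrightarrow> r \<otimes> x \<in> I"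
  shows "ideal I R"
proof (rule idealI)
  show "ring R" by (rule ring_axioms)
  have neg: "\<ominus> x \<in> I" if "x \<in> I" for x
  proof -
    have "x \<in> carrier R" using that assms(1) by auto
    then have "\<ominus> x = (\<ominus> \<one>) \<otimes> x" by algebra
    then show ?thesis using assms(4)[OF _ that, of "\<ominus> \<one>"] by simp
  qed
  show "subgroup I (add_monoid R)"
    by (rule add.subgroupI) (use assms neg in \<open>auto simp: a_inv_def\<close>)
  show "x \<otimes> a \<in> I" if "a \<in> I" "x \<in> carrier R" for a x using assms(4) that by blast
  show "a \<otimes> x \<in> I" if "a \<in> I" "x \<in> carrier R" for a x
    using assms(4)[of x a] assms(1) that m_comm[of x a] by auto
qed

lemma (in cring) ideal_facts:
  assumes "ideal I R"
  shows ideal_carr: "x \<in> I \<Longrightarrow> x \<in> carrier R"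
    and ideal_zero: "\<zero> \<in> I"
    and ideal_add: "x \<in> I \<Longrightarrow> y \<in> I \<Longrightarrow> x \<oplus> y \<in> I"
    and ideal_minus: "x \<in> I \<Longrightarrow> y \<in> I \<Longrightarrow> x \<ominus> y \<in> I"
    and ideal_mult: "r \<in> carrier R \<Longrightarrow> x \<in> I \<Longrightarrow> r \<otimes> x \<in> I"
    and ideal_mult': "r \<in> carrier R \<Longrightarrow> x \<in> I \<Longrightarrow> x \<otimes> r \<in> I"
proof -
  interpret I: ideal I R by (rule assms)
  show "x \<in> I \<Longrightarrow> x \<in> carrier R" by (rule I.Icarr)
  show "\<zero> \<in> I" by simp
  show "x \<in> I \<Longrightarrow> y \<in> I \<Longrightarrow> x \<oplus> y \<in> I" by simp
  show "x \<in> I \<Longrightarrow> y \<in> I \<Longrightarrow> x \<ominus> y \<in> I" by (simp add: a_minus_def)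
  show "r \<in> carrier R \<Longrightarrow> x \<in> I \<Longrightarrow> r \<otimes> x \<in> I" by (rule I.I_l_closed)
  show "r \<in> carrier R \<Longrightarrow> x \<in> I \<Longrightarrow> x \<otimes> r \<in> I" by (rule I.I_r_closed)
qed

lemma (in cring) ideal_add_cancel:
  assumes "ideal I R" "x \<oplus> y \<in> I" "x \<in> I" "y \<in> carrier R"
  shows "y \<in> I"
proof -
  have c: "x \<in> carrier R" using ideal_carr assms by blast
  have "y = (x \<oplus> y) \<ominus> x" using assms c by algebra
  then show ?thesis using ideal_minus[OF assms(1,2,3)] by simp
qed

lemma (in cring) prime_facts:
  assumes "primeideal Q R"
  shows prime_ideal: "ideal Q R"
    and prime_notone: "\<one> \<notin> Q"
    and prime_mult: "a \<in> carrier R \<Longrightarrow> b \<in> carrier R \<Longrightarrow> a \<otimes> b \<in> Q \<Longrightarrow> a \<in> Q \<or> b \<in> Q"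
proof -
  interpret Q: primeideal Q R by (rule assms)
  show "ideal Q R" ..
  show "\<one> \<notin> Q" using Q.one_imp_carrier Q.I_notcarr by blast
  show "a \<in> carrier R \<Longrightarrow> b \<in> carrier R \<Longrightarrow> a \<otimes> b \<in> Q \<Longrightarrow> a \<in> Q \<or> b \<in> Q" by (rule Q.I_prime)
qed

lemma (in cring) prime_compl:
  assumes "primeideal Q R"
  shows "\<one> \<in> carrier R - Q"
    and "s \<in> carrier R - Q \<Longrightarrow> t \<in> carrier R - Q \<Longrightarrow> s \<otimes> t \<in> carrier R - Q"
  using prime_facts[OF assms] by auto

lemma (in cring) primeI:
  assumes "ideal Q R" "\<one> \<notin> Q"
    "\<And>a b. a \<in> carrier R \<Longrightarrow> b \<in> carrier R \<Longrightarrow> a \<otimes> b \<in> Q \<Longrightarrow> a \<in> Q \<or> b \<in> Q"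
  shows "primeideal Q R"
  by (rule primeidealI) (use assms is_cring in auto)

text \<open>The contraction to \<open>R\<close> of the extension of \<open>U\<close> to \<open>R\<^sub>Q\<close>. Membership in \<open>saturate Q U\<close> expresses
  that an element lies in \<open>U\<close> locally at \<open>Q\<close>, without leaving \<open>R\<close>.\<close>

definition (in cring) saturate :: "'a set \<Rightarrow> 'a set \<Rightarrow> 'a set" where
  "saturate Q U = {r \<in> carrier R. \<exists>s\<in>carrier R - Q. s \<otimes> r \<in> U}"

definition (in cring) colon :: "'a set \<Rightarrow> 'a \<Rightarrow> 'a set" where
  "colon V z = {r \<in> carrier R. r \<otimes> z \<in> V}"

text \<open>The ideal \<open>V + aU\<close>. With \<open>U = R\<close> it is \<open>V + (a)\<close>.\<close>

definition (in cring) adjoin :: "'a set \<Rightarrow> 'a \<Rightarrow> 'a set \<Rightarrow> 'a set" where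
  "adjoin V a U = {v \<oplus> a \<otimes> u | v u. v \<in> V \<and> u \<in> U}"

lemma (in cring) saturateI: "s \<in> carrier R \<Longrightarrow> s \<notin> Q \<Longrightarrow> r \<in> carrier R \<Longrightarrow> s \<otimes> r \<in> U \<Longrightarrow> r \<in> saturate Q U"
  by (auto simp: saturate_def)

lemma (in cring) saturateE:
  assumes "r \<in> saturate Q U"
  obtains s where "s \<in> carrier R" "s \<notin> Q" "r \<in> carrier R" "s \<otimes> r \<in> U"
  using assms by (auto simp: saturate_def)

lemma (in cring) adjoinI: "v \<in> V \<Longrightarrow> u \<in> U \<Longrightarrow> v \<oplus> a \<otimes> u \<in> adjoin V a U"
  by (auto simp: adjoin_def)

lemma (in cring) adjoinE:
  assumes "x \<in> adjoin V a U" obtains v u where "v \<in> V" "u \<in> U" "x = v \<oplus> a \<otimes> u"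
  using assms by (auto simp: adjoin_def)

lemma (in cring) ideal_saturate:
  assumes Q: "primeideal Q R" and U: "ideal U R"
  shows "ideal (saturate Q U) R"
proof (rule ideal_of_closure)
  show "saturate Q U \<subseteq> carrier R" by (auto simp: saturate_def)
  show "\<zero> \<in> saturate Q U"
    by (rule saturateI[of \<one>]) (use prime_compl[OF Q] ideal_zero[OF U] in auto)
  fix x y assume "x \<in> saturate Q U" "y \<in> saturate Q U"
  then obtain s t where s: "s \<in> carrier R - Q" "x \<in> carrier R" "s \<otimes> x \<in> U"
    and t: "t \<in> carrier R - Q" "y \<in> carrier R" "t \<otimes> y \<in> U" by (auto elim!: saturateE)
  have c: "s \<in> carrier R" "t \<in> carrier R" using s t by auto
  have "(s \<otimes> t) \<otimes> (x \<oplus> y) = t \<otimes> (s \<otimes> x) \<oplus> s \<otimes> (t \<otimes> y)"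
    using c s(2) t(2) by algebra
  also have "\<dots> \<in> U" using s t ideal_add[OF U] ideal_mult[OF U] by simp
  finally show "x \<oplus> y \<in> saturate Q U"
    using saturateI[of "s \<otimes> t" Q "x \<oplus> y" U] prime_compl(2)[OF Q s(1) t(1)] s t by auto
next
  fix r x assume r: "r \<in> carrier R" "x \<in> saturate Q U"
  then obtain s where s: "s \<in> carrier R" "s \<notin> Q" "x \<in> carrier R" "s \<otimes> x \<in> U" by (auto elim!: saturateE)
  have "s \<otimes> (r \<otimes> x) = r \<otimes> (s \<otimes> x)" using r s by algebra
  then show "r \<otimes> x \<in> saturate Q U"
    using saturateI[of s Q "r \<otimes> x" U] s r ideal_mult[OF U] by auto
qed

lemma (in cring) saturate_incl:
  assumes Q: "primeideal Q R" and U: "ideal U R"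
  shows "U \<subseteq> saturate Q U"
proof
  fix x assume "x \<in> U"
  then show "x \<in> saturate Q U"
    using saturateI[of \<one> Q x U] prime_compl[OF Q] ideal_carr[OF U] by auto
qed

lemma (in cring) saturate_mono: "U \<subseteq> V \<Longrightarrow> saturate Q U \<subseteq> saturate Q V"
  by (auto simp: saturate_def)

lemma (in cring) saturate_multD:
  assumes Q: "primeideal Q R" and "s \<in> carrier R" "s \<notin> Q" "x \<in> carrier R" "s \<otimes> x \<in> saturate Q U"
  shows "x \<in> saturate Q U"
proof -
  obtain t where t: "t \<in> carrier R" "t \<notin> Q" "t \<otimes> (s \<otimes> x) \<in> U" using assms by (auto elim!: saturateE)
  then have "(t \<otimes> s) \<otimes> x \<in> U" using assms t by (simp add: m_assoc)
  then show ?thesis using saturateI[of "t \<otimes> s" Q x U] prime_compl(2)[OF Q, of t s] t assms by auto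
qed

lemma (in cring) saturate_saturate:
  assumes Q: "primeideal Q R" and U: "ideal U R"
  shows "saturate Q (saturate Q U) = saturate Q U"
proof
  show "saturate Q (saturate Q U) \<subseteq> saturate Q U"
    using saturate_multD[OF Q] by (meson saturateE subsetI)
qed (rule saturate_incl[OF Q ideal_saturate[OF Q U]])

lemma (in cring) saturate_carrier:
  assumes Q: "primeideal Q R"
  shows "saturate Q (carrier R) = carrier R"
  using saturate_incl[OF Q oneideal] by (auto simp: saturate_def)

lemma (in cring) ideal_colon:
  assumes V: "ideal V R" and z: "z \<in> carrier R"
  shows "ideal (colon V z) R"
proof (rule ideal_of_closure)
  fix x y assume "x \<in> colon V z" "y \<in> colon V z"
  then show "x \<oplus> y \<in> colon V z" using ideal_add[OF V] z by (auto simp: colon_def l_distr)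
next
  fix r x assume "r \<in> carrier R" "x \<in> colon V z"
  then show "r \<otimes> x \<in> colon V z" using ideal_mult[OF V] z by (auto simp: colon_def m_assoc)
qed (use ideal_zero[OF V] z in \<open>auto simp: colon_def\<close>)

lemma (in cring) ideal_adjoin:
  assumes V: "ideal V R" and a: "a \<in> carrier R" and U: "ideal U R"
  shows "ideal (adjoin V a U) R"
proof (rule ideal_of_closure)
  show "adjoin V a U \<subseteq> carrier R" using ideal_carr[OF V] ideal_carr[OF U] a by (auto elim!: adjoinE)
  have "\<zero> = \<zero> \<oplus> a \<otimes> \<zero>" using a by simp
  then show "\<zero> \<in> adjoin V a U" using adjoinI[OF ideal_zero[OF V] ideal_zero[OF U]] by metis
  fix x y assume "x \<in> adjoin V a U" "y \<in> adjoin V a U"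
  then obtain v u v' u' where e: "v \<in> V" "u \<in> U" "x = v \<oplus> a \<otimes> u" "v' \<in> V" "u' \<in> U" "y = v' \<oplus> a \<otimes> u'"
    by (auto elim!: adjoinE)
  note c = ideal_carr[OF V e(1)] ideal_carr[OF V e(4)] ideal_carr[OF U e(2)] ideal_carr[OF U e(5)]
  have "x \<oplus> y = (v \<oplus> v') \<oplus> a \<otimes> (u \<oplus> u')" unfolding e(3,6) using c a by algebra
  then show "x \<oplus> y \<in> adjoin V a U" using adjoinI ideal_add[OF V] ideal_add[OF U] e by metis
next
  fix r x assume r: "r \<in> carrier R" and "x \<in> adjoin V a U"
  then obtain v u where e: "v \<in> V" "u \<in> U" "x = v \<oplus> a \<otimes> u" by (auto elim!: adjoinE)
  note c = ideal_carr[OF V e(1)] ideal_carr[OF U e(2)]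
  have "r \<otimes> x = (r \<otimes> v) \<oplus> a \<otimes> (r \<otimes> u)" unfolding e using c r a by algebra
  then show "r \<otimes> x \<in> adjoin V a U" using adjoinI ideal_mult[OF V r] ideal_mult[OF U r] e by metis
qed

lemma (in cring) adjoin_incl:
  assumes V: "ideal V R" and a: "a \<in> carrier R" and U: "ideal U R"
  shows "V \<subseteq> adjoin V a U"
proof
  fix v assume "v \<in> V"
  then have "v = v \<oplus> a \<otimes> \<zero>" using ideal_carr[OF V] a by simp
  then show "v \<in> adjoin V a U" using adjoinI[OF \<open>v \<in> V\<close> ideal_zero[OF U]] by metis
qed

lemma (in cring) adjoin_mem:
  assumes V: "ideal V R" and a: "a \<in> carrier R" and U: "ideal U R" and u: "u \<in> U"
  shows "a \<otimes> u \<in> adjoin V a U"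
proof -
  have "a \<otimes> u = \<zero> \<oplus> a \<otimes> u" using ideal_carr[OF U] a u by simp
  then show ?thesis using adjoinI[OF ideal_zero[OF V] u] by metis
qed

lemma (in cring) adjoin_gen:
  assumes V: "ideal V R" and a: "a \<in> carrier R"
  shows "a \<in> adjoin V a (carrier R)"
  using adjoin_mem[OF V a oneideal one_closed] a by simp

lemma (in cring) adjoin_mono: "V \<subseteq> V' \<Longrightarrow> U \<subseteq> U' \<Longrightarrow> adjoin V a U \<subseteq> adjoin V' a U'"
  by (auto simp: adjoin_def)

lemma (in cring) adjoin_subset:
  assumes K: "ideal K R" and "V \<subseteq> K" "\<And>u. u \<in> U \<Longrightarrow> a \<otimes> u \<in> K"
  shows "adjoin V a U \<subseteq> K"
  using assms(2,3) ideal_add[OF K] by (auto elim!: adjoinE)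

lemma (in cring) adjoin_gen_subset:
  assumes K: "ideal K R" and "V \<subseteq> K" "a \<in> K"
  shows "adjoin V a (carrier R) \<subseteq> K"
  by (rule adjoin_subset[OF K assms(2)]) (rule ideal_mult'[OF K _ assms(3)])

section \<open>Noetherian rings\<close>

locale noeth_cring = cring R + noetherian_ring R for R (structure)

lemma (in noeth_cring) maximal_ideal_with:
  assumes "P I" "\<And>K. P K \<Longrightarrow> ideal K R"
  shows "\<exists>M. P M \<and> (\<forall>N. P N \<longrightarrow> M \<subseteq> N \<longrightarrow> N = M)"
proof -
  have "\<exists>M\<in>Collect P. \<forall>N\<in>Collect P. M \<subseteq> N \<longrightarrow> N = M"
  proof (rule subset_Zorn_nonempty)
    show "Collect P \<noteq> {}" using assms(1) by auto
    fix C assume C: "C \<noteq> {}" "subset.chain (Collect P) C"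
    then have "subset.chain {I. ideal I R} C"
      using assms(2) unfolding subset.chain_def by auto
    then have "\<Union>C \<in> C" using ideal_chain_is_trivial C(1) by blast
    then show "\<Union>C \<in> Collect P" using C(2) unfolding subset.chain_def by auto
  qed
  then show ?thesis by auto
qed

lemma (in noeth_cring) noeth_induct [consumes 1, case_names step]:
  assumes "ideal I R"
    and step: "\<And>I. ideal I R \<Longrightarrow> (\<And>K. ideal K R \<Longrightarrow> I \<subset> K \<Longrightarrow> P K) \<Longrightarrow> P I"
  shows "P I"
proof (rule ccontr)
  assume "\<not> P I"
  then have "\<exists>M. (ideal M R \<and> \<not> P M) \<and> (\<forall>N. ideal N R \<and> \<not> P N \<longrightarrow> M \<subseteq> N \<longrightarrow> N = M)"
    by (intro maximal_ideal_with[of _ I]) (use assms(1) in auto)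
  then obtain M where M: "ideal M R" "\<not> P M" "\<And>N. ideal N R \<Longrightarrow> \<not> P N \<Longrightarrow> M \<subseteq> N \<Longrightarrow> N = M"
    by blast
  have "P M" using step[OF M(1)] M(3) by blast
  then show False using M(2) by blast
qed

lemma (in noeth_cring) ascending_stabilises:
  assumes "\<And>n::nat. ideal (F n) R" "\<And>n. F n \<subseteq> F (Suc n)"
  shows "\<exists>n. \<forall>m\<ge>n. F m = F n"
proof -
  have "\<exists>M. M \<in> range F \<and> (\<forall>N. N \<in> range F \<longrightarrow> M \<subseteq> N \<longrightarrow> N = M)"
    by (rule maximal_ideal_with[of _ "F 0"]) (use assms(1) in auto)
  then obtain M where M: "M \<in> range F" "\<And>N. N \<in> range F \<Longrightarrow> M \<subseteq> N \<Longrightarrow> N = M"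
    by blast
  then obtain n where n: "M = F n" by auto
  have "F m = F n" if "m \<ge> n" for m
    using M(2)[of "F m"] n lift_Suc_mono_le[of F n m] assms(2) that by auto
  then show ?thesis by blast
qed

text \<open>A maximal member among the ideals \<open>(V : z)\<close>, \<open>z \<notin> V\<close>, is prime: an associated prime of \<open>R/V\<close>.\<close>

lemma (in noeth_cring) colon_prime_exists:
  assumes V: "ideal V R" and "\<one> \<notin> V"
  shows "\<exists>z\<in>carrier R. z \<notin> V \<and> primeideal (colon V z) R"
proof -
  let ?A = "{colon V z | z. z \<in> carrier R - V}"
  have "\<one> \<in> carrier R - V" using assms by auto
  then have "\<exists>M. M \<in> ?A \<and> (\<forall>N. N \<in> ?A \<longrightarrow> M \<subseteq> N \<longrightarrow> N = M)"
    by (intro maximal_ideal_with[of _ "colon V \<one>"]) (use ideal_colon[OF V] in auto)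
  then obtain M where "M \<in> ?A" and max: "\<And>N. N \<in> ?A \<Longrightarrow> M \<subseteq> N \<Longrightarrow> N = M"
    by blast
  then obtain z where z: "z \<in> carrier R" "z \<notin> V" "M = colon V z" by auto
  have "primeideal (colon V z) R"
  proof (rule primeI)
    show "ideal (colon V z) R" by (rule ideal_colon[OF V z(1)])
    show "\<one> \<notin> colon V z" using z by (simp add: colon_def)
    fix a b assume ab: "a \<in> carrier R" "b \<in> carrier R" "a \<otimes> b \<in> colon V z"
    show "a \<in> colon V z \<or> b \<in> colon V z"
    proof (rule disjCI)
      assume "b \<notin> colon V z"
      then have bz: "b \<otimes> z \<in> carrier R - V" using ab z by (auto simp: colon_def)
      have "M \<subseteq> colon V (b \<otimes> z)"
      proof
        fix r assume "r \<in> M"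
        then have r: "r \<in> carrier R" "r \<otimes> z \<in> V" using z by (auto simp: colon_def)
        have "r \<otimes> (b \<otimes> z) = b \<otimes> (r \<otimes> z)" using r ab z by algebra
        then show "r \<in> colon V (b \<otimes> z)" using ideal_mult[OF V ab(2) r(2)] r(1) by (simp add: colon_def)
      qed
      then have "colon V (b \<otimes> z) = M" using max bz by blast
      moreover have "a \<in> colon V (b \<otimes> z)" using ab z by (auto simp: colon_def m_assoc)
      ultimately show "a \<in> colon V z" using z by simp
    qed
  qed
  then show ?thesis using z by blast
qed

text \<open>Noetherian induction: if \<open>ab \<in> I\<close> with \<open>a, b \<notin> I\<close>, every prime over \<open>I\<close> lies over \<open>I + (a)\<close> or
  over \<open>I + (b)\<close>.\<close>

lemma (in noeth_cring) finitely_many_primes_below: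
  assumes "ideal I R"
  shows "\<exists>F. finite F \<and> (\<forall>P\<in>F. primeideal P R \<and> I \<subseteq> P) \<and>
    (\<forall>Q. primeideal Q R \<and> I \<subseteq> Q \<longrightarrow> (\<exists>P\<in>F. P \<subseteq> Q))"
  using assms
proof (induction rule: noeth_induct)
  case (step I)
  show ?case
  proof (cases "\<one> \<in> I \<or> primeideal I R")
    case True
    then show ?thesis
    proof
      assume "\<one> \<in> I"
      then show ?thesis using prime_notone by (intro exI[of _ "{}"]) auto
    next
      assume "primeideal I R"
      then show ?thesis by (intro exI[of _ "{I}"]) auto
    qed
  next
    case False
    then obtain a b where ab: "a \<in> carrier R" "b \<in> carrier R" "a \<otimes> b \<in> I" "a \<notin> I" "b \<notin> I"
      using primeI[OF step(1)] by blast
    let ?A = "adjoin I a (carrier R)" and ?B = "adjoin I b (carrier R)"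
    have A: "ideal ?A R" "I \<subset> ?A"
      using ideal_adjoin[OF step(1) ab(1) oneideal] adjoin_incl[OF step(1) ab(1) oneideal]
        adjoin_gen[OF step(1) ab(1)] ab by auto
    have B: "ideal ?B R" "I \<subset> ?B"
      using ideal_adjoin[OF step(1) ab(2) oneideal] adjoin_incl[OF step(1) ab(2) oneideal]
        adjoin_gen[OF step(1) ab(2)] ab by auto
    obtain F where F: "finite F" "\<forall>P\<in>F. primeideal P R \<and> ?A \<subseteq> P"
      "\<forall>Q. primeideal Q R \<and> ?A \<subseteq> Q \<longrightarrow> (\<exists>P\<in>F. P \<subseteq> Q)" using step(2)[OF A] by blast
    obtain G where G: "finite G" "\<forall>P\<in>G. primeideal P R \<and> ?B \<subseteq> P"
      "\<forall>Q. primeideal Q R \<and> ?B \<subseteq> Q \<longrightarrow> (\<exists>P\<in>G. P \<subseteq> Q)" using step(2)[OF B] by blast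
    have "\<exists>P\<in>F \<union> G. P \<subseteq> Q" if Q: "primeideal Q R" "I \<subseteq> Q" for Q
    proof -
      have "a \<in> Q \<or> b \<in> Q" using prime_mult[OF Q(1) ab(1,2)] ab(3) Q(2) by blast
      then have "?A \<subseteq> Q \<or> ?B \<subseteq> Q" using adjoin_gen_subset[OF prime_ideal[OF Q(1)] Q(2)] by blast
      then show ?thesis using F(3)[rule_format, of Q] G(3)[rule_format, of Q] Q(1) by auto
    qed
    moreover have "\<forall>P\<in>F \<union> G. primeideal P R \<and> I \<subseteq> P" using F(2) G(2) A(2) B(2) by blast
    ultimately show ?thesis using F(1) G(1) by (intro exI[of _ "F \<union> G"]) simp
  qed
qed

lemma (in noeth_cring) minimal_primes_finite:
  assumes "ideal I R"
  shows "finite (minimal_primes R I)"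
    and "primeideal Q R \<Longrightarrow> I \<subseteq> Q \<Longrightarrow> \<exists>P\<in>minimal_primes R I. P \<subseteq> Q"
proof -
  obtain F where F: "finite F" "\<forall>P\<in>F. primeideal P R \<and> I \<subseteq> P"
      "\<forall>Q. primeideal Q R \<and> I \<subseteq> Q \<longrightarrow> (\<exists>P\<in>F. P \<subseteq> Q)"
    using finitely_many_primes_below[OF assms] by blast
  have "minimal_primes R I \<subseteq> F"
    using F by (auto simp: minimal_primes_def) metis
  then show "finite (minimal_primes R I)" using F(1) finite_subset by blast
  assume Q: "primeideal Q R" "I \<subseteq> Q"
  let ?G = "{P \<in> F. P \<subseteq> Q}"
  have "finite ?G" "?G \<noteq> {}" using F Q by auto
  then obtain P where P: "P \<in> ?G" "\<forall>P'\<in>?G. P' \<subseteq> P \<longrightarrow> P = P'"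
    using finite_has_minimal[of ?G] by blast
  have "P \<in> minimal_primes R I"
    unfolding minimal_primes_def
  proof (intro CollectI conjI allI impI)
    show "primeideal P R" "I \<subseteq> P" using P F by auto
    fix Q' assume Q': "primeideal Q' R \<and> I \<subseteq> Q' \<and> Q' \<subseteq> P"
    then obtain P' where "P' \<in> F" "P' \<subseteq> Q'" using F by blast
    then show "Q' = P" using P Q' by (metis (lifting) mem_Collect_eq order_trans subset_antisym)
  qed
  then show "\<exists>P\<in>minimal_primes R I. P \<subseteq> Q" using P by blast
qed

lemma (in noeth_cring) proper_ideal_in_prime:
  assumes I: "ideal I R" and "\<one> \<notin> I"
  shows "\<exists>P. primeideal P R \<and> I \<subseteq> P"
proof -
  obtain z where z: "z \<in> carrier R" "primeideal (colon I z) R" using colon_prime_exists[OF assms] by blast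
  have "I \<subseteq> colon I z" using ideal_mult'[OF I z(1)] ideal_carr[OF I] by (auto simp: colon_def)
  then show ?thesis using z by blast
qed

text \<open>An ideal that is maximal among those disjoint from a multiplicative set is prime.\<close>

lemma (in noeth_cring) prime_avoiding:
  assumes I: "ideal I R" and S: "S \<subseteq> carrier R" "\<one> \<in> S" "\<And>s t. s \<in> S \<Longrightarrow> t \<in> S \<Longrightarrow> s \<otimes> t \<in> S"
    and disj: "S \<inter> I = {}"
  shows "\<exists>P. primeideal P R \<and> I \<subseteq> P \<and> S \<inter> P = {}"
proof -
  let ?A = "\<lambda>K. ideal K R \<and> I \<subseteq> K \<and> S \<inter> K = {}"
  have "\<exists>M. ?A M \<and> (\<forall>N. ?A N \<longrightarrow> M \<subseteq> N \<longrightarrow> N = M)"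
    by (rule maximal_ideal_with[of _ I]) (use I disj in auto)
  then obtain M where M: "ideal M R" "I \<subseteq> M" "S \<inter> M = {}" and max: "\<And>N. ?A N \<Longrightarrow> M \<subseteq> N \<Longrightarrow> N = M"
    by blast
  have "primeideal M R"
  proof (rule primeI[OF M(1)])
    show "\<one> \<notin> M" using S M by auto
    fix a b assume ab: "a \<in> carrier R" "b \<in> carrier R" "a \<otimes> b \<in> M"
    have key: "\<exists>s\<in>S. \<exists>m\<in>M. \<exists>r\<in>carrier R. s = m \<oplus> c \<otimes> r" if c: "c \<in> carrier R" "c \<notin> M" for c
    proof -
      let ?C = "adjoin M c (carrier R)"
      have "ideal ?C R" "M \<subseteq> ?C" "c \<in> ?C"
        using ideal_adjoin[OF M(1) c(1) oneideal] adjoin_incl[OF M(1) c(1) oneideal] adjoin_gen[OF M(1) c(1)] by auto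
      then have "S \<inter> ?C \<noteq> {}" using max[of ?C] c M by auto
      then show ?thesis by (auto elim!: adjoinE)
    qed
    show "a \<in> M \<or> b \<in> M"
    proof (rule ccontr)
      assume "\<not> ?thesis"
      then obtain s m r s' m' r' where e: "s \<in> S" "m \<in> M" "r \<in> carrier R" "s = m \<oplus> a \<otimes> r"
        "s' \<in> S" "m' \<in> M" "r' \<in> carrier R" "s' = m' \<oplus> b \<otimes> r'" using key ab by metis
      note c = ideal_carr[OF M(1) e(2)] ideal_carr[OF M(1) e(6)]
      have "s \<otimes> s' = s' \<otimes> m \<oplus> (a \<otimes> r \<otimes> m' \<oplus> (r \<otimes> r') \<otimes> (a \<otimes> b))"
        unfolding e(4,8) using c e(3,7) ab by algebra
      also have "\<dots> \<in> M" using ideal_add[OF M(1)] ideal_mult[OF M(1)] e ab S by (auto simp del: m_assoc)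
      finally show False using S(3)[OF e(1,5)] M by blast
    qed
  qed
  then show ?thesis using M by blast
qed

section \<open>Nakayama's lemma and the principal ideal theorem\<close>

text \<open>The ideal \<open>V + a\<^sub>1U + \<dots> + a\<^sub>kU\<close>; for \<open>U = R\<close> this is \<open>V + (a\<^sub>1, \<dots>, a\<^sub>k)\<close>.\<close>

primrec (in cring) adjoin_list :: "'a set \<Rightarrow> 'a set \<Rightarrow> 'a list \<Rightarrow> 'a set" where
  "adjoin_list V U [] = V"
| "adjoin_list V U (a # as) = adjoin_list (adjoin V a U) U as"

lemma (in cring) ideal_adjoin_list:
  "ideal V R \<Longrightarrow> ideal U R \<Longrightarrow> set as \<subseteq> carrier R \<Longrightarrow> ideal (adjoin_list V U as) R"
  by (induction as arbitrary: V) (auto intro: ideal_adjoin)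

lemma (in cring) adjoin_list_incl:
  "ideal V R \<Longrightarrow> ideal U R \<Longrightarrow> set as \<subseteq> carrier R \<Longrightarrow> V \<subseteq> adjoin_list V U as"
proof (induction as arbitrary: V)
  case (Cons a as)
  then show ?case using adjoin_incl[of V a U] Cons.IH[of "adjoin V a U"] ideal_adjoin[of V a U] by auto
qed simp

lemma (in cring) adjoin_list_subset:
  "ideal K R \<Longrightarrow> V \<subseteq> K \<Longrightarrow> (\<And>a u. a \<in> set as \<Longrightarrow> u \<in> U \<Longrightarrow> a \<otimes> u \<in> K) \<Longrightarrow> adjoin_list V U as \<subseteq> K"
proof (induction as arbitrary: V)
  case (Cons a as)
  then show ?case using adjoin_subset[of K V U a] by simp
qed simp

lemma (in cring) adjoin_list_mem:
  "ideal V R \<Longrightarrow> ideal U R \<Longrightarrow> set as \<subseteq> carrier R \<Longrightarrow> a \<in> set as \<Longrightarrow> u \<in> U \<Longrightarrow> a \<otimes> u \<in> adjoin_list V U as"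
proof (induction as arbitrary: V)
  case (Cons b as)
  have i: "ideal (adjoin V b U) R" using Cons.prems ideal_adjoin[of V b U] by auto
  show ?case
  proof (cases "a = b")
    case True
    then have "a \<otimes> u \<in> adjoin V b U" using adjoin_mem[of V b U u] Cons.prems by auto
    then show ?thesis using adjoin_list_incl[OF i Cons.prems(2), of as] Cons.prems by auto
  next
    case False
    then show ?thesis using Cons.IH[OF i] Cons.prems by auto
  qed
qed simp

text \<open>Nakayama's lemma at \<open>Q\<close>: if \<open>N \<subseteq> V + x\<^sub>1N + \<dots> + x\<^sub>kN\<close> locally, with \<open>x\<^sub>i \<in> Q\<close>, then \<open>N \<subseteq> V\<close> locally. The chain condition replaces
  the usual determinant trick: take \<open>K \<supseteq> V\<close> maximal among the \<open>Q\<close>-saturated ideals that do not contain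
  \<open>N\<close>. For \<open>z \<in> N - K\<close> one has \<open>N \<subseteq> K + (z)\<close> locally, so \<open>tz \<in> K + Qz\<close> for some \<open>t \<notin> Q\<close>, which forces
  \<open>z\<close> into \<open>K\<close>.\<close>

theorem (in noeth_cring) nakayama:
  assumes Q: "primeideal Q R" and V: "ideal V R" and N: "ideal N R"
    and xs: "set xs \<subseteq> Q" and NV: "N \<subseteq> saturate Q (adjoin_list V N xs)"
  shows "N \<subseteq> saturate Q V"
proof (rule ccontr)
  assume neg: "\<not> N \<subseteq> saturate Q V"
  let ?A = "\<lambda>K. ideal K R \<and> V \<subseteq> K \<and> saturate Q K = K \<and> \<not> N \<subseteq> K"
  have "?A (saturate Q V)" using neg ideal_saturate[OF Q V] saturate_incl[OF Q V] saturate_saturate[OF Q V] by auto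
  then have "\<exists>K. ?A K \<and> (\<forall>L. ?A L \<longrightarrow> K \<subseteq> L \<longrightarrow> L = K)"
    by (rule maximal_ideal_with) auto
  then obtain K where K: "ideal K R" "V \<subseteq> K" "saturate Q K = K" "\<not> N \<subseteq> K"
    and max: "\<And>L. ?A L \<Longrightarrow> K \<subseteq> L \<Longrightarrow> L = K"
    by blast
  obtain z where z: "z \<in> N" "z \<notin> K" using K by auto
  have zc: "z \<in> carrier R" using ideal_carr[OF N z(1)] .
  have Qi: "ideal Q R" by (rule prime_ideal[OF Q])
  let ?L = "adjoin K z (carrier R)"
  let ?K1 = "saturate Q ?L"
  have Li: "ideal ?L R" by (rule ideal_adjoin[OF K(1) zc oneideal])
  have "K \<subseteq> ?K1" "z \<in> ?K1"
    using adjoin_incl[OF K(1) zc oneideal] adjoin_gen[OF K(1) zc] saturate_incl[OF Q Li] by auto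
  then have NK: "N \<subseteq> ?K1"
    using max[of ?K1] z K(2) ideal_saturate[OF Q Li] saturate_saturate[OF Q Li] by auto
  let ?D = "saturate Q (adjoin K z Q)"
  have Di: "ideal (adjoin K z Q) R" by (rule ideal_adjoin[OF K(1) zc Qi])
  have "adjoin_list V N xs \<subseteq> ?D"
  proof (rule adjoin_list_subset)
    show "ideal ?D R" by (rule ideal_saturate[OF Q Di])
    show "V \<subseteq> ?D" using K(2) adjoin_incl[OF K(1) zc Qi] saturate_incl[OF Q Di] by auto
    fix a u assume au: "a \<in> set xs" "u \<in> N"
    then have aQ: "a \<in> Q" using xs by auto
    have ac: "a \<in> carrier R" using ideal_carr[OF Qi aQ] .
    obtain t where t: "t \<in> carrier R" "t \<notin> Q" "u \<in> carrier R" "t \<otimes> u \<in> ?L"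
      using au NK by (auto elim!: saturateE)
    obtain k r where kr: "k \<in> K" "r \<in> carrier R" "t \<otimes> u = k \<oplus> z \<otimes> r" using t(4) by (auto elim!: adjoinE)
    have kc: "k \<in> carrier R" using ideal_carr[OF K(1) kr(1)] .
    have "t \<otimes> (a \<otimes> u) = a \<otimes> (t \<otimes> u)" using t ac by algebra
    also have "\<dots> = a \<otimes> k \<oplus> z \<otimes> (a \<otimes> r)" unfolding kr(3) using ac kc zc kr(2) by algebra
    also have "\<dots> \<in> adjoin K z Q"
      by (rule adjoinI) (use ideal_mult[OF K(1) ac kr(1)] ideal_mult'[OF Qi kr(2) aQ] in auto)
    finally show "a \<otimes> u \<in> ?D" using saturateI[of t Q "a \<otimes> u"] t ac by auto
  qed
  then have "z \<in> saturate Q ?D" using NV z(1) saturate_mono by blast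
  then have "z \<in> ?D" using saturate_saturate[OF Q Di] by simp
  then obtain t where t: "t \<in> carrier R" "t \<notin> Q" "t \<otimes> z \<in> adjoin K z Q" by (auto elim!: saturateE)
  then obtain k q where kq: "k \<in> K" "q \<in> Q" "t \<otimes> z = k \<oplus> z \<otimes> q" by (auto elim!: adjoinE)
  have c: "k \<in> carrier R" "q \<in> carrier R" using ideal_carr[OF K(1) kq(1)] ideal_carr[OF Qi kq(2)] .
  have "(t \<ominus> q) \<otimes> z = t \<otimes> z \<ominus> z \<otimes> q" using t c zc by algebra
  also have "\<dots> = k" unfolding kq(3) using c zc by algebra
  finally have e: "(t \<ominus> q) \<otimes> z \<in> K" using kq(1) by simp
  have "t = (t \<ominus> q) \<oplus> q" using t c by algebra
  then have "t \<ominus> q \<notin> Q" using t(2) kq(2) ideal_add[OF Qi] by metis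
  then have "z \<in> saturate Q K" using saturateI[of "t \<ominus> q" Q z K] t c zc e by auto
  then show False using K(3) z(2) by simp
qed

lemma (in cring) prime_power_mem:
  assumes P: "primeideal P R" and y: "y \<in> carrier R" "y [^] (n::nat) \<in> P"
  shows "y \<in> P"
  using y(2)
proof (induction n)
  case 0 then show ?case using prime_notone[OF P] by simp
next
  case (Suc n)
  then show ?case using prime_mult[OF P nat_pow_closed[OF y(1)] y(1)] by auto
qed

text \<open>If \<open>p\<close> is the only prime between \<open>K\<^sub>0\<close> and \<open>p\<close>, then \<open>(R/K\<^sub>0)\<^sub>p\<close> is Artinian. Noetherian induction on \<open>K\<close>:
  an associated prime \<open>(V : z)\<close> of the saturation \<open>V\<close> of \<open>K\<close> must be \<open>p\<close>, so \<open>z\<close> spans a simple module over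
  \<open>R\<^sub>p\<close> modulo \<open>V\<close>. A descending chain is then controlled by its sum with \<open>(z)\<close>, which stabilises by
  induction, and by its intersection with that simple module, which can drop only once.\<close>

lemma (in noeth_cring) dcc_above:
  assumes p: "primeideal p R" and K0: "ideal K0 R"
    and only: "\<And>p'. primeideal p' R \<Longrightarrow> K0 \<subseteq> p' \<Longrightarrow> p' \<subseteq> p \<Longrightarrow> p' = p"
    and "ideal K R"
  shows "K0 \<subseteq> K \<Longrightarrow> (\<And>n::nat. ideal (F n) R) \<Longrightarrow> (\<And>n. K \<subseteq> F n) \<Longrightarrow> (\<And>n. F (Suc n) \<subseteq> F n) \<Longrightarrow>
    \<exists>n. \<forall>m\<ge>n. saturate p (F m) = saturate p (F n)"
  using \<open>ideal K R\<close>
proof (induction arbitrary: F rule: noeth_induct)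
  case (step K)
  note Ki = step(1) and K0K = step(3) and Fi = step(4) and KF = step(5) and FS = step(6)
  have Fmono: "F m \<subseteq> F n" if "n \<le> m" for m n using lift_Suc_antimono_le[of F n m] FS that by auto
  show ?case
  proof (cases "\<one> \<in> saturate p K")
    case True
    have "saturate p (F m) = carrier R" for m
    proof -
      have "\<one> \<in> saturate p (F m)" using True saturate_mono[OF KF[of m]] by auto
      then show ?thesis using ideal.one_imp_carrier[OF ideal_saturate[OF p Fi[of m]]] by simp
    qed
    then show ?thesis by auto
  next
    case False
    let ?V = "saturate p K"
    have Vi: "ideal ?V R" by (rule ideal_saturate[OF p Ki])
    obtain z where z: "z \<in> carrier R" "z \<notin> ?V" and pr: "primeideal (colon ?V z) R"
      using colon_prime_exists[OF Vi False] by blast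
    have "K \<subseteq> colon ?V z"
      using saturate_incl[OF p Ki] ideal_mult'[OF Vi z(1)] ideal_carr[OF Ki] by (auto simp: colon_def)
    moreover have "colon ?V z \<subseteq> p"
      using saturate_multD[OF p _ _ z(1), of _ K] z(2) by (auto simp: colon_def)
    ultimately have cp: "colon ?V z = p" using only[OF pr] K0K by auto
    \<comment> \<open>Modulo \<open>V\<close>, the multiples of \<open>z\<close> now form a one-dimensional space over the residue field at \<open>p\<close>.\<close>
    let ?K' = "adjoin ?V z (carrier R)"
    have K'i: "ideal ?K' R" by (rule ideal_adjoin[OF Vi z(1) oneideal])
    have VK': "?V \<subseteq> ?K'" "z \<in> ?K'" using adjoin_incl[OF Vi z(1) oneideal] adjoin_gen[OF Vi z(1)] by auto
    then have KK': "K \<subset> ?K'" using saturate_incl[OF p Ki] z(2) by auto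
    define G where "G n = adjoin (saturate p (F n)) z (carrier R)" for n
    have Si: "ideal (saturate p (F n)) R" for n by (rule ideal_saturate[OF p Fi])
    have Gi: "ideal (G n) R" for n unfolding G_def by (rule ideal_adjoin[OF Si z(1) oneideal])
    have "\<exists>n. \<forall>m\<ge>n. saturate p (G m) = saturate p (G n)"
    proof (rule step(2)[OF K'i KK' _ Gi])
      show "K0 \<subseteq> ?K'" using K0K KK' by auto
      show "?K' \<subseteq> G n" for n unfolding G_def by (rule adjoin_mono) (use saturate_mono[OF KF] in auto)
      show "G (Suc n) \<subseteq> G n" for n unfolding G_def by (rule adjoin_mono) (use saturate_mono[OF FS] in auto)
    qed
    then obtain N where N: "\<And>m. m \<ge> N \<Longrightarrow> saturate p (G m) = saturate p (G N)" by blast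
    have SG: "saturate p (F n) \<subseteq> G n" for n unfolding G_def by (rule adjoin_incl[OF Si z(1) oneideal])
    show ?thesis
    proof (cases "\<forall>n. z \<in> saturate p (F n)")
      case True
      have "G n = saturate p (F n)" for n
      proof
        show "G n \<subseteq> saturate p (F n)" unfolding G_def by (rule adjoin_gen_subset[OF Si]) (use True in auto)
      qed (rule SG)
      then have "saturate p (G n) = saturate p (F n)" for n using saturate_saturate[OF p Fi] by simp
      then show ?thesis using N by blast
    next
      case False
      \<comment> \<open>From \<open>n0\<close> on, \<open>F n\<close> meets \<open>V + (z)\<close> in \<open>V\<close> only (locally), so that \<open>F n\<close> can be recovered
          from \<open>F n + (z)\<close>.\<close>
      then obtain n0 where "z \<notin> saturate p (F n0)" by auto
      then have zn: "z \<notin> saturate p (F n)" if "n \<ge> n0" for n using saturate_mono[OF Fmono[OF that]] by auto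
      define M where "M = max N n0"
      have "saturate p (F m) = saturate p (F M)" if "m \<ge> M" for m
      proof
        show "saturate p (F m) \<subseteq> saturate p (F M)" by (rule saturate_mono[OF Fmono[OF that]])
        show "saturate p (F M) \<subseteq> saturate p (F m)"
        proof
          fix a assume a: "a \<in> saturate p (F M)"
          then have "a \<in> saturate p (G M)" using SG saturate_incl[OF p Gi] by blast
          then have "a \<in> saturate p (G m)" using N[of m] N[of M] that by (auto simp: M_def)
          then obtain s where s: "s \<in> carrier R" "s \<notin> p" "a \<in> carrier R" "s \<otimes> a \<in> G m" by (auto elim!: saturateE)
          then obtain b r where br: "b \<in> saturate p (F m)" "r \<in> carrier R" "s \<otimes> a = b \<oplus> z \<otimes> r"
            unfolding G_def by (auto elim!: adjoinE)
          have bc: "b \<in> carrier R" using ideal_carr[OF Si br(1)] .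
          have bM: "b \<in> saturate p (F M)" using br(1) saturate_mono[OF Fmono[OF that]] by auto
          have "b \<oplus> r \<otimes> z \<in> saturate p (F M)"
            using br(3) ideal_mult[OF Si s(1) a] m_comm[OF br(2) z(1)] by simp
          then have "r \<otimes> z \<in> saturate p (F M)" using ideal_add_cancel[OF Si _ bM] br z by auto
          then have "r \<in> p" using saturate_multD[OF p br(2) _ z(1)] zn[of M] by (auto simp: M_def)
          then have "r \<otimes> z \<in> ?V" using cp by (auto simp: colon_def)
          then have "r \<otimes> z \<in> saturate p (F m)" using saturate_mono[OF KF] by blast
          then have "s \<otimes> a \<in> saturate p (F m)"
            using br ideal_add[OF Si br(1)] m_comm[OF br(2) z(1)] by simp
          then show "a \<in> saturate p (F m)" using saturate_multD[OF p s(1,2,3)] by blast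
        qed
      qed
      then show ?thesis by blast
    qed
  qed
qed

text \<open>Krull's principal ideal theorem in the form used for chains of primes: modulo \<open>q\<^sub>0\<close>, the prime \<open>p\<close> has
  height at least two, so it cannot be minimal over \<open>x\<close>. Otherwise the descending chain of the ideals
  \<open>I\<^sub>n + (x)\<close>, with \<open>I\<^sub>n\<close> the \<open>q\<^sub>1\<close>-saturation of \<open>q\<^sub>0 + (y\<^sup>n)\<close> and \<open>y \<in> q\<^sub>1 - q\<^sub>0\<close>, would stabilise locally at
  \<open>p\<close>. Nakayama turns this into \<open>I\<^sub>n = I\<^sub>n\<^sub>+\<^sub>1\<close>, and cancelling \<open>y\<^sup>n\<close> produces an element of \<open>q\<^sub>0 + (y)\<close> outside
  \<open>q\<^sub>1\<close>, which is absurd.\<close>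

theorem (in noeth_cring) principal_ideal_theorem:
  assumes q0: "primeideal q0 R" and q1: "primeideal q1 R" and p: "primeideal p R"
    and lt: "q0 \<subset> q1" "q1 \<subset> p" and x: "x \<in> p"
  shows "\<exists>p'. primeideal p' R \<and> q0 \<subset> p' \<and> p' \<subset> p \<and> x \<in> p'"
proof (cases "x \<in> q1")
  case True
  then show ?thesis using q1 lt by blast
next
  case xq: False
  note i0 = prime_ideal[OF q0] and i1 = prime_ideal[OF q1] and ip = prime_ideal[OF p]
  have xc: "x \<in> carrier R" by (rule ideal_carr[OF ip x])
  show ?thesis
  proof (rule ccontr)
    assume neg: "\<not> ?thesis"
    let ?K0 = "adjoin q0 x (carrier R)"
    have K0: "ideal ?K0 R" by (rule ideal_adjoin[OF i0 xc oneideal])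
    have only: "p' = p" if "primeideal p' R" "?K0 \<subseteq> p'" "p' \<subseteq> p" for p'
    proof -
      have "x \<in> p'" "q0 \<subseteq> p'" using that adjoin_gen[OF i0 xc] adjoin_incl[OF i0 xc oneideal] by auto
      moreover have "x \<notin> q0" using xq lt by auto
      ultimately show ?thesis using neg that by blast
    qed
    obtain y where y: "y \<in> q1" "y \<notin> q0" using lt by auto
    have yc: "y \<in> carrier R" by (rule ideal_carr[OF i1 y(1)])
    define J where "J n = adjoin q0 (y [^] n) (carrier R)" for n :: nat
    have Ji: "ideal (J n) R" for n unfolding J_def by (rule ideal_adjoin[OF i0 _ oneideal]) (use yc in auto)
    have JS: "J (Suc n) \<subseteq> J n" for n
    proof -
      have "y [^] n \<otimes> y \<in> J n" unfolding J_def
        by (rule adjoin_mem[OF i0 _ oneideal yc]) (use yc in auto)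
      moreover have "q0 \<subseteq> J n" unfolding J_def by (rule adjoin_incl[OF i0 _ oneideal]) (use yc in auto)
      ultimately show ?thesis using adjoin_gen_subset[OF Ji[of n], of q0 "y [^] Suc n"] by (simp add: J_def)
    qed
    define I where "I n = saturate q1 (J n)" for n
    have Ii: "ideal (I n) R" for n unfolding I_def by (rule ideal_saturate[OF q1 Ji])
    have IS: "I (Suc n) \<subseteq> I n" for n unfolding I_def by (rule saturate_mono[OF JS])
    define F where "F n = adjoin (I n) x (carrier R)" for n
    have Fi: "ideal (F n) R" for n unfolding F_def by (rule ideal_adjoin[OF Ii xc oneideal])
    have FS: "F (Suc n) \<subseteq> F n" for n unfolding F_def by (rule adjoin_mono[OF IS]) simp
    have K0F: "?K0 \<subseteq> F n" for n unfolding F_def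
    proof (rule adjoin_mono)
      have "q0 \<subseteq> J n" unfolding J_def by (rule adjoin_incl[OF i0 _ oneideal]) (use yc in auto)
      then show "q0 \<subseteq> I n" unfolding I_def using saturate_incl[OF q1 Ji] by blast
    qed simp
    have "\<exists>n. \<forall>m\<ge>n. saturate p (F m) = saturate p (F n)"
      by (rule dcc_above[of p ?K0 ?K0 F, OF p K0 only K0 subset_refl Fi K0F FS])
    then obtain n where nm: "\<forall>m\<ge>n. saturate p (F m) = saturate p (F n)" ..
    have n: "saturate p (F (Suc n)) = saturate p (F n)" using nm[rule_format, of "Suc n"] by simp
    \<comment> \<open>\<open>I n \<subseteq> I (n+1) + (x)\<close> locally, and the coefficient of \<open>x\<close> lies in \<open>I n\<close> because \<open>x \<notin> q1\<close>.\<close>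
    have "I n \<subseteq> saturate p (adjoin_list (I (Suc n)) (I n) [x])"
    proof
      fix a assume a: "a \<in> I n"
      have "a \<in> F n" unfolding F_def using adjoin_incl[OF Ii xc oneideal] a by auto
      then have "a \<in> saturate p (F (Suc n))" unfolding n using saturate_incl[OF p Fi] by blast
      then obtain s where s: "s \<in> carrier R" "s \<notin> p" "a \<in> carrier R" "s \<otimes> a \<in> F (Suc n)" by (auto elim!: saturateE)
      then obtain b c where bc: "b \<in> I (Suc n)" "c \<in> carrier R" "s \<otimes> a = b \<oplus> x \<otimes> c"
        unfolding F_def by (auto elim!: adjoinE)
      have "b \<oplus> x \<otimes> c \<in> I n" using bc(3) ideal_mult[OF Ii s(1) a] by simp
      moreover have "b \<in> I n" using bc(1) IS by auto
      ultimately have "x \<otimes> c \<in> I n" using ideal_add_cancel[OF Ii] xc bc(2) by auto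
      then have "c \<in> I n" unfolding I_def using saturate_multD[OF q1 xc xq bc(2)] by blast
      then have "s \<otimes> a \<in> adjoin (I (Suc n)) x (I n)" unfolding bc(3) using adjoinI bc(1) by blast
      then show "a \<in> saturate p (adjoin_list (I (Suc n)) (I n) [x])" using saturateI s by simp
    qed
    then have "I n \<subseteq> saturate p (I (Suc n))" using nakayama[OF p Ii Ii, of "[x]"] x by auto
    also have "\<dots> \<subseteq> I (Suc n)"
    proof
      fix a assume "a \<in> saturate p (I (Suc n))"
      then obtain s where s: "s \<in> carrier R" "s \<notin> p" "a \<in> carrier R" "s \<otimes> a \<in> I (Suc n)" by (auto elim!: saturateE)
      then show "a \<in> I (Suc n)" unfolding I_def using saturate_multD[OF q1 s(1) _ s(3)] lt by blast
    qed
    finally have sub: "I n \<subseteq> I (Suc n)" .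
    have "y [^] n \<in> J n" unfolding J_def by (rule adjoin_gen[OF i0]) (use yc in auto)
    then have "y [^] n \<in> saturate q1 (J (Suc n))" using sub saturate_incl[OF q1 Ji] unfolding I_def by blast
    then obtain s where s: "s \<in> carrier R" "s \<notin> q1" "s \<otimes> y [^] n \<in> J (Suc n)" by (auto elim!: saturateE)
    then obtain v r where vr: "v \<in> q0" "r \<in> carrier R" "s \<otimes> y [^] n = v \<oplus> y [^] Suc n \<otimes> r"
      unfolding J_def by (auto elim!: adjoinE)
    have vc: "v \<in> carrier R" by (rule ideal_carr[OF i0 vr(1)])
    \<comment> \<open>\<open>y\<^sup>n\<close> cancels modulo \<open>q0\<close>, which leaves \<open>s \<in> q0 + (y) \<subseteq> q1\<close>, contrary to the choice of \<open>s\<close>.\<close>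
    define w where "w = y [^] n"
    have wc: "w \<in> carrier R" and e: "s \<otimes> w = v \<oplus> (w \<otimes> y) \<otimes> r"
      using vr(3) yc by (auto simp: w_def)
    have "(s \<ominus> y \<otimes> r) \<otimes> w = s \<otimes> w \<ominus> (w \<otimes> y) \<otimes> r" using s(1) vr(2) yc wc by algebra
    also have "\<dots> = v" unfolding e using vc wc yc vr(2) by algebra
    finally have "(s \<ominus> y \<otimes> r) \<otimes> w \<in> q0" using vr(1) by simp
    moreover have "w \<notin> q0" using prime_power_mem[OF q0 yc] y(2) unfolding w_def by blast
    ultimately have "s \<ominus> y \<otimes> r \<in> q0" using prime_mult[OF q0 _ wc] s(1) vr(2) yc by auto
    then have "(s \<ominus> y \<otimes> r) \<oplus> y \<otimes> r \<in> q1"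
      using lt ideal_add[OF i1] ideal_mult'[OF i1 vr(2) y(1)] by blast
    moreover have "(s \<ominus> y \<otimes> r) \<oplus> y \<otimes> r = s" using s(1) yc vr(2) by algebra
    ultimately show False using s(2) by simp
  qed
qed

lemma prime_chain_Cons:
  "prime_chain R (p # Ps) \<longleftrightarrow> primeideal p R \<and> (Ps = [] \<or> (p \<subset> hd Ps \<and> prime_chain R Ps))"
proof (cases Ps)
  case (Cons q Qs)
  then show ?thesis by (auto simp: prime_chain_def)
qed (auto simp: prime_chain_def)

lemma prime_chain_between:
  assumes "prime_chain R Ps" "p \<in> set Ps" shows "hd Ps \<subseteq> p" "p \<subseteq> last Ps"
proof -
  have ne: "Ps \<noteq> []" and so: "sorted_wrt (\<subset>) Ps" using assms(1) by (auto simp: prime_chain_def)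
  show "hd Ps \<subseteq> p" using so ne assms(2) by (cases Ps) auto
  have "sorted_wrt (\<subset>) (butlast Ps @ [last Ps])" "p \<in> set (butlast Ps @ [last Ps])" using so ne assms(2) by simp_all
  then show "p \<subseteq> last Ps" by (auto simp: sorted_wrt_append)
qed

text \<open>Any chain of primes whose last member contains \<open>x\<close> can be deformed, keeping its two ends and its length, so that
  already its second member contains \<open>x\<close>: the principal ideal theorem pushes \<open>x\<close> down one step at a time.\<close>

lemma (in noeth_cring) chain_through:
  assumes "prime_chain R (p # Ps)" "Ps \<noteq> []" "x \<in> last Ps"
  shows "\<exists>Qs. Qs \<noteq> [] \<and> prime_chain R (p # Qs) \<and> length Qs = length Ps \<and> last Qs = last Ps \<and> x \<in> hd Qs"
  using assms
proof (induction Ps arbitrary: p)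
  case (Cons q Ps)
  show ?case
  proof (cases "Ps = []")
    case True
    then show ?thesis using Cons.prems by (intro exI[of _ "[q]"]) auto
  next
    case False
    have c: "primeideal p R" "p \<subset> q" "prime_chain R (q # Ps)" using Cons.prems(1) by (auto simp: prime_chain_Cons)
    obtain Qs where Qs: "Qs \<noteq> []" "prime_chain R (q # Qs)" "length Qs = length Ps" "last Qs = last Ps" "x \<in> hd Qs"
      using Cons.IH[OF c(3) False] Cons.prems(3) False by auto
    have h: "primeideal q R" "q \<subset> hd Qs" "prime_chain R Qs" using Qs(1,2) by (auto simp: prime_chain_Cons)
    have "primeideal (hd Qs) R" using h(3) Qs(1) by (auto simp: prime_chain_def)
    then obtain q' where q': "primeideal q' R" "p \<subset> q'" "q' \<subset> hd Qs" "x \<in> q'"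
      using principal_ideal_theorem[OF c(1) h(1) _ c(2) h(2) Qs(5)] by blast
    have "prime_chain R (p # q' # Qs)" using q' c h Qs(1) by (auto simp: prime_chain_Cons)
    then show ?thesis using Qs q' False by (intro exI[of _ "q' # Qs"]) auto
  qed
qed simp

section \<open>Regular local rings\<close>

locale local_noeth = noeth_cring +
  fixes m assumes m_prime: "primeideal m R"
    and m_max: "ideal K R \<Longrightarrow> \<one> \<notin> K \<Longrightarrow> K \<subseteq> m"

lemma (in local_noeth) saturate_m:
  assumes J: "ideal J R" shows "saturate m J = J"
proof
  show "saturate m J \<subseteq> J"
  proof
    fix a assume "a \<in> saturate m J"
    then obtain s where s: "s \<in> carrier R" "s \<notin> m" "a \<in> carrier R" "s \<otimes> a \<in> J" by (auto elim!: saturateE)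
    let ?S = "adjoin {\<zero>} s (carrier R)"
    have "ideal ?S R" "s \<in> ?S" using ideal_adjoin[OF zeroideal s(1) oneideal] adjoin_gen[OF zeroideal s(1)] by auto
    then have "\<one> \<in> ?S" using m_max s(2) by blast
    then obtain r where r: "r \<in> carrier R" "\<one> = s \<otimes> r" using s(1) by (auto elim!: adjoinE)
    have "a = \<one> \<otimes> a" using s by simp
    also have "\<dots> = r \<otimes> (s \<otimes> a)" unfolding r(2) using r(1) s by algebra
    finally show "a \<in> J" using ideal_mult[OF J r(1) s(4)] by simp
  qed
qed (rule saturate_incl[OF m_prime J])

text \<open>Krull's height theorem for the maximal ideal. By \<open>chain_through\<close>, the second member of the chain may be
  assumed to contain the first generator \<open>x\<close>; dropping the first member leaves a chain over \<open>J + (x)\<close>.\<close>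

lemma (in local_noeth) prime_chain_length_le:
  assumes "ideal J R" "set xs \<subseteq> carrier R" "adjoin_list J (carrier R) xs = m"
    and "prime_chain R Ps" "J \<subseteq> hd Ps" "last Ps = m"
  shows "length Ps \<le> length xs + 1"
  using assms
proof (induction xs arbitrary: J Ps)
  case Nil
  then obtain p Qs where Ps: "Ps = p # Qs" by (cases Ps) (auto simp: prime_chain_def)
  have "Qs = []"
  proof (rule ccontr)
    assume "Qs \<noteq> []"
    then have "last Qs \<in> set Qs" by simp
    then have "p \<subset> last Qs" using Nil.prems(4) Ps by (auto simp: prime_chain_def)
    then show False using Nil.prems \<open>Qs \<noteq> []\<close> Ps by auto
  qed
  then show ?case using Ps by simp
next
  case (Cons x xs)
  then obtain p Qs where Ps: "Ps = p # Qs" by (cases Ps) (auto simp: prime_chain_def)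
  have xc: "x \<in> carrier R" using Cons.prems by auto
  let ?J = "adjoin J x (carrier R)"
  have J': "ideal ?J R" by (rule ideal_adjoin[OF Cons.prems(1) xc oneideal])
  show ?case
  proof (cases "Qs = []")
    case False
    have "?J \<subseteq> m" using adjoin_list_incl[OF J' oneideal, of xs] Cons.prems by auto
    then have "x \<in> last Qs" using adjoin_gen[OF Cons.prems(1) xc] Cons.prems(6) Ps False by auto
    then obtain Qs' where Q: "Qs' \<noteq> []" "prime_chain R (p # Qs')" "length Qs' = length Qs" "last Qs' = last Qs" "x \<in> hd Qs'"
      using chain_through[OF _ False] Cons.prems(4) Ps by blast
    have c: "p \<subset> hd Qs'" "prime_chain R Qs'" using Q by (auto simp: prime_chain_Cons)
    have "primeideal (hd Qs') R" using c(2) Q(1) by (auto simp: prime_chain_def)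
    then have "?J \<subseteq> hd Qs'"
      using adjoin_gen_subset[OF prime_ideal] c(1) Cons.prems(5) Ps Q(5) by auto
    then have "length Qs' \<le> length xs + 1"
      using Cons.IH[OF J' _ _ c(2)] Cons.prems Q Ps False by auto
    then show ?thesis using Q Ps by simp
  qed (use Ps in simp)
qed

text \<open>The ideals \<open>J, J + (x\<^sub>1), J + (x\<^sub>1, x\<^sub>2), \<dots>\<close> are prime and strictly increasing. In particular the \<open>x\<^sub>i\<close> form
  a regular sequence on \<open>R/J\<close>.\<close>

primrec (in cring) prime_tower :: "'a set \<Rightarrow> 'a list \<Rightarrow> bool" where
  "prime_tower J [] \<longleftrightarrow> primeideal J R"
| "prime_tower J (x # xs) \<longleftrightarrow> primeideal J R \<and> x \<notin> J \<and> prime_tower (adjoin J x (carrier R)) xs"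

lemma (in cring) prime_tower_prime: "prime_tower J xs \<Longrightarrow> primeideal J R"
  by (cases xs) auto

text \<open>This is the statement that a regular local ring is a domain in which a minimal system of generators of
  the maximal ideal is a regular sequence, for \<open>R/J\<close>: the hypotheses say that \<open>m/J\<close> has as many
  generators as there are steps in a chain of primes over \<open>J\<close>. By induction \<open>J + (x)\<close> is prime. The bound on
  lengths of chains shows that \<open>J + (x)\<close> is the second member of a suitable chain with first member
  \<open>p \<supseteq> J\<close>, and that \<open>x \<notin> p\<close>. Hence \<open>p \<subseteq> J + xp\<close>, and Nakayama gives \<open>p = J\<close>.\<close>

theorem (in local_noeth) regular_prime_tower:
  assumes "ideal J R" "set xs \<subseteq> carrier R" "adjoin_list J (carrier R) xs = m"
    and "prime_chain R Ps" "J \<subseteq> hd Ps" "last Ps = m" "length Ps = length xs + 1"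
  shows "prime_tower J xs"
  using assms
proof (induction xs arbitrary: J Ps)
  case Nil
  then show ?case using m_prime by simp
next
  case (Cons x xs)
  then obtain p Qs where Ps: "Ps = p # Qs" by (cases Ps) (auto simp: prime_chain_def)
  have Qs: "Qs \<noteq> []" "length Qs = length xs + 1" using Cons.prems(7) Ps by auto
  have xc: "x \<in> carrier R" and xsc: "set xs \<subseteq> carrier R" using Cons.prems by auto
  have pp: "primeideal p R" using Cons.prems(4) Ps by (auto simp: prime_chain_def)
  note pi = prime_ideal[OF pp] and Ji = Cons.prems(1)
  have Jp: "J \<subseteq> p" using Cons.prems(5) Ps by simp
  let ?J = "adjoin J x (carrier R)"
  have J': "ideal ?J R" by (rule ideal_adjoin[OF Ji xc oneideal])
  have J'm: "adjoin_list ?J (carrier R) xs = m" using Cons.prems(3) by simp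
  have "?J \<subseteq> m" using adjoin_list_incl[OF J' oneideal xsc] J'm by auto
  then have xm: "x \<in> m" using adjoin_gen[OF Ji xc] by auto
  \<comment> \<open>Otherwise the whole chain lies over \<open>J + (x)\<close> and is too long.\<close>
  have xp: "x \<notin> p"
  proof
    assume "x \<in> p"
    then have "?J \<subseteq> hd Ps" using adjoin_gen_subset[OF pi Jp] Ps by simp
    then show False using prime_chain_length_le[OF J' xsc J'm Cons.prems(4) _ Cons.prems(6)] Cons.prems(7) by simp
  qed
  have "x \<in> last Qs" using xm Cons.prems(6) Ps Qs by simp
  then obtain Qs' where Q: "Qs' \<noteq> []" "prime_chain R (p # Qs')" "length Qs' = length Qs" "last Qs' = last Qs" "x \<in> hd Qs'"
    using chain_through[OF _ Qs(1)] Cons.prems(4) Ps by blast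
  have c: "p \<subset> hd Qs'" "prime_chain R Qs'" using Q by (auto simp: prime_chain_Cons)
  have "primeideal (hd Qs') R" using c(2) Q(1) by (auto simp: prime_chain_def)
  then have J'h: "?J \<subseteq> hd Qs'" using adjoin_gen_subset[OF prime_ideal] c(1) Jp Q(5) by auto
  have lm: "last Qs' = m" using Q(4) Cons.prems(6) Ps Qs by simp
  have tow: "prime_tower ?J xs"
    by (rule Cons.IH[OF J' xsc J'm c(2) J'h lm]) (use Q Qs in simp)
  have J'p: "primeideal ?J R" by (rule prime_tower_prime[OF tow])
  \<comment> \<open>Otherwise \<open>J + (x)\<close> could be added to the chain over \<open>J + (x)\<close>, making it too long.\<close>
  have "?J = hd Qs'"
  proof (rule ccontr)
    assume "?J \<noteq> hd Qs'"
    then have "prime_chain R (?J # Qs')" using J'h J'p c by (auto simp: prime_chain_Cons)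
    then show False using prime_chain_length_le[OF J' xsc J'm, of "?J # Qs'"] lm Q Qs by auto
  qed
  then have pJ': "p \<subset> ?J" using c by simp
  have "p \<subseteq> adjoin_list J p [x]"
  proof
    fix a assume a: "a \<in> p"
    then have "a \<in> ?J" using pJ' by blast
    then obtain j r where jr: "j \<in> J" "r \<in> carrier R" "a = j \<oplus> x \<otimes> r" by (auto elim!: adjoinE)
    have "x \<otimes> r \<in> p" using ideal_add_cancel[OF pi, of j "x \<otimes> r"] a jr Jp xc by auto
    then have "r \<in> p" using prime_mult[OF pp xc jr(2)] xp by auto
    then show "a \<in> adjoin_list J p [x]" using adjoinI jr by simp
  qed
  then have "p \<subseteq> saturate m (adjoin_list J p [x])"
    using saturate_incl[OF m_prime ideal_adjoin_list[OF Ji pi, of "[x]"]] xc by auto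
  then have "p \<subseteq> saturate m J" using nakayama[OF m_prime Ji pi, of "[x]"] xm by auto
  then have "p = J" using saturate_m[OF Ji] Jp by auto
  then show ?case using pp xp tow by simp
qed

section \<open>Locally regular sequences on subquotients of the ring\<close>

text \<open>The nonzerodivisor conditions of a regular sequence, on the localization of \<open>U/V\<close> at \<open>Q\<close>. An element \<open>y\<close> of
  \<open>U\<close> vanishes there iff it lies in \<open>saturate Q V\<close>, and it suffices to test numerators.\<close>

primrec (in cring) loc_regular :: "'a set \<Rightarrow> 'a set \<Rightarrow> 'a set \<Rightarrow> 'a list \<Rightarrow> bool" where
  "loc_regular Q V U [] \<longleftrightarrow> True"
| "loc_regular Q V U (a # as) \<longleftrightarrow>
     (\<forall>y\<in>U. a \<otimes> y \<in> saturate Q V \<longrightarrow> y \<in> saturate Q V) \<and> loc_regular Q (adjoin V a U) U as"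

lemma (in cring) loc_regular_nth:
  "loc_regular Q V U as \<Longrightarrow> i < length as \<Longrightarrow> y \<in> U \<Longrightarrow> as ! i \<otimes> y \<in> saturate Q (adjoin_list V U (take i as)) \<Longrightarrow>
    y \<in> saturate Q (adjoin_list V U (take i as))"
proof (induction as arbitrary: V i)
  case (Cons a as)
  then show ?case by (cases i) auto
qed simp

lemma (in cring) loc_regular_trivial:
  assumes Q: "primeideal Q R" and U: "ideal U R"
  shows "ideal V R \<Longrightarrow> U \<subseteq> saturate Q V \<Longrightarrow> set as \<subseteq> carrier R \<Longrightarrow> loc_regular Q V U as"
proof (induction as arbitrary: V)
  case (Cons a as)
  have a: "a \<in> carrier R" using Cons.prems by simp
  have "U \<subseteq> saturate Q (adjoin V a U)"
    using Cons.prems(2) saturate_mono[OF adjoin_incl[OF Cons.prems(1) a U]] by blast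
  then show ?case using Cons.prems Cons.IH[OF ideal_adjoin[OF Cons.prems(1) a U]] by auto
qed simp

text \<open>Weak regularity only depends on the localized module up to isomorphism. The isomorphism
  \<open>(W/V)\<^sub>Q \<rightarrow> (W'/V')\<^sub>Q\<close> is multiplication by \<open>z\<close>: this covers cyclic modules and, with \<open>z = 1\<close>, the isomorphism
  \<open>W/(W \<inter> V') \<rightarrow> (W + V')/V'\<close>.\<close>

lemma (in cring) loc_regular_transport:
  assumes Q: "primeideal Q R" and z: "z \<in> carrier R" and W: "ideal W R" and W': "ideal W' R"
    and zW: "\<And>w. w \<in> W \<Longrightarrow> z \<otimes> w \<in> W'"
  shows "ideal V R \<Longrightarrow> ideal V' R \<Longrightarrow> (\<And>v. v \<in> V \<Longrightarrow> z \<otimes> v \<in> V') \<Longrightarrow> W' \<subseteq> saturate Q (adjoin V' z W) \<Longrightarrow>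
    (\<And>w. w \<in> W \<Longrightarrow> z \<otimes> w \<in> saturate Q V' \<Longrightarrow> w \<in> saturate Q V) \<Longrightarrow> set as \<subseteq> carrier R \<Longrightarrow>
    loc_regular Q V W as \<Longrightarrow> loc_regular Q V' W' as"
proof (induction as arbitrary: V V')
  case (Cons a as)
  note V = Cons.prems(1) and V' = Cons.prems(2) and zV = Cons.prems(3) and cov = Cons.prems(4)
    and ker = Cons.prems(5)
  have a: "a \<in> carrier R" and as: "set as \<subseteq> carrier R" using Cons.prems(6) by auto
  have hd: "\<And>y. y \<in> W \<Longrightarrow> a \<otimes> y \<in> saturate Q V \<Longrightarrow> y \<in> saturate Q V"
    and tl: "loc_regular Q (adjoin V a W) W as" using Cons.prems(7) by auto
  note SV' = ideal_saturate[OF Q V']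
  have lift: "\<exists>s v w. s \<in> carrier R \<and> s \<notin> Q \<and> y \<in> carrier R \<and> v \<in> V' \<and> w \<in> W \<and>
      v \<in> carrier R \<and> w \<in> carrier R \<and> s \<otimes> y = v \<oplus> z \<otimes> w" if "y \<in> W'" for y
  proof -
    have "y \<in> saturate Q (adjoin V' z W)" using cov that by blast
    then obtain s where s: "s \<in> carrier R" "s \<notin> Q" "y \<in> carrier R" "s \<otimes> y \<in> adjoin V' z W"
      by (auto elim!: saturateE)
    then obtain v w where "v \<in> V'" "w \<in> W" "s \<otimes> y = v \<oplus> z \<otimes> w" by (auto elim!: adjoinE)
    then show ?thesis using s ideal_carr[OF V'] ideal_carr[OF W] by blast
  qed
  have "y \<in> saturate Q V'" if y: "y \<in> W'" "a \<otimes> y \<in> saturate Q V'" for y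
  proof -
    obtain s v w where e: "s \<in> carrier R" "s \<notin> Q" "y \<in> carrier R" "v \<in> V'" "w \<in> W"
      "v \<in> carrier R" "w \<in> carrier R" "s \<otimes> y = v \<oplus> z \<otimes> w" using lift[OF y(1)] by blast
    have "a \<otimes> v \<oplus> z \<otimes> (a \<otimes> w) = a \<otimes> (v \<oplus> z \<otimes> w)" using a z e(6,7) by algebra
    also have "\<dots> = s \<otimes> (a \<otimes> y)" unfolding e(8)[symmetric] using a e(1,3) by algebra
    finally have "a \<otimes> v \<oplus> z \<otimes> (a \<otimes> w) \<in> saturate Q V'" using ideal_mult[OF SV' e(1) y(2)] by simp
    moreover have vS: "v \<in> saturate Q V'" using saturate_incl[OF Q V'] e(4) by auto
    ultimately have "z \<otimes> (a \<otimes> w) \<in> saturate Q V'"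
      using ideal_add_cancel[OF SV' _ ideal_mult[OF SV' a vS]] a z e by auto
    then have "w \<in> saturate Q V" using hd[OF e(5)] ker ideal_mult[OF W a e(5)] by auto
    then obtain t where t: "t \<in> carrier R" "t \<notin> Q" "t \<otimes> w \<in> V" by (auto elim!: saturateE)
    have "t \<otimes> (z \<otimes> w) = z \<otimes> (t \<otimes> w)" using t z e(7) by algebra
    then have "z \<otimes> w \<in> saturate Q V'" using saturateI[OF t(1,2), of "z \<otimes> w" V'] zV[OF t(3)] z e(7) by auto
    then have "s \<otimes> y \<in> saturate Q V'" unfolding e(8) using ideal_add[OF SV' vS] by blast
    then show ?thesis using saturate_multD[OF Q e(1,2,3)] by blast
  qed
  moreover have "loc_regular Q (adjoin V' a W') W' as"
  proof (rule Cons.IH[of "adjoin V a W" "adjoin V' a W'", OF _ _ _ _ _ as tl])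
    show V1: "ideal (adjoin V a W) R" "ideal (adjoin V' a W') R"
      using ideal_adjoin[OF V a W] ideal_adjoin[OF V' a W'] .
    show "z \<otimes> x \<in> adjoin V' a W'" if x: "x \<in> adjoin V a W" for x
    proof -
      obtain v w where e: "v \<in> V" "w \<in> W" "x = v \<oplus> a \<otimes> w" using x by (auto elim!: adjoinE)
      have "z \<otimes> x = z \<otimes> v \<oplus> a \<otimes> (z \<otimes> w)"
        unfolding e(3) using ideal_carr[OF V e(1)] ideal_carr[OF W e(2)] a z by algebra
      then show ?thesis using adjoinI[OF zV[OF e(1)] zW[OF e(2)]] by metis
    qed
    show "W' \<subseteq> saturate Q (adjoin (adjoin V' a W') z W)"
      using cov saturate_mono[OF adjoin_mono[OF adjoin_incl[OF V' a W'] subset_refl]] by blast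
    show "w \<in> saturate Q (adjoin V a W)" if w: "w \<in> W" "z \<otimes> w \<in> saturate Q (adjoin V' a W')" for w
    proof -
      obtain s where s: "s \<in> carrier R" "s \<notin> Q" "s \<otimes> (z \<otimes> w) \<in> adjoin V' a W'"
        using w by (auto elim!: saturateE)
      then obtain v y where vy: "v \<in> V'" "y \<in> W'" "s \<otimes> (z \<otimes> w) = v \<oplus> a \<otimes> y" by (auto elim!: adjoinE)
      obtain t v1 w1 where e: "t \<in> carrier R" "t \<notin> Q" "y \<in> carrier R" "v1 \<in> V'" "w1 \<in> W"
        "v1 \<in> carrier R" "w1 \<in> carrier R" "t \<otimes> y = v1 \<oplus> z \<otimes> w1" using lift[OF vy(2)] by blast
      have c: "v \<in> carrier R" "w \<in> carrier R" using ideal_carr[OF V' vy(1)] ideal_carr[OF W w(1)] .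
      let ?d = "(t \<otimes> s) \<otimes> w \<ominus> a \<otimes> w1"
      have "z \<otimes> ?d = t \<otimes> (s \<otimes> (z \<otimes> w)) \<ominus> a \<otimes> (z \<otimes> w1)" using s e z a c by algebra
      also have "\<dots> = t \<otimes> v \<oplus> a \<otimes> (t \<otimes> y) \<ominus> a \<otimes> (z \<otimes> w1)" unfolding vy(3) using e a c by algebra
      also have "\<dots> = t \<otimes> v \<oplus> a \<otimes> v1" unfolding e(8) using e(1,6,7) a z c by algebra
      also have "\<dots> \<in> V'" using ideal_add[OF V'] ideal_mult[OF V'] e a vy by auto
      finally have "z \<otimes> ?d \<in> saturate Q V'" using saturate_incl[OF Q V'] by blast
      moreover have "?d \<in> W"
        using ideal_minus[OF W] ideal_mult[OF W _ w(1)] ideal_mult[OF W a e(5)] e(1) s(1) by auto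
      ultimately have "?d \<in> saturate Q V" by (rule ker[rotated])
      then have d: "?d \<in> saturate Q (adjoin V a W)" using saturate_mono[OF adjoin_incl[OF V a W]] by blast
      have "a \<otimes> w1 \<in> saturate Q (adjoin V a W)"
        using adjoin_mem[OF V a W e(5)] saturate_incl[OF Q V1(1)] by auto
      then have "?d \<oplus> a \<otimes> w1 \<in> saturate Q (adjoin V a W)" using d ideal_add[OF ideal_saturate[OF Q V1(1)]] by blast
      moreover have "?d \<oplus> a \<otimes> w1 = (t \<otimes> s) \<otimes> w" using s e a c by algebra
      ultimately have "(t \<otimes> s) \<otimes> w \<in> saturate Q (adjoin V a W)" by simp
      then show ?thesis
        using saturate_multD[OF Q _ _ c(2), of "t \<otimes> s"] prime_compl(2)[OF Q, of t s] s e by auto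
    qed
  qed
  ultimately show ?case by simp
qed simp

text \<open>Multiplication by \<open>z\<close> identifies \<open>R/(V : z)\<close> with \<open>(V + (z))/V\<close>.\<close>

lemma (in cring) loc_regular_cyclic:
  assumes Q: "primeideal Q R" and V: "ideal V R" and z: "z \<in> carrier R" and as: "set as \<subseteq> carrier R"
    and w: "loc_regular Q (colon V z) (carrier R) as"
  shows "loc_regular Q V (adjoin V z (carrier R)) as"
proof (rule loc_regular_transport[OF Q z oneideal ideal_adjoin[OF V z oneideal] _ ideal_colon[OF V z] V _ _ _ as w])
  show "z \<otimes> w \<in> adjoin V z (carrier R)" if "w \<in> carrier R" for w by (rule adjoin_mem[OF V z oneideal that])
  show "z \<otimes> v \<in> V" if "v \<in> colon V z" for v using that z m_comm[of z v] by (auto simp: colon_def)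
  show "adjoin V z (carrier R) \<subseteq> saturate Q (adjoin V z (carrier R))" by (rule saturate_incl[OF Q ideal_adjoin[OF V z oneideal]])
  show "w \<in> saturate Q (colon V z)" if w: "w \<in> carrier R" "z \<otimes> w \<in> saturate Q V" for w
  proof -
    obtain s where s: "s \<in> carrier R" "s \<notin> Q" "s \<otimes> (z \<otimes> w) \<in> V" using w by (auto elim!: saturateE)
    have "s \<otimes> (z \<otimes> w) = (s \<otimes> w) \<otimes> z" using s z w by algebra
    then show ?thesis using saturateI[OF s(1,2) w(1), of "colon V z"] s w by (auto simp: colon_def)
  qed
qed

text \<open>A sequence that is weakly regular on the two ends of \<open>0 \<rightarrow> W/V \<rightarrow> U/V \<rightarrow> U/W \<rightarrow> 0\<close> is so on the middle. Since
  \<open>a\<close> is regular on \<open>U/W\<close>, the sequence stays exact modulo \<open>a\<close>, which carries the induction.\<close>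

lemma (in cring) loc_regular_extension:
  assumes Q: "primeideal Q R" and U: "ideal U R"
  shows "ideal V R \<Longrightarrow> ideal W R \<Longrightarrow> V \<subseteq> W \<Longrightarrow> W \<subseteq> U \<Longrightarrow> set as \<subseteq> carrier R \<Longrightarrow>
    loc_regular Q V W as \<Longrightarrow> loc_regular Q W U as \<Longrightarrow> loc_regular Q V U as"
proof (induction as arbitrary: V W)
  case (Cons a as)
  note V = Cons.prems(1) and W = Cons.prems(2) and VW = Cons.prems(3) and WU = Cons.prems(4)
  have a: "a \<in> carrier R" and as: "set as \<subseteq> carrier R" using Cons.prems(5) by auto
  have h1: "\<And>y. y \<in> W \<Longrightarrow> a \<otimes> y \<in> saturate Q V \<Longrightarrow> y \<in> saturate Q V"
    and t1: "loc_regular Q (adjoin V a W) W as" using Cons.prems(6) by auto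
  have h2: "\<And>y. y \<in> U \<Longrightarrow> a \<otimes> y \<in> saturate Q W \<Longrightarrow> y \<in> saturate Q W"
    and t2: "loc_regular Q (adjoin W a U) U as" using Cons.prems(7) by auto
  note SV = ideal_saturate[OF Q V]
  have "y \<in> saturate Q V" if y: "y \<in> U" "a \<otimes> y \<in> saturate Q V" for y
  proof -
    have "y \<in> saturate Q W" using h2[OF y(1)] y(2) saturate_mono[OF VW] by blast
    then obtain s where s: "s \<in> carrier R" "s \<notin> Q" "y \<in> carrier R" "s \<otimes> y \<in> W" by (auto elim!: saturateE)
    have "a \<otimes> (s \<otimes> y) = s \<otimes> (a \<otimes> y)" using a s by algebra
    then have "s \<otimes> y \<in> saturate Q V" using h1[OF s(4)] ideal_mult[OF SV s(1) y(2)] by simp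
    then show ?thesis using saturate_multD[OF Q s(1,2,3)] by blast
  qed
  moreover have "loc_regular Q (adjoin V a U) U as"
  proof (rule Cons.IH[OF _ _ _ _ as _ t2])
    show VU: "ideal (adjoin V a U) R" by (rule ideal_adjoin[OF V a U])
    show WaU: "ideal (adjoin W a U) R" by (rule ideal_adjoin[OF W a U])
    show "adjoin V a U \<subseteq> adjoin W a U" by (rule adjoin_mono[OF VW subset_refl])
    show "adjoin W a U \<subseteq> U" by (rule adjoin_subset[OF U WU ideal_mult[OF U a]])
    show "loc_regular Q (adjoin V a U) (adjoin W a U) as"
    proof (rule loc_regular_transport[OF Q one_closed W WaU _ ideal_adjoin[OF V a W] VU _ _ _ as t1])
      show "\<one> \<otimes> w \<in> adjoin W a U" if "w \<in> W" for w
        using adjoin_incl[OF W a U] that ideal_carr[OF W that] by auto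
      show "\<one> \<otimes> v \<in> adjoin V a U" if "v \<in> adjoin V a W" for v
        using adjoin_mono[OF subset_refl WU, of V a] that ideal_carr[OF ideal_adjoin[OF V a W] that] by auto
      have i: "ideal (adjoin (adjoin V a U) \<one> W) R" by (rule ideal_adjoin[OF VU one_closed W])
      \<comment> \<open>\<open>(W + aU)/(V + aU)\<close> is a quotient of \<open>W\<close> by a submodule that is locally \<open>V + aW\<close>.\<close>
      have "adjoin W a U \<subseteq> adjoin (adjoin V a U) \<one> W"
      proof
        fix x assume "x \<in> adjoin W a U"
        then obtain w u where e: "w \<in> W" "u \<in> U" "x = w \<oplus> a \<otimes> u" by (auto elim!: adjoinE)
        have "x = a \<otimes> u \<oplus> \<one> \<otimes> w" unfolding e(3) using ideal_carr[OF W e(1)] ideal_carr[OF U e(2)] a by algebra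
        then show "x \<in> adjoin (adjoin V a U) \<one> W" using adjoinI[OF adjoin_mem[OF V a U e(2)] e(1)] by metis
      qed
      then show "adjoin W a U \<subseteq> saturate Q (adjoin (adjoin V a U) \<one> W)" using saturate_incl[OF Q i] by blast
      show "w \<in> saturate Q (adjoin V a W)" if w: "w \<in> W" "\<one> \<otimes> w \<in> saturate Q (adjoin V a U)" for w
      proof -
        have wc: "w \<in> carrier R" by (rule ideal_carr[OF W w(1)])
        then obtain s where s: "s \<in> carrier R" "s \<notin> Q" "s \<otimes> w \<in> adjoin V a U" using w by (auto elim!: saturateE)
        then obtain v u where e: "v \<in> V" "u \<in> U" "s \<otimes> w = v \<oplus> a \<otimes> u" by (auto elim!: adjoinE)
        have c: "v \<in> carrier R" "u \<in> carrier R" using ideal_carr[OF V e(1)] ideal_carr[OF U e(2)] .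
        have "a \<otimes> u \<in> W"
          using ideal_add_cancel[OF W, of v "a \<otimes> u"] e VW ideal_mult[OF W s(1) w(1)] a c by auto
        then have "u \<in> saturate Q W" using h2[OF e(2)] saturate_incl[OF Q W] by blast
        then obtain t where t: "t \<in> carrier R" "t \<notin> Q" "t \<otimes> u \<in> W" by (auto elim!: saturateE)
        have "(t \<otimes> s) \<otimes> w = t \<otimes> (s \<otimes> w)" using t s wc by algebra
        also have "\<dots> = t \<otimes> v \<oplus> a \<otimes> (t \<otimes> u)" unfolding e(3) using t c a by algebra
        also have "\<dots> \<in> adjoin V a W" by (rule adjoinI[OF ideal_mult[OF V t(1) e(1)] t(3)])
        finally show ?thesis
          using saturateI[of "t \<otimes> s" Q w] prime_compl(2)[OF Q, of t s] t s wc by auto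
      qed
    qed
  qed
  ultimately show ?case by simp
qed simp

text \<open>\<open>R/K\<close> has a finite filtration with factors \<open>R/p\<close>, \<open>p\<close> prime over \<open>I\<close>. As \<open>P\<close> is minimal over \<open>I\<close>, every
  such \<open>p \<noteq> P\<close> contains an element outside \<open>P\<close>; inverting these elements leaves only factors \<open>R/P\<close>.\<close>

theorem (in noeth_cring) generic_loc_regular_quotient:
  assumes P: "P \<in> minimal_primes R I" and "ideal K R"
  shows "I \<subseteq> K \<Longrightarrow> \<exists>f\<in>carrier R. f \<notin> P \<and> (\<forall>Q as. primeideal Q R \<longrightarrow> f \<notin> Q \<longrightarrow> set as \<subseteq> carrier R \<longrightarrow>
    loc_regular Q P (carrier R) as \<longrightarrow> loc_regular Q K (carrier R) as)"
  using \<open>ideal K R\<close>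
proof (induction rule: noeth_induct)
  case (step K)
  note K = step(1) and IK = step(3)
  have Pp: "primeideal P R" using P by (simp add: minimal_primes_def)
  show ?case
  proof (cases "\<one> \<in> K")
    case True
    then have "K = carrier R" using ideal.one_imp_carrier[OF K] by simp
    then show ?thesis
      using loc_regular_trivial[OF _ oneideal oneideal] saturate_carrier prime_notone[OF Pp] by (intro bexI[of _ \<one>]) auto
  next
    case False
    obtain z where z: "z \<in> carrier R" "z \<notin> K" and pr: "primeideal (colon K z) R"
      using colon_prime_exists[OF K False] by blast
    let ?L = "adjoin K z (carrier R)"
    have L: "ideal ?L R" by (rule ideal_adjoin[OF K z(1) oneideal])
    have KL: "K \<subset> ?L" using adjoin_incl[OF K z(1) oneideal] adjoin_gen[OF K z(1)] z(2) by blast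
    obtain f1 where f1: "f1 \<in> carrier R" "f1 \<notin> P"
      and f1w: "\<And>Q as. primeideal Q R \<Longrightarrow> f1 \<notin> Q \<Longrightarrow> set as \<subseteq> carrier R \<Longrightarrow>
        loc_regular Q P (carrier R) as \<Longrightarrow> loc_regular Q ?L (carrier R) as"
      using step(2)[OF L KL] IK KL by blast
    have Lc: "?L \<subseteq> carrier R" using ideal_carr[OF L] by blast
    have glue: "loc_regular Q K (carrier R) as"
      if "primeideal Q R" "f1 \<notin> Q" "set as \<subseteq> carrier R" "loc_regular Q P (carrier R) as" "loc_regular Q K ?L as" for Q as
      using loc_regular_extension[OF that(1) oneideal K L _ Lc that(3,5) f1w[OF that(1-4)]] KL by blast
    show ?thesis
    proof (cases "colon K z = P")
      case True
      show ?thesis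
      proof (rule bexI[OF _ f1(1)], intro conjI allI impI)
        fix Q as assume h: "primeideal Q R" "f1 \<notin> Q" "set as \<subseteq> carrier R" "loc_regular Q P (carrier R) as"
        show "loc_regular Q K (carrier R) as"
          by (rule glue[OF h loc_regular_cyclic[OF h(1) K z(1) h(3)]]) (use h(4) True in simp)
      qed (rule f1(2))
    next
      case False
      have "I \<subseteq> colon K z"
        using IK ideal_mult'[OF K z(1)] ideal_carr[OF K] by (auto simp: colon_def)
      then have "\<not> colon K z \<subseteq> P" using False P pr by (auto simp: minimal_primes_def)
      then obtain g where g: "g \<in> colon K z" "g \<notin> P" by blast
      have gc: "g \<in> carrier R" and gz: "g \<otimes> z \<in> K" using g by (auto simp: colon_def)
      show ?thesis
      proof (rule bexI[of _ "f1 \<otimes> g"], intro conjI allI impI)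
        show "f1 \<otimes> g \<notin> P" using prime_mult[OF Pp f1(1) gc] f1 g by blast
        fix Q as assume h: "primeideal Q R" "f1 \<otimes> g \<notin> Q" "set as \<subseteq> carrier R" "loc_regular Q P (carrier R) as"
        have f1Q: "f1 \<notin> Q" and gQ: "g \<notin> Q"
          using h(2) ideal_mult[OF prime_ideal[OF h(1)]] ideal_mult'[OF prime_ideal[OF h(1)]] f1(1) gc by auto
        have "z \<in> saturate Q K" using saturateI[OF gc gQ z(1) gz] .
        then have "?L \<subseteq> saturate Q K" using adjoin_gen_subset[OF ideal_saturate[OF h(1) K] saturate_incl[OF h(1) K]] by blast
        then show "loc_regular Q K (carrier R) as"
          using glue[OF h(1) f1Q h(3,4)] loc_regular_trivial[OF h(1) L K _ h(3)] by blast
      qed (use f1 gc in simp)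
    qed
  qed
qed

section \<open>The monomial filtration of the powers of an ideal\<close>

text \<open>Always move on to an index at which the remaining values attain their minimum.\<close>

lemma nat_seq_increasing_subseq:
  fixes h :: "nat \<Rightarrow> nat"
  shows "\<exists>\<phi>::nat \<Rightarrow> nat. strict_mono \<phi> \<and> mono (\<lambda>i. h (\<phi> i))"
proof -
  have "\<exists>k\<ge>n. \<forall>j\<ge>n. h k \<le> h j" for n
  proof -
    have "\<exists>k. k \<ge> n \<and> (\<forall>j. j \<ge> n \<longrightarrow> h k \<le> h j)"
      using ex_has_least_nat[of "\<lambda>k. k \<ge> n" n h] by blast
    then show ?thesis by blast
  qed
  then obtain m where m: "\<And>n. m n \<ge> n" "\<And>n j. j \<ge> n \<Longrightarrow> h (m n) \<le> h j" by metis
  define \<phi> where "\<phi> = rec_nat (m 0) (\<lambda>_ k. m (Suc k))"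
  have \<phi>: "\<phi> 0 = m 0" "\<And>i. \<phi> (Suc i) = m (Suc (\<phi> i))" by (simp_all add: \<phi>_def)
  have less: "\<phi> i < \<phi> (Suc i)" for i using m(1)[of "Suc (\<phi> i)"] by (simp add: \<phi>(2))
  have "h (\<phi> i) \<le> h (\<phi> (Suc i))" for i
  proof (cases i)
    case 0
    then show ?thesis using m(2)[of 0] \<phi>(1) by simp
  next
    case (Suc j)
    have "\<phi> (Suc i) \<ge> Suc (\<phi> j)" using less[of i] less[of j] Suc by simp
    then show ?thesis using m(2)[of "Suc (\<phi> j)" "\<phi> (Suc i)"] \<phi>(2)[of j] Suc by simp
  qed
  then show ?thesis using less by (meson mono_iff_le_Suc strict_mono_Suc_iff)
qed

text \<open>Dickson's lemma, in the form that an infinite sequence of exponents has a subsequence that increases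
  in every coordinate.\<close>

lemma dickson:
  fixes f :: "nat \<Rightarrow> nat list"
  shows "(\<And>i. length (f i) = r) \<Longrightarrow> \<exists>\<phi>::nat \<Rightarrow> nat. strict_mono \<phi> \<and> (\<forall>i. list_all2 (\<le>) (f (\<phi> i)) (f (\<phi> (Suc i))))"
proof (induction r arbitrary: f)
  case 0
  then show ?case by (intro exI[of _ id]) (auto simp: strict_mono_def)
next
  case (Suc r)
  obtain \<phi> :: "nat \<Rightarrow> nat" where \<phi>: "strict_mono \<phi>" "mono (\<lambda>i. hd (f (\<phi> i)))"
    using nat_seq_increasing_subseq[of "\<lambda>i. hd (f i)"] by blast
  have "length (tl (f (\<phi> i))) = r" for i using Suc.prems by simp
  from Suc.IH[of "\<lambda>i. tl (f (\<phi> i))", OF this] obtain \<psi> :: "nat \<Rightarrow> nat" where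
    \<psi>: "strict_mono \<psi>" "\<And>i. list_all2 (\<le>) (tl (f (\<phi> (\<psi> i)))) (tl (f (\<phi> (\<psi> (Suc i)))))" by blast
  have "list_all2 (\<le>) (f ((\<phi> \<circ> \<psi>) i)) (f ((\<phi> \<circ> \<psi>) (Suc i)))" for i
  proof -
    have ne: "f k \<noteq> []" for k using Suc.prems[of k] by auto
    have "\<psi> i \<le> \<psi> (Suc i)" using \<psi>(1) by (simp add: strict_mono_less_eq)
    then have "hd (f (\<phi> (\<psi> i))) \<le> hd (f (\<phi> (\<psi> (Suc i))))" using \<phi>(2) by (auto simp: mono_def)
    then have "list_all2 (\<le>) (hd (f (\<phi> (\<psi> i))) # tl (f (\<phi> (\<psi> i)))) (hd (f (\<phi> (\<psi> (Suc i)))) # tl (f (\<phi> (\<psi> (Suc i)))))"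
      using \<psi>(2) by simp
    then show ?thesis using ne by simp
  qed
  moreover have "strict_mono (\<phi> \<circ> \<psi>)" using \<phi>(1) \<psi>(1) by (simp add: strict_mono_def)
  ultimately show ?case by blast
qed

text \<open>Infinitely many distinct values would, along a sequence of exponents given by Dickson's lemma, form an
  ascending chain of ideals that never repeats.\<close>

lemma (in noeth_cring) finite_monotone_ideals:
  assumes id: "\<And>\<alpha>. length \<alpha> = r \<Longrightarrow> ideal (F \<alpha>) R"
    and mono: "\<And>\<alpha> \<beta> :: nat list. length \<alpha> = r \<Longrightarrow> length \<beta> = r \<Longrightarrow> list_all2 (\<le>) \<alpha> \<beta> \<Longrightarrow> F \<alpha> \<subseteq> F \<beta>"
  shows "finite (F ` {\<alpha>. length \<alpha> = r})"
proof (rule ccontr)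
  assume "infinite (F ` {\<alpha>. length \<alpha> = r})"
  then obtain g :: "nat \<Rightarrow> 'a set" where g: "inj g" "range g \<subseteq> F ` {\<alpha>. length \<alpha> = r}"
    using infinite_countable_subset by blast
  then have "\<forall>i. \<exists>\<alpha>. length \<alpha> = r \<and> g i = F \<alpha>" by blast
  then obtain f where f: "\<And>i. length (f i) = r" "\<And>i. g i = F (f i)" by metis
  obtain \<phi> :: "nat \<Rightarrow> nat" where \<phi>: "strict_mono \<phi>" "\<And>i. list_all2 (\<le>) (f (\<phi> i)) (f (\<phi> (Suc i)))"
    using dickson[of f r, OF f(1)] by blast
  have "\<exists>n. \<forall>m\<ge>n. F (f (\<phi> m)) = F (f (\<phi> n))"
    by (rule ascending_stabilises) (use id mono f(1) \<phi>(2) in auto)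
  then obtain n where "\<forall>m\<ge>n. F (f (\<phi> m)) = F (f (\<phi> n))" ..
  then have "g (\<phi> (Suc n)) = g (\<phi> n)" unfolding f(2) using le_SucI[OF order_refl] by blast
  then have "\<phi> (Suc n) = \<phi> n" using g(1) by (auto simp: inj_def)
  then show False using \<phi>(1) by (metis n_not_Suc_n strict_mono_eq)
qed

text \<open>The monomial \<open>g\<^sub>1^\<alpha>\<^sub>1 \<dots> g\<^sub>r^\<alpha>\<^sub>r\<close>. Exponents are lists because these carry the lexicographic order, which is
  total and compatible with addition on lists of a fixed length.\<close>

primrec (in cring) gens_monom :: "'a list \<Rightarrow> nat list \<Rightarrow> 'a" where
  "gens_monom [] \<alpha> = \<one>"
| "gens_monom (g # gs) \<alpha> = g [^] hd \<alpha> \<otimes> gens_monom gs (tl \<alpha>)"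

lemma (in cring) gens_monom_closed: "set gs \<subseteq> carrier R \<Longrightarrow> gens_monom gs \<alpha> \<in> carrier R"
  by (induction gs arbitrary: \<alpha>) auto

lemma (in cring) gens_monom_add:
  "set gs \<subseteq> carrier R \<Longrightarrow> length \<alpha> = length gs \<Longrightarrow> length \<beta> = length gs \<Longrightarrow>
    gens_monom gs (map2 (+) \<alpha> \<beta>) = gens_monom gs \<alpha> \<otimes> gens_monom gs \<beta>"
proof (induction gs arbitrary: \<alpha> \<beta>)
  case (Cons g gs)
  then obtain a \<alpha>' b \<beta>' where e: "\<alpha> = a # \<alpha>'" "\<beta> = b # \<beta>'" by (metis length_Suc_conv)
  have g: "g \<in> carrier R" using Cons.prems by simp
  define u v where "u = gens_monom gs \<alpha>'" and "v = gens_monom gs \<beta>'"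
  define x y where "x = g [^] a" and "y = g [^] b"
  have c: "u \<in> carrier R" "v \<in> carrier R" "x \<in> carrier R" "y \<in> carrier R"
    using gens_monom_closed Cons.prems g by (auto simp: u_def v_def x_def y_def)
  have "gens_monom gs (map2 (+) \<alpha>' \<beta>') = u \<otimes> v" using Cons e by (simp add: u_def v_def)
  moreover have "g [^] (a + b) = x \<otimes> y" using nat_pow_mult[OF g, of a b] by (simp add: x_def y_def)
  ultimately have "gens_monom (g # gs) (map2 (+) \<alpha> \<beta>) = (x \<otimes> y) \<otimes> (u \<otimes> v)" by (simp add: e)
  also have "\<dots> = (x \<otimes> u) \<otimes> (y \<otimes> v)" using c by algebra
  finally show ?case by (simp add: e u_def v_def x_def y_def)
qed simp

lemma (in cring) gens_monom_gen:
  "set gs \<subseteq> carrier R \<Longrightarrow> g \<in> set gs \<Longrightarrow> length \<beta> = length gs \<Longrightarrow>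
    \<exists>\<beta>'. length \<beta>' = length gs \<and> sum_list \<beta>' = Suc (sum_list \<beta>) \<and> gens_monom gs \<beta>' = g \<otimes> gens_monom gs \<beta>"
proof (induction gs arbitrary: \<beta>)
  case (Cons h gs)
  then obtain b \<beta>0 where e: "\<beta> = b # \<beta>0" "length \<beta>0 = length gs" by (metis length_Suc_conv)
  have h: "h \<in> carrier R" "g \<in> carrier R" "set gs \<subseteq> carrier R" using Cons.prems by auto
  define u x where "u = gens_monom gs \<beta>0" and "x = h [^] b"
  have c: "u \<in> carrier R" "x \<in> carrier R" using gens_monom_closed h by (auto simp: u_def x_def)
  show ?case
  proof (cases "g = h")
    case True
    have "gens_monom (h # gs) (Suc b # \<beta>0) = (x \<otimes> h) \<otimes> u" by (simp add: u_def x_def)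
    also have "\<dots> = h \<otimes> (x \<otimes> u)" using c h(1) by algebra
    finally show ?thesis using e True by (intro exI[of _ "Suc b # \<beta>0"]) (simp add: u_def x_def)
  next
    case False
    then obtain \<beta>' where b: "length \<beta>' = length gs" "sum_list \<beta>' = Suc (sum_list \<beta>0)" "gens_monom gs \<beta>' = g \<otimes> u"
      using Cons.IH[OF h(3) _ e(2)] Cons.prems unfolding u_def by auto
    have "x \<otimes> (g \<otimes> u) = g \<otimes> (x \<otimes> u)" using c h(2) by algebra
    then show ?thesis using e b by (intro exI[of _ "b # \<beta>'"]) (simp add: u_def x_def)
  qed
qed simp

lemma map2_add_less:
  fixes \<alpha> \<beta> \<gamma> :: "nat list"
  shows "length \<gamma> = length \<alpha> \<Longrightarrow> length \<alpha> = length \<beta> \<Longrightarrow> \<alpha> < \<beta> \<Longrightarrow> map2 (+) \<gamma> \<alpha> < map2 (+) \<gamma> \<beta>"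
  by (induction \<gamma> \<alpha> \<beta> rule: list_induct3) auto

lemma sum_list_map2_add:
  fixes \<alpha> \<beta> :: "nat list"
  shows "length \<alpha> = length \<beta> \<Longrightarrow> sum_list (map2 (+) \<alpha> \<beta>) = sum_list \<alpha> + sum_list \<beta>"
  by (induction \<alpha> \<beta> rule: list_induct2) auto

lemma le_list_diff:
  fixes \<alpha> \<beta> :: "nat list"
  shows "list_all2 (\<le>) \<alpha> \<beta> \<Longrightarrow> \<exists>\<gamma>. length \<gamma> = length \<alpha> \<and> \<beta> = map2 (+) \<gamma> \<alpha>"
proof (induction rule: list_all2_induct)
  case (Cons a as b bs)
  then obtain \<gamma> where "length \<gamma> = length as" "bs = map2 (+) \<gamma> as" by blast
  then show ?case using Cons(1) by (intro exI[of _ "(b - a) # \<gamma>"]) simp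
qed simp

lemma finite_exponents: "finite {\<alpha> :: nat list. length \<alpha> = r \<and> sum_list \<alpha> = n}"
proof (rule finite_subset)
  show "{\<alpha> :: nat list. length \<alpha> = r \<and> sum_list \<alpha> = n} \<subseteq> {\<alpha>. set \<alpha> \<subseteq> {..n} \<and> length \<alpha> = r}"
    using member_le_sum_list by fastforce
qed (simp add: finite_lists_length_eq)

lemma (in cring) ideal_prod_subset:
  assumes "ideal K R" "\<And>x y. x \<in> I \<Longrightarrow> y \<in> J \<Longrightarrow> x \<otimes> y \<in> K"
  shows "ideal_prod R I J \<subseteq> K"
proof
  fix x assume "x \<in> ideal_prod R I J"
  then show "x \<in> K" by induction (use assms ideal_add[OF assms(1)] in auto)
qed

lemma (in cring) ideal_pow_ideal: "ideal I R \<Longrightarrow> ideal (ideal_pow R I n) R"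
  by (induction n) (auto intro: oneideal ideal_prod_is_ideal)

lemma (in cring) ideal_pow_mult1: "x \<in> I \<Longrightarrow> y \<in> ideal_pow R I n \<Longrightarrow> x \<otimes> y \<in> ideal_pow R I (Suc n)"
  by (auto intro: ideal_prod.prod)

lemma (in cring) ideal_pow_Suc_subset:
  assumes I: "ideal I R" shows "ideal_pow R I (Suc n) \<subseteq> ideal_pow R I n"
  using ideal_prod_subset[OF ideal_pow_ideal[OF I]] ideal_mult[OF ideal_pow_ideal[OF I]] ideal_carr[OF I]
  by auto

lemma (in cring) ideal_pow_mult:
  assumes I: "ideal I R"
  shows "x \<in> ideal_pow R I m \<Longrightarrow> y \<in> ideal_pow R I n \<Longrightarrow> x \<otimes> y \<in> ideal_pow R I (m + n)"
proof (induction m arbitrary: x)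
  case 0
  then show ?case using ideal_mult[OF ideal_pow_ideal[OF I]] by simp
next
  case (Suc m)
  have yc: "y \<in> carrier R" by (rule ideal_carr[OF ideal_pow_ideal[OF I] Suc.prems(2)])
  have K: "ideal (ideal_pow R I (Suc m + n)) R" by (rule ideal_pow_ideal[OF I])
  have "ideal_prod R I (ideal_pow R I m) \<subseteq> colon (ideal_pow R I (Suc m + n)) y"
  proof (rule ideal_prod_subset[OF ideal_colon[OF K yc]])
    fix a b assume ab: "a \<in> I" "b \<in> ideal_pow R I m"
    have c: "a \<in> carrier R" "b \<in> carrier R" using ideal_carr[OF I ab(1)] ideal_carr[OF ideal_pow_ideal[OF I] ab(2)] .
    have "a \<otimes> (b \<otimes> y) \<in> ideal_pow R I (Suc (m + n))"
      by (rule ideal_pow_mult1[OF ab(1) Suc.IH[OF ab(2) Suc.prems(2)]])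
    then show "a \<otimes> b \<in> colon (ideal_pow R I (Suc m + n)) y" using c yc by (simp add: colon_def m_assoc)
  qed
  then show ?case using Suc.prems(1) by (auto simp: colon_def)
qed

lemma (in cring) ideal_pow_gens_monom:
  assumes gs: "set gs \<subseteq> carrier R" and I: "I = Idl (set gs)"
  shows "ideal_pow R I n \<subseteq> Idl (gens_monom gs ` {\<alpha>. length \<alpha> = length gs \<and> sum_list \<alpha> = n})"
proof (induction n)
  case 0
  have g0: "gens_monom hs (replicate (length hs) 0) = \<one>" for hs by (induction hs) auto
  have "\<one> \<in> gens_monom gs ` {\<alpha>. length \<alpha> = length gs \<and> sum_list \<alpha> = 0}"
    using g0[of gs, symmetric] by (rule image_eqI) (simp add: sum_list_replicate)
  then have "\<one> \<in> Idl (gens_monom gs ` {\<alpha>. length \<alpha> = length gs \<and> sum_list \<alpha> = 0})"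
    using genideal_self[of "gens_monom gs ` {\<alpha>. length \<alpha> = length gs \<and> sum_list \<alpha> = 0}"] gens_monom_closed[OF gs] by blast
  moreover have "ideal (Idl (gens_monom gs ` {\<alpha>. length \<alpha> = length gs \<and> sum_list \<alpha> = 0})) R"
    by (rule genideal_ideal) (use gens_monom_closed[OF gs] in auto)
  ultimately show ?case using ideal.one_imp_carrier by auto
next
  case (Suc n)
  let ?X = "\<lambda>n. gens_monom gs ` {\<alpha>. length \<alpha> = length gs \<and> sum_list \<alpha> = n}"
  have Xc: "?X n \<subseteq> carrier R" for n using gens_monom_closed[OF gs] by auto
  let ?K = "Idl (?X (Suc n))"
  have K: "ideal ?K R" by (rule genideal_ideal[OF Xc])
  have 1: "x \<otimes> w \<in> ?K" if x: "x \<in> I" and w: "w \<in> ?X n" for x w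
  proof -
    obtain \<beta> where b: "length \<beta> = length gs" "sum_list \<beta> = n" "w = gens_monom gs \<beta>" using w by auto
    have wc: "w \<in> carrier R" using w Xc by auto
    have "g \<in> colon ?K w" if g: "g \<in> set gs" for g
    proof -
      obtain \<beta>' where "length \<beta>' = length gs" "sum_list \<beta>' = Suc n" "gens_monom gs \<beta>' = g \<otimes> w"
        using gens_monom_gen[OF gs g b(1)] b by auto
      then have "g \<otimes> w \<in> ?X (Suc n)" by (metis (mono_tags, lifting) image_eqI mem_Collect_eq)
      then show ?thesis using genideal_self[OF Xc] g gs by (auto simp: colon_def)
    qed
    then have "I \<subseteq> colon ?K w" unfolding I by (intro genideal_minimal ideal_colon[OF K wc]) auto
    then show ?thesis using x by (auto simp: colon_def)
  qed
  have Ii: "ideal I R" unfolding I by (rule genideal_ideal[OF gs])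
  have "x \<otimes> y \<in> ?K" if x: "x \<in> I" and y: "y \<in> ideal_pow R I n" for x y
  proof -
    have xc: "x \<in> carrier R" by (rule ideal_carr[OF Ii x])
    have "w \<in> colon ?K x" if w: "w \<in> ?X n" for w
    proof -
      have wc: "w \<in> carrier R" using w Xc by blast
      then show ?thesis using 1[OF x w] m_comm[OF wc xc] by (simp add: colon_def)
    qed
    then have "?X n \<subseteq> colon ?K x" by blast
    then have "Idl (?X n) \<subseteq> colon ?K x" by (rule genideal_minimal[OF ideal_colon[OF K xc]])
    then have "y \<otimes> x \<in> ?K" using y Suc.IH by (auto simp: colon_def)
    then show ?thesis using m_comm xc ideal_carr[OF ideal_pow_ideal[OF Ii] y] by simp
  qed
  then show ?case using ideal_prod_subset[OF K] by simp
qed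

lemma (in cring) gens_monom_in_ideal_pow:
  assumes gs: "set gs \<subseteq> I" and I: "ideal I R"
  shows "length \<alpha> = length gs \<Longrightarrow> gens_monom gs \<alpha> \<in> ideal_pow R I (sum_list \<alpha>)"
  using gs
proof (induction gs arbitrary: \<alpha>)
  case Nil
  then show ?case by simp
next
  case (Cons g gs)
  then obtain a \<beta> where e: "\<alpha> = a # \<beta>" "length \<beta> = length gs" by (metis length_Suc_conv)
  have gc: "g \<in> I" "g \<in> carrier R" using Cons.prems ideal_carr[OF I] by auto
  have "g [^] a \<in> ideal_pow R I a"
  proof (induction a)
    case (Suc a)
    have "g \<otimes> g [^] a \<in> ideal_pow R I (Suc a)" by (rule ideal_pow_mult1[OF gc(1) Suc])
    then show ?case using m_comm[of g "g [^] a"] gc by simp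
  qed simp
  then show ?case using ideal_pow_mult[OF I] Cons e by simp
qed

definition (in cring) monom_span :: "'a set \<Rightarrow> 'a list \<Rightarrow> nat \<Rightarrow> nat list set \<Rightarrow> 'a set" where
  "monom_span I gs n Y = Idl (ideal_pow R I (Suc n) \<union> gens_monom gs ` Y)"

text \<open>The ideal \<open>a\<^sub>\<alpha> = (V\<^sub>\<alpha> : g^\<alpha>)\<close>, where \<open>V\<^sub>\<alpha>\<close> is spanned by \<open>I\<^sup>n\<^sup>+\<^sup>1\<close> and the monomials of degree \<open>n = |\<alpha>|\<close> below
  \<open>\<alpha>\<close>. The factors of the filtration of \<open>I\<^sup>n/I\<^sup>n\<^sup>+\<^sup>1\<close> by the lexicographic order are the modules \<open>R/a\<^sub>\<alpha>\<close>.\<close>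

definition (in cring) monom_conductor :: "'a set \<Rightarrow> 'a list \<Rightarrow> nat list \<Rightarrow> 'a set" where
  "monom_conductor I gs \<alpha> = colon (monom_span I gs (sum_list \<alpha>)
     {\<beta>. length \<beta> = length gs \<and> sum_list \<beta> = sum_list \<alpha> \<and> \<beta> < \<alpha>}) (gens_monom gs \<alpha>)"

context cring
begin

lemma monom_span_carr:
  assumes "ideal I R" "set gs \<subseteq> carrier R"
  shows "ideal_pow R I (Suc n) \<union> gens_monom gs ` Y \<subseteq> carrier R"
  using ideal_carr[OF ideal_pow_ideal[OF assms(1)]] gens_monom_closed[OF assms(2)] by blast

lemma ideal_monom_span:
  assumes "ideal I R" "set gs \<subseteq> carrier R"
  shows "ideal (monom_span I gs n Y) R"
  unfolding monom_span_def by (rule genideal_ideal[OF monom_span_carr[OF assms]])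

lemma monom_span_mem:
  assumes "ideal I R" "set gs \<subseteq> carrier R"
  shows "ideal_pow R I (Suc n) \<subseteq> monom_span I gs n Y" "\<alpha> \<in> Y \<Longrightarrow> gens_monom gs \<alpha> \<in> monom_span I gs n Y"
  using genideal_self[OF monom_span_carr[OF assms], of n Y] unfolding monom_span_def by auto

lemma monom_span_minimal:
  assumes "ideal K R" "ideal_pow R I (Suc n) \<subseteq> K" "\<And>\<alpha>. \<alpha> \<in> Y \<Longrightarrow> gens_monom gs \<alpha> \<in> K"
  shows "monom_span I gs n Y \<subseteq> K"
  unfolding monom_span_def by (rule genideal_minimal) (use assms in auto)

lemma ideal_monom_conductor:
  assumes "ideal I R" "set gs \<subseteq> carrier R"
  shows "ideal (monom_conductor I gs \<alpha>) R"
  unfolding monom_conductor_def by (rule ideal_colon[OF ideal_monom_span[OF assms] gens_monom_closed[OF assms(2)]])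

text \<open>Multiplication by \<open>g^\<gamma>\<close>, \<open>\<delta> = \<gamma> + \<alpha>\<close>, maps the span of \<open>I\<^sup>n\<^sup>+\<^sup>1\<close> and of the monomials below \<open>\<alpha>\<close> into the
  corresponding span for \<open>\<delta>\<close>, because the order is translation invariant.\<close>

lemma monom_conductor_mono:
  assumes I: "ideal I R" and gs: "set gs \<subseteq> I" and l: "length \<alpha> = length gs"
    and le: "list_all2 (\<le>) \<alpha> \<delta>"
  shows "monom_conductor I gs \<alpha> \<subseteq> monom_conductor I gs \<delta>"
proof
  have gsc: "set gs \<subseteq> carrier R" using gs ideal_carr[OF I] by auto
  obtain \<gamma> where g: "length \<gamma> = length gs" "\<delta> = map2 (+) \<gamma> \<alpha>" using le_list_diff[OF le] l by auto
  have lg: "length \<gamma> = length \<alpha>" using g(1) l by simp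
  let ?S = "\<lambda>\<alpha>. monom_span I gs (sum_list \<alpha>) {\<beta>. length \<beta> = length gs \<and> sum_list \<beta> = sum_list \<alpha> \<and> \<beta> < \<alpha>}"
  note cl = gens_monom_closed[OF gsc]
  have sd: "sum_list \<delta> = sum_list \<gamma> + sum_list \<alpha>" unfolding g(2) by (rule sum_list_map2_add[OF lg])
  have Sd: "ideal (?S \<delta>) R" by (rule ideal_monom_span[OF I gsc])
  have "?S \<alpha> \<subseteq> colon (?S \<delta>) (gens_monom gs \<gamma>)"
  proof (rule monom_span_minimal[OF ideal_colon[OF Sd cl]])
    show "ideal_pow R I (Suc (sum_list \<alpha>)) \<subseteq> colon (?S \<delta>) (gens_monom gs \<gamma>)"
    proof
      fix x assume x: "x \<in> ideal_pow R I (Suc (sum_list \<alpha>))"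
      have "x \<otimes> gens_monom gs \<gamma> \<in> ideal_pow R I (Suc (sum_list \<alpha>) + sum_list \<gamma>)"
        by (rule ideal_pow_mult[OF I x gens_monom_in_ideal_pow[OF gs I g(1)]])
      also have "Suc (sum_list \<alpha>) + sum_list \<gamma> = Suc (sum_list \<delta>)" using sd by simp
      finally have "x \<otimes> gens_monom gs \<gamma> \<in> ?S \<delta>" using monom_span_mem(1)[OF I gsc] by blast
      then show "x \<in> colon (?S \<delta>) (gens_monom gs \<gamma>)"
        using ideal_carr[OF ideal_pow_ideal[OF I] x] by (simp add: colon_def)
    qed
    fix \<beta> assume b: "\<beta> \<in> {\<beta>. length \<beta> = length gs \<and> sum_list \<beta> = sum_list \<alpha> \<and> \<beta> < \<alpha>}"
    have "map2 (+) \<gamma> \<beta> \<in> {\<beta>. length \<beta> = length gs \<and> sum_list \<beta> = sum_list \<delta> \<and> \<beta> < \<delta>}"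
      using b g l map2_add_less[of \<gamma> \<beta> \<alpha>] sum_list_map2_add[of \<gamma> \<beta>] sd by auto
    then have "gens_monom gs (map2 (+) \<gamma> \<beta>) \<in> ?S \<delta>" by (rule monom_span_mem(2)[OF I gsc])
    also have "gens_monom gs (map2 (+) \<gamma> \<beta>) = gens_monom gs \<gamma> \<otimes> gens_monom gs \<beta>" by (rule gens_monom_add[OF gsc]) (use g b in auto)
    also have "\<dots> = gens_monom gs \<beta> \<otimes> gens_monom gs \<gamma>" by (rule m_comm[OF cl cl])
    finally show "gens_monom gs \<beta> \<in> colon (?S \<delta>) (gens_monom gs \<gamma>)" using cl by (simp add: colon_def)
  qed
  moreover fix r assume r: "r \<in> monom_conductor I gs \<alpha>"
  ultimately have "r \<otimes> gens_monom gs \<alpha> \<in> colon (?S \<delta>) (gens_monom gs \<gamma>)" and rc: "r \<in> carrier R"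
    unfolding monom_conductor_def by (auto simp: colon_def)
  then have "(r \<otimes> gens_monom gs \<alpha>) \<otimes> gens_monom gs \<gamma> \<in> ?S \<delta>" by (simp add: colon_def)
  also have "(r \<otimes> gens_monom gs \<alpha>) \<otimes> gens_monom gs \<gamma> = r \<otimes> gens_monom gs \<delta>"
    unfolding g(2) gens_monom_add[OF gsc g(1) l] using m_comm[OF cl cl] m_assoc[OF rc cl cl] by metis
  finally show "r \<in> monom_conductor I gs \<delta>" using rc by (simp add: monom_conductor_def colon_def)
qed

lemma monom_conductor_incl:
  assumes I: "ideal I R" and gs: "set gs \<subseteq> I" and l: "length \<alpha> = length gs"
  shows "I \<subseteq> monom_conductor I gs \<alpha>"
proof
  fix x assume x: "x \<in> I"
  have gsc: "set gs \<subseteq> carrier R" using gs ideal_carr[OF I] by auto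
  have "x \<otimes> gens_monom gs \<alpha> \<in> ideal_pow R I (Suc (sum_list \<alpha>))"
    by (rule ideal_pow_mult1[OF x gens_monom_in_ideal_pow[OF gs I l]])
  then show "x \<in> monom_conductor I gs \<alpha>"
    using monom_span_mem(1)[OF I gsc] ideal_carr[OF I x] unfolding monom_conductor_def colon_def by blast
qed

text \<open>The set \<open>Y\<close> is an initial segment of the exponents of degree \<open>n\<close>; its largest member contributes the
  top factor \<open>R/a\<^sub>\<alpha>\<close> of the filtration.\<close>

lemma loc_regular_monom_span:
  assumes Q: "primeideal Q R" and I: "ideal I R" and gs: "set gs \<subseteq> I" and as: "set as \<subseteq> carrier R"
    and w: "\<And>\<alpha>. length \<alpha> = length gs \<Longrightarrow> loc_regular Q (monom_conductor I gs \<alpha>) (carrier R) as"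
    and "finite Y"
  shows "(\<And>\<alpha>. \<alpha> \<in> Y \<Longrightarrow> length \<alpha> = length gs \<and> sum_list \<alpha> = n) \<Longrightarrow>
    (\<And>\<alpha> \<beta>. \<alpha> \<in> Y \<Longrightarrow> length \<beta> = length gs \<Longrightarrow> sum_list \<beta> = n \<Longrightarrow> \<beta> < \<alpha> \<Longrightarrow> \<beta> \<in> Y) \<Longrightarrow>
    loc_regular Q (ideal_pow R I (Suc n)) (monom_span I gs n Y) as"
  using \<open>finite Y\<close>
proof (induction Y rule: finite_linorder_max_induct)
  case empty
  have gsc: "set gs \<subseteq> carrier R" using gs ideal_carr[OF I] by auto
  note pi = ideal_pow_ideal[OF I, of "Suc n"]
  have "monom_span I gs n {} \<subseteq> ideal_pow R I (Suc n)" by (rule monom_span_minimal[OF pi]) auto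
  then have "monom_span I gs n {} \<subseteq> saturate Q (ideal_pow R I (Suc n))" using saturate_incl[OF Q pi] by blast
  then show ?case by (rule loc_regular_trivial[OF Q ideal_monom_span[OF I gsc] pi _ as])
next
  case (insert b A)
  have gsc: "set gs \<subseteq> carrier R" using gs ideal_carr[OF I] by auto
  note cl = gens_monom_closed[OF gsc] and pi = ideal_pow_ideal[OF I, of "Suc n"] and gi = ideal_monom_span[OF I gsc, of n]
  have b: "length b = length gs" "sum_list b = n" using insert.prems(1) by auto
  have A: "A = {\<beta>. length \<beta> = length gs \<and> sum_list \<beta> = n \<and> \<beta> < b}"
    using insert.hyps(2) insert.prems by auto
  have down: "\<beta> \<in> A" if "\<alpha> \<in> A" "length \<beta> = length gs" "sum_list \<beta> = n" "\<beta> < \<alpha>" for \<alpha> \<beta>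
    using that unfolding A by auto
  have w1: "loc_regular Q (ideal_pow R I (Suc n)) (monom_span I gs n A) as"
    by (rule insert.IH[OF _ down]) (use insert.prems(1) in auto)
  have "colon (monom_span I gs n A) (gens_monom gs b) = monom_conductor I gs b" unfolding monom_conductor_def b(2) A ..
  then have w2: "loc_regular Q (monom_span I gs n A) (adjoin (monom_span I gs n A) (gens_monom gs b) (carrier R)) as"
    using loc_regular_cyclic[OF Q gi cl as] w[OF b(1)] by simp
  let ?L = "adjoin (monom_span I gs n A) (gens_monom gs b) (carrier R)"
  have L: "ideal ?L R" by (rule ideal_adjoin[OF gi cl oneideal])
  have sub: "monom_span I gs n A \<subseteq> ?L" by (rule adjoin_incl[OF gi cl oneideal])
  have "monom_span I gs n (insert b A) = ?L"
  proof
    have g: "\<And>\<alpha>. \<alpha> \<in> A \<Longrightarrow> gens_monom gs \<alpha> \<in> monom_span I gs n A" by (rule monom_span_mem(2)[OF I gsc])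
    show "monom_span I gs n (insert b A) \<subseteq> ?L"
      by (rule monom_span_minimal[OF L]) (use sub g monom_span_mem(1)[OF I gsc, of n A] adjoin_gen[OF gi cl] in auto)
    have "monom_span I gs n A \<subseteq> monom_span I gs n (insert b A)"
      by (rule monom_span_minimal[OF gi monom_span_mem(1)[OF I gsc] monom_span_mem(2)[OF I gsc]]) auto
    then show "?L \<subseteq> monom_span I gs n (insert b A)"
      using adjoin_gen_subset[OF gi] monom_span_mem(2)[OF I gsc] by auto
  qed
  then show ?case
    using loc_regular_extension[OF Q L pi gi monom_span_mem(1)[OF I gsc] sub as w1 w2] by simp
qed

lemma loc_regular_ideal_pow:
  assumes Q: "primeideal Q R" and I: "I = Idl (set gs)" and gsc: "set gs \<subseteq> carrier R" and as: "set as \<subseteq> carrier R"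
    and w: "\<And>\<alpha>. length \<alpha> = length gs \<Longrightarrow> loc_regular Q (monom_conductor I gs \<alpha>) (carrier R) as"
  shows "loc_regular Q (ideal_pow R I (Suc n)) (ideal_pow R I n) as"
proof -
  have Ii: "ideal I R" and gs: "set gs \<subseteq> I" unfolding I using genideal_ideal[OF gsc] genideal_self[OF gsc] by auto
  let ?X = "{\<alpha>. length \<alpha> = length gs \<and> sum_list \<alpha> = n}"
  have "monom_span I gs n ?X = ideal_pow R I n"
  proof
    show "monom_span I gs n ?X \<subseteq> ideal_pow R I n"
      by (rule monom_span_minimal[OF ideal_pow_ideal[OF Ii] ideal_pow_Suc_subset[OF Ii]])
        (use gens_monom_in_ideal_pow[OF gs Ii] in auto)
    have "Idl (gens_monom gs ` ?X) \<subseteq> monom_span I gs n ?X"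
      by (rule genideal_minimal[OF ideal_monom_span[OF Ii gsc]]) (intro image_subsetI monom_span_mem(2)[OF Ii gsc])
    then show "ideal_pow R I n \<subseteq> monom_span I gs n ?X" using ideal_pow_gens_monom[OF gsc I, of n] by blast
  qed
  moreover have "loc_regular Q (ideal_pow R I (Suc n)) (monom_span I gs n ?X) as"
    by (rule loc_regular_monom_span[OF Q Ii gs as w finite_exponents]) auto
  ultimately show ?thesis by simp
qed

end

text \<open>This takes the place of generic freeness of the associated graded ring over \<open>R/P\<close>, uniformly in the
  degree. The ideals \<open>a\<^sub>\<alpha>\<close> increase with \<open>\<alpha>\<close>, hence there are only finitely many of them, and one element
  outside \<open>P\<close> serves for all the factors \<open>R/a\<^sub>\<alpha>\<close> of all the modules \<open>I\<^sup>n/I\<^sup>n\<^sup>+\<^sup>1\<close>.\<close>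

theorem (in noeth_cring) generic_loc_regular_pow:
  assumes P: "P \<in> minimal_primes R I" and I: "ideal I R"
  shows "\<exists>f\<in>carrier R. f \<notin> P \<and> (\<forall>Q as. primeideal Q R \<longrightarrow> f \<notin> Q \<longrightarrow> set as \<subseteq> carrier R \<longrightarrow>
    loc_regular Q P (carrier R) as \<longrightarrow> (\<forall>n. loc_regular Q (ideal_pow R I (Suc n)) (ideal_pow R I n) as))"
proof -
  have Pp: "primeideal P R" using P by (simp add: minimal_primes_def)
  obtain A where A: "A \<subseteq> carrier R" "finite A" "I = Idl A" using finetely_gen[OF I] by blast
  obtain gs where gs: "set gs = A" using finite_list[OF A(2)] by blast
  have gsc: "set gs \<subseteq> carrier R" and Igs: "I = Idl (set gs)" and gsI: "set gs \<subseteq> I"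
    using A gs genideal_self[OF A(1)] by auto
  let ?A = "monom_conductor I gs ` {\<alpha>. length \<alpha> = length gs}"
  have fin: "finite ?A"
    by (rule finite_monotone_ideals) (use ideal_monom_conductor[OF I gsc] monom_conductor_mono[OF I gsI] in auto)
  have cmb: "finite B \<Longrightarrow> (\<And>K. K \<in> B \<Longrightarrow> ideal K R \<and> I \<subseteq> K) \<Longrightarrow>
    \<exists>f\<in>carrier R. f \<notin> P \<and> (\<forall>Q as. primeideal Q R \<longrightarrow> f \<notin> Q \<longrightarrow> set as \<subseteq> carrier R \<longrightarrow>
      loc_regular Q P (carrier R) as \<longrightarrow> (\<forall>K\<in>B. loc_regular Q K (carrier R) as))" for B
  proof (induction B rule: finite_induct)
    case empty
    then show ?case using prime_notone[OF Pp] by (intro bexI[of _ \<one>]) auto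
  next
    case (insert K B)
    obtain f where f: "f \<in> carrier R" "f \<notin> P" and fw: "\<And>Q as. primeideal Q R \<Longrightarrow> f \<notin> Q \<Longrightarrow> set as \<subseteq> carrier R \<Longrightarrow>
      loc_regular Q P (carrier R) as \<Longrightarrow> (\<forall>K\<in>B. loc_regular Q K (carrier R) as)" using insert.IH insert.prems by blast
    have "ideal K R" "I \<subseteq> K" using insert.prems[of K] by auto
    then obtain g where g: "g \<in> carrier R" "g \<notin> P" and gw: "\<And>Q as. primeideal Q R \<Longrightarrow> g \<notin> Q \<Longrightarrow> set as \<subseteq> carrier R \<Longrightarrow>
      loc_regular Q P (carrier R) as \<Longrightarrow> loc_regular Q K (carrier R) as"
      using generic_loc_regular_quotient[OF P] by blast
    show ?case
    proof (rule bexI[of _ "f \<otimes> g"], intro conjI allI impI)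
      show "f \<otimes> g \<notin> P" using prime_mult[OF Pp f(1) g(1)] f g by blast
      fix Q as assume h: "primeideal Q R" "f \<otimes> g \<notin> Q" "set as \<subseteq> carrier R" "loc_regular Q P (carrier R) as"
      have "f \<notin> Q" "g \<notin> Q"
        using h(2) ideal_mult[OF prime_ideal[OF h(1)]] ideal_mult'[OF prime_ideal[OF h(1)]] f(1) g(1) by auto
      then show "\<forall>K\<in>insert K B. loc_regular Q K (carrier R) as" using fw gw h by blast
    qed (use f g in simp)
  qed
  have "\<exists>f\<in>carrier R. f \<notin> P \<and> (\<forall>Q as. primeideal Q R \<longrightarrow> f \<notin> Q \<longrightarrow> set as \<subseteq> carrier R \<longrightarrow>
      loc_regular Q P (carrier R) as \<longrightarrow> (\<forall>K\<in>?A. loc_regular Q K (carrier R) as))"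
    by (rule cmb[OF fin]) (use ideal_monom_conductor[OF I gsc] monom_conductor_incl[OF I gsI] in auto)
  then obtain f where f: "f \<in> carrier R" "f \<notin> P" and fw: "\<And>Q as. primeideal Q R \<Longrightarrow> f \<notin> Q \<Longrightarrow> set as \<subseteq> carrier R \<Longrightarrow>
      loc_regular Q P (carrier R) as \<Longrightarrow> (\<forall>K\<in>?A. loc_regular Q K (carrier R) as)"
    by blast
  have "\<forall>n. loc_regular Q (ideal_pow R I (Suc n)) (ideal_pow R I n) as"
    if h: "primeideal Q R" "f \<notin> Q" "set as \<subseteq> carrier R" "loc_regular Q P (carrier R) as" for Q as
    using loc_regular_ideal_pow[OF h(1) Igs gsc h(3)] fw[OF h] by blast
  then show ?thesis using f by blast
qed

section \<open>Localization\<close>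

locale mult_set = cring R for R (structure) +
  fixes S :: "'a set"
  assumes S_carr: "S \<subseteq> carrier R" and S_one: "\<one> \<in> S" and S_mult: "s \<in> S \<Longrightarrow> t \<in> S \<Longrightarrow> s \<otimes> t \<in> S"
begin

abbreviation "L \<equiv> localization R S"
abbreviation "fr \<equiv> loc_frac R S"

lemma Sc: "s \<in> S \<Longrightarrow> s \<in> carrier R" using S_carr by auto

lemma frac_mem_iff: "(b, t) \<in> fr a s \<longleftrightarrow> b \<in> carrier R \<and> t \<in> S \<and> (\<exists>u\<in>S. u \<otimes> t \<otimes> a = u \<otimes> s \<otimes> b)"
  by (simp add: loc_frac_def)

lemma frac_refl: "a \<in> carrier R \<Longrightarrow> s \<in> S \<Longrightarrow> (a, s) \<in> fr a s"
  using S_one by (auto simp: frac_mem_iff)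

lemma frac_subset:
  assumes "a \<in> carrier R" "b \<in> carrier R" "s \<in> S" "t \<in> S" "u \<in> S" "u \<otimes> t \<otimes> a = u \<otimes> s \<otimes> b"
  shows "fr a s \<subseteq> fr b t"
proof
  fix p assume "p \<in> fr a s"
  then obtain c w v where p: "p = (c, w)" "c \<in> carrier R" "w \<in> S" "v \<in> S" "v \<otimes> w \<otimes> a = v \<otimes> s \<otimes> c"
    by (cases p) (auto simp: frac_mem_iff)
  note c = assms(1,2) p(2) Sc[OF assms(3)] Sc[OF assms(4)] Sc[OF assms(5)] Sc[OF p(3)] Sc[OF p(4)]
  have "(u \<otimes> v \<otimes> s) \<otimes> w \<otimes> b = v \<otimes> w \<otimes> (u \<otimes> s \<otimes> b)" using c by algebra
  also have "\<dots> = u \<otimes> t \<otimes> (v \<otimes> w \<otimes> a)" unfolding assms(6)[symmetric] using c by algebra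
  also have "\<dots> = (u \<otimes> v \<otimes> s) \<otimes> t \<otimes> c" unfolding p(5) using c by algebra
  finally show "p \<in> fr b t" using p S_mult assms by (auto simp: frac_mem_iff intro!: bexI[of _ "u \<otimes> v \<otimes> s"])
qed

lemma frac_eqI:
  assumes "a \<in> carrier R" "b \<in> carrier R" "s \<in> S" "t \<in> S" "u \<in> S" "u \<otimes> t \<otimes> a = u \<otimes> s \<otimes> b"
  shows "fr a s = fr b t"
  using frac_subset[OF assms] frac_subset[OF assms(2,1,4,3,5) assms(6)[symmetric]] by blast

lemma frac_eq_iff:
  assumes "a \<in> carrier R" "b \<in> carrier R" "s \<in> S" "t \<in> S"
  shows "fr a s = fr b t \<longleftrightarrow> (\<exists>u\<in>S. u \<otimes> t \<otimes> a = u \<otimes> s \<otimes> b)"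
proof
  assume "fr a s = fr b t"
  then have "(b, t) \<in> fr a s" using frac_refl assms by simp
  then show "\<exists>u\<in>S. u \<otimes> t \<otimes> a = u \<otimes> s \<otimes> b" by (simp add: frac_mem_iff)
qed (use frac_eqI[OF assms] in blast)

lemma frac_carr: "a \<in> carrier R \<Longrightarrow> s \<in> S \<Longrightarrow> fr a s \<in> carrier L"
  by (auto simp: localization_def)

lemma frac_cases:
  assumes "x \<in> carrier L" obtains a s where "a \<in> carrier R" "s \<in> S" "x = fr a s"
  using assms by (auto simp: localization_def)

lemma frac_mult:
  assumes a: "a \<in> carrier R" "b \<in> carrier R" "s \<in> S" "t \<in> S"
  shows "fr a s \<otimes>\<^bsub>L\<^esub> fr b t = fr (a \<otimes> b) (s \<otimes> t)"
proof -
  have eq: "fr (a' \<otimes> b') (s' \<otimes> t') = fr (a \<otimes> b) (s \<otimes> t)" if m: "(a', s') \<in> fr a s" "(b', t') \<in> fr b t" for a' s' b' t'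
  proof -
    obtain u where u: "a' \<in> carrier R" "s' \<in> S" "u \<in> S" "u \<otimes> s' \<otimes> a = u \<otimes> s \<otimes> a'" using m by (auto simp: frac_mem_iff)
    obtain v where v: "b' \<in> carrier R" "t' \<in> S" "v \<in> S" "v \<otimes> t' \<otimes> b = v \<otimes> t \<otimes> b'" using m by (auto simp: frac_mem_iff)
    note c = a(1,2) Sc[OF a(3)] Sc[OF a(4)] u(1) Sc[OF u(2)] Sc[OF u(3)] v(1) Sc[OF v(2)] Sc[OF v(3)]
    have "(u \<otimes> v) \<otimes> (s \<otimes> t) \<otimes> (a' \<otimes> b') = (u \<otimes> s \<otimes> a') \<otimes> (v \<otimes> t \<otimes> b')" using c by algebra
    also have "\<dots> = (u \<otimes> v) \<otimes> (s' \<otimes> t') \<otimes> (a \<otimes> b)" unfolding u(4)[symmetric] v(4)[symmetric] using c by algebra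
    finally show ?thesis using frac_eqI[of "a' \<otimes> b'" "a \<otimes> b" "s' \<otimes> t'" "s \<otimes> t" "u \<otimes> v"] c a u v S_mult by auto
  qed
  have "{fr (a' \<otimes> b') (s' \<otimes> t') | a' s' b' t'. (a', s') \<in> fr a s \<and> (b', t') \<in> fr b t} = {fr (a \<otimes> b) (s \<otimes> t)}"
    using eq frac_refl a by blast
  then show ?thesis by (simp add: localization_def)
qed

lemma frac_add:
  assumes a: "a \<in> carrier R" "b \<in> carrier R" "s \<in> S" "t \<in> S"
  shows "fr a s \<oplus>\<^bsub>L\<^esub> fr b t = fr (t \<otimes> a \<oplus> s \<otimes> b) (s \<otimes> t)"
proof -
  have eq: "fr (t' \<otimes> a' \<oplus> s' \<otimes> b') (s' \<otimes> t') = fr (t \<otimes> a \<oplus> s \<otimes> b) (s \<otimes> t)"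
    if m: "(a', s') \<in> fr a s" "(b', t') \<in> fr b t" for a' s' b' t'
  proof -
    obtain u where u: "a' \<in> carrier R" "s' \<in> S" "u \<in> S" "u \<otimes> s' \<otimes> a = u \<otimes> s \<otimes> a'" using m by (auto simp: frac_mem_iff)
    obtain v where v: "b' \<in> carrier R" "t' \<in> S" "v \<in> S" "v \<otimes> t' \<otimes> b = v \<otimes> t \<otimes> b'" using m by (auto simp: frac_mem_iff)
    note c = a(1,2) Sc[OF a(3)] Sc[OF a(4)] u(1) Sc[OF u(2)] Sc[OF u(3)] v(1) Sc[OF v(2)] Sc[OF v(3)]
    have "(u \<otimes> v) \<otimes> (s \<otimes> t) \<otimes> (t' \<otimes> a' \<oplus> s' \<otimes> b') =
        v \<otimes> t \<otimes> t' \<otimes> (u \<otimes> s \<otimes> a') \<oplus> u \<otimes> s \<otimes> s' \<otimes> (v \<otimes> t \<otimes> b')" using c by algebra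
    also have "\<dots> = (u \<otimes> v) \<otimes> (s' \<otimes> t') \<otimes> (t \<otimes> a \<oplus> s \<otimes> b)"
      unfolding u(4)[symmetric] v(4)[symmetric] using c by algebra
    finally show ?thesis
      using frac_eqI[of "t' \<otimes> a' \<oplus> s' \<otimes> b'" "t \<otimes> a \<oplus> s \<otimes> b" "s' \<otimes> t'" "s \<otimes> t" "u \<otimes> v"] c a u v S_mult by auto
  qed
  have "{fr (t' \<otimes> a' \<oplus> s' \<otimes> b') (s' \<otimes> t') | a' s' b' t'. (a', s') \<in> fr a s \<and> (b', t') \<in> fr b t} =
      {fr (t \<otimes> a \<oplus> s \<otimes> b) (s \<otimes> t)}"
    using eq frac_refl a by blast
  then show ?thesis by (simp add: localization_def)
qed

lemma frac_zero: "\<zero>\<^bsub>L\<^esub> = fr \<zero> \<one>" and frac_one: "\<one>\<^bsub>L\<^esub> = fr \<one> \<one>"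
  by (simp_all add: localization_def)

lemma frac_cancel:
  assumes "a \<in> carrier R" "s \<in> S" "t \<in> S"
  shows "fr (t \<otimes> a) (t \<otimes> s) = fr a s"
proof (rule frac_eqI[of _ _ _ _ \<one>])
  show "\<one> \<otimes> s \<otimes> (t \<otimes> a) = \<one> \<otimes> (t \<otimes> s) \<otimes> a" using assms Sc[OF assms(2)] Sc[OF assms(3)] by algebra
qed (use assms Sc S_mult S_one in auto)

lemma frac_zero_eq: "s \<in> S \<Longrightarrow> fr \<zero> s = fr \<zero> \<one>"
  using frac_cancel[of \<zero> \<one> s] S_one Sc by simp

lemma localization_cring: "cring L"
proof (rule cringI)
  show "abelian_group L"
  proof (rule abelian_groupI)
    fix x y assume "x \<in> carrier L" "y \<in> carrier L"
    then obtain a s b t where e: "a \<in> carrier R" "s \<in> S" "x = fr a s" "b \<in> carrier R" "t \<in> S" "y = fr b t"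
      by (metis frac_cases)
    show "x \<oplus>\<^bsub>L\<^esub> y \<in> carrier L" using e Sc S_mult by (auto simp: frac_add intro!: frac_carr)
    have "t \<otimes> a \<oplus> s \<otimes> b = s \<otimes> b \<oplus> t \<otimes> a" "s \<otimes> t = t \<otimes> s" using e(1,4) Sc[OF e(2)] Sc[OF e(5)] by algebra+
    then show "x \<oplus>\<^bsub>L\<^esub> y = y \<oplus>\<^bsub>L\<^esub> x" using e by (simp add: frac_add)
  next
    show "\<zero>\<^bsub>L\<^esub> \<in> carrier L" unfolding frac_zero by (rule frac_carr[OF zero_closed S_one])
  next
    fix x y z assume "x \<in> carrier L" "y \<in> carrier L" "z \<in> carrier L"
    then obtain a s b t c w where e: "a \<in> carrier R" "s \<in> S" "x = fr a s" "b \<in> carrier R" "t \<in> S" "y = fr b t"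
       "c \<in> carrier R" "w \<in> S" "z = fr c w" by (metis frac_cases)
    note k = e(1,4,7) Sc[OF e(2)] Sc[OF e(5)] Sc[OF e(8)]
    have "w \<otimes> (t \<otimes> a \<oplus> s \<otimes> b) \<oplus> (s \<otimes> t) \<otimes> c = (t \<otimes> w) \<otimes> a \<oplus> s \<otimes> (w \<otimes> b \<oplus> t \<otimes> c)"
      "(s \<otimes> t) \<otimes> w = s \<otimes> (t \<otimes> w)" using k by algebra+
    then show "x \<oplus>\<^bsub>L\<^esub> y \<oplus>\<^bsub>L\<^esub> z = x \<oplus>\<^bsub>L\<^esub> (y \<oplus>\<^bsub>L\<^esub> z)" using e(2,5,8) k S_mult unfolding e(3,6,9) by (simp add: frac_add)
  next
    fix x assume "x \<in> carrier L"
    then obtain a s where e: "a \<in> carrier R" "s \<in> S" "x = fr a s" by (metis frac_cases)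
    note k = e(1) Sc[OF e(2)]
    show "\<zero>\<^bsub>L\<^esub> \<oplus>\<^bsub>L\<^esub> x = x" using e k S_one by (simp add: frac_zero frac_add)
    have "s \<otimes> \<ominus> a \<oplus> s \<otimes> a = \<zero>" using k by algebra
    then have "fr (\<ominus> a) s \<oplus>\<^bsub>L\<^esub> x = \<zero>\<^bsub>L\<^esub>" using e frac_zero_eq[OF S_mult[OF e(2) e(2)]] by (simp add: frac_zero frac_add)
    then show "\<exists>y\<in>carrier L. y \<oplus>\<^bsub>L\<^esub> x = \<zero>\<^bsub>L\<^esub>" using frac_carr[of "\<ominus> a" s] e by blast
  qed
  show "comm_monoid L"
  proof (rule comm_monoidI)
    fix x y assume "x \<in> carrier L" "y \<in> carrier L"
    then obtain a s b t where e: "a \<in> carrier R" "s \<in> S" "x = fr a s" "b \<in> carrier R" "t \<in> S" "y = fr b t"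
      by (metis frac_cases)
    show "x \<otimes>\<^bsub>L\<^esub> y \<in> carrier L" using e Sc S_mult by (auto simp: frac_mult intro!: frac_carr)
    show "x \<otimes>\<^bsub>L\<^esub> y = y \<otimes>\<^bsub>L\<^esub> x" using e Sc by (simp add: frac_mult m_comm)
  next
    show "\<one>\<^bsub>L\<^esub> \<in> carrier L" unfolding frac_one by (rule frac_carr[OF one_closed S_one])
  next
    fix x y z assume "x \<in> carrier L" "y \<in> carrier L" "z \<in> carrier L"
    then obtain a s b t c w where e: "a \<in> carrier R" "s \<in> S" "x = fr a s" "b \<in> carrier R" "t \<in> S" "y = fr b t"
       "c \<in> carrier R" "w \<in> S" "z = fr c w" by (metis frac_cases)
    then show "x \<otimes>\<^bsub>L\<^esub> y \<otimes>\<^bsub>L\<^esub> z = x \<otimes>\<^bsub>L\<^esub> (y \<otimes>\<^bsub>L\<^esub> z)" using Sc S_mult by (simp add: frac_mult m_assoc)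
  next
    fix x assume "x \<in> carrier L"
    then obtain a s where e: "a \<in> carrier R" "s \<in> S" "x = fr a s" by (metis frac_cases)
    then show "\<one>\<^bsub>L\<^esub> \<otimes>\<^bsub>L\<^esub> x = x" using Sc S_one by (simp add: frac_one frac_mult)
  qed
  fix x y z assume "x \<in> carrier L" "y \<in> carrier L" "z \<in> carrier L"
  then obtain a s b t c w where e: "a \<in> carrier R" "s \<in> S" "x = fr a s" "b \<in> carrier R" "t \<in> S" "y = fr b t"
     "c \<in> carrier R" "w \<in> S" "z = fr c w" by (metis frac_cases)
  note k = e(1,4,7) Sc[OF e(2)] Sc[OF e(5)] Sc[OF e(8)]
  have "(t \<otimes> w) \<otimes> (a \<otimes> c) \<oplus> (s \<otimes> w) \<otimes> (b \<otimes> c) = w \<otimes> ((t \<otimes> a \<oplus> s \<otimes> b) \<otimes> c)"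
    "(s \<otimes> w) \<otimes> (t \<otimes> w) = w \<otimes> (s \<otimes> t \<otimes> w)" using k by algebra+
  then have "x \<otimes>\<^bsub>L\<^esub> z \<oplus>\<^bsub>L\<^esub> y \<otimes>\<^bsub>L\<^esub> z = fr (w \<otimes> ((t \<otimes> a \<oplus> s \<otimes> b) \<otimes> c)) (w \<otimes> (s \<otimes> t \<otimes> w))"
    using e(2,5,8) k S_mult unfolding e(3,6,9) by (simp add: frac_mult frac_add)
  also have "\<dots> = fr ((t \<otimes> a \<oplus> s \<otimes> b) \<otimes> c) (s \<otimes> t \<otimes> w)" by (rule frac_cancel) (use e(2,5,8) k S_mult in auto)
  finally show "(x \<oplus>\<^bsub>L\<^esub> y) \<otimes>\<^bsub>L\<^esub> z = x \<otimes>\<^bsub>L\<^esub> z \<oplus>\<^bsub>L\<^esub> y \<otimes>\<^bsub>L\<^esub> z"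
    using e(2,5,8) k S_mult unfolding e(3,6,9) by (simp add: frac_mult frac_add)
qed

abbreviation "lm \<equiv> loc_map R S"

lemma loc_map_hom: "lm \<in> ring_hom R L"
proof (rule ring_hom_memI)
  show "lm x \<in> carrier L" if "x \<in> carrier R" for x unfolding loc_map_def by (rule frac_carr[OF that S_one])
qed (use S_one in \<open>simp_all add: loc_map_def frac_mult frac_add frac_one\<close>)

lemma loc_map_zero_iff: "a \<in> carrier R \<Longrightarrow> lm a = \<zero>\<^bsub>L\<^esub> \<longleftrightarrow> (\<exists>u\<in>S. u \<otimes> a = \<zero>)"
  unfolding loc_map_def frac_zero using frac_eq_iff[of a \<zero> \<one> \<one>] S_one Sc by auto

lemma loc_map_unit:
  assumes "s \<in> S" shows "lm s \<in> Units L"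
proof -
  interpret L: cring L by (rule localization_cring)
  have e: "fr s \<one> \<otimes>\<^bsub>L\<^esub> fr \<one> s = \<one>\<^bsub>L\<^esub>"
    using assms Sc S_one frac_cancel[of \<one> \<one> s] by (simp add: frac_mult frac_one)
  have c: "fr s \<one> \<in> carrier L" "fr \<one> s \<in> carrier L" using frac_carr assms Sc S_one by auto
  have "fr \<one> s \<otimes>\<^bsub>L\<^esub> fr s \<one> = \<one>\<^bsub>L\<^esub>" using e L.m_comm[OF c] by simp
  then show ?thesis unfolding loc_map_def Units_def using e c by blast
qed

lemma frac_clear: "a \<in> carrier R \<Longrightarrow> s \<in> S \<Longrightarrow> fr a s \<otimes>\<^bsub>L\<^esub> lm s = lm a"
  using Sc S_one frac_cancel[of a \<one> s] by (simp add: loc_map_def frac_mult m_comm)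

end

section \<open>Homomorphisms with fractions as values\<close>

lemma (in ring_hom_cring) hom_Units: "x \<in> Units R \<Longrightarrow> h x \<in> Units S"
  unfolding Units_def by auto (metis hom_closed hom_mult hom_one)

lemma (in cring) unit_notin_prime:
  assumes P: "primeideal P R" and x: "x \<in> Units R" shows "x \<notin> P"
proof
  assume "x \<in> P"
  then have "inv x \<otimes> x \<in> P" using ideal_mult[OF prime_ideal[OF P]] x by blast
  then show False using prime_notone[OF P] x by simp
qed

text \<open>Localizations and quotients are of this kind, and so are their composites; this treats
  \<open>R \<rightarrow> R\<^sub>f \<rightarrow> R\<^sub>f/I\<^sub>f \<rightarrow> (R\<^sub>f/I\<^sub>f)\<^sub>p\<close> as a single map. As every element of the target is a fraction \<open>h(r)/h(s)\<close>
  with a unit as denominator, ideals of the target are determined by their contractions.\<close>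

locale frac_hom = ring_hom_cring R L h for R (structure) and L (structure) and h +
  assumes frac: "y \<in> carrier L \<Longrightarrow> \<exists>r\<in>carrier R. \<exists>s\<in>carrier R. h s \<in> Units L \<and> y \<otimes>\<^bsub>L\<^esub> h s = h r"

lemma (in mult_set) frac_hom_loc_map: "frac_hom R L lm"
proof -
  interpret L: cring L by (rule localization_cring)
  interpret ring_hom_cring R L lm by unfold_locales (rule loc_map_hom)
  show ?thesis
  proof
    fix y assume "y \<in> carrier L"
    then obtain a s where "a \<in> carrier R" "s \<in> S" "y = fr a s" by (rule frac_cases)
    then show "\<exists>r\<in>carrier R. \<exists>s\<in>carrier R. lm s \<in> Units L \<and> y \<otimes>\<^bsub>L\<^esub> lm s = lm r"
      using frac_clear loc_map_unit Sc by blast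
  qed
qed

context frac_hom
begin

text \<open>Contraction and extension of ideals along \<open>h\<close>.\<close>

definition ctr :: "'c set \<Rightarrow> 'a set" where "ctr J = {r \<in> carrier R. h r \<in> J}"
definition ext :: "'a set \<Rightarrow> 'c set" where
  "ext U = {y \<in> carrier L. \<exists>u\<in>U. \<exists>s\<in>carrier R. h s \<in> Units L \<and> y \<otimes>\<^bsub>L\<^esub> h s = h u}"

lemma unit_cancel_ideal:
  assumes J: "ideal J L" and y: "y \<in> carrier L" and u: "u \<in> Units L" and yu: "y \<otimes>\<^bsub>L\<^esub> u \<in> J"
  shows "y \<in> J"
proof -
  have uc: "u \<in> carrier L" and iu: "inv\<^bsub>L\<^esub> u \<in> carrier L" using u by auto
  have "y = inv\<^bsub>L\<^esub> u \<otimes>\<^bsub>L\<^esub> (y \<otimes>\<^bsub>L\<^esub> u)"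
    using y u uc iu S.m_lcomm[of "inv\<^bsub>L\<^esub> u" y u] by simp
  then show ?thesis using S.ideal_mult[OF J iu yu] by simp
qed

lemma unit_mult: "s \<in> carrier R \<Longrightarrow> t \<in> carrier R \<Longrightarrow> h s \<in> Units L \<Longrightarrow> h t \<in> Units L \<Longrightarrow> h (s \<otimes> t) \<in> Units L"
  by simp

lemma ideal_ctr:
  assumes J: "ideal J L" shows "ideal (ctr J) R"
  by (rule R.ideal_of_closure)
    (use S.ideal_zero[OF J] S.ideal_add[OF J] S.ideal_mult[OF J] in \<open>auto simp: ctr_def\<close>)

lemma prime_ctr:
  assumes J: "primeideal J L" shows "primeideal (ctr J) R"
proof (rule R.primeI[OF ideal_ctr[OF S.prime_ideal[OF J]]])
  show "\<one> \<notin> ctr J" using S.prime_notone[OF J] by (simp add: ctr_def)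
  show "a \<in> ctr J \<or> b \<in> ctr J" if "a \<in> carrier R" "b \<in> carrier R" "a \<otimes> b \<in> ctr J" for a b
    using S.prime_mult[OF J, of "h a" "h b"] that by (auto simp: ctr_def)
qed

lemma ctr_subset_iff:
  assumes J: "ideal J L" and J': "ideal J' L"
  shows "ctr J \<subseteq> ctr J' \<longleftrightarrow> J \<subseteq> J'"
proof
  assume sub: "ctr J \<subseteq> ctr J'"
  show "J \<subseteq> J'"
  proof
    fix y assume y: "y \<in> J"
    have yc: "y \<in> carrier L" by (rule S.ideal_carr[OF J y])
    then obtain r s where rs: "r \<in> carrier R" "s \<in> carrier R" "h s \<in> Units L" "y \<otimes>\<^bsub>L\<^esub> h s = h r" using frac by blast
    have "h r \<in> J" using S.ideal_mult'[OF J, of "h s" y] rs y by simp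
    then have "h r \<in> J'" using sub rs(1) by (auto simp: ctr_def)
    then show "y \<in> J'" using unit_cancel_ideal[OF J' yc rs(3)] rs(4) by simp
  qed
qed (auto simp: ctr_def)

lemma ctr_psubset_iff:
  assumes J: "ideal J L" and J': "ideal J' L"
  shows "ctr J \<subset> ctr J' \<longleftrightarrow> J \<subset> J'"
  using ctr_subset_iff[OF J J'] ctr_subset_iff[OF J' J] by blast

lemma hom_in_ext: "u \<in> carrier R \<Longrightarrow> u \<in> U \<Longrightarrow> h u \<in> ext U"
  unfolding ext_def by (intro CollectI conjI bexI[of _ u] bexI[of _ \<one>]) auto

lemma image_subset_ext: "ideal U R \<Longrightarrow> h ` U \<subseteq> ext U"
  using R.ideal_carr hom_in_ext by blast

lemma ideal_ext:
  assumes U: "ideal U R" shows "ideal (ext U) L"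
proof (rule S.ideal_of_closure)
  show "\<zero>\<^bsub>L\<^esub> \<in> ext U"
    using hom_in_ext[OF R.zero_closed R.ideal_zero[OF U]] by simp
  fix x y assume "x \<in> ext U" "y \<in> ext U"
  then obtain u s v t where e: "x \<in> carrier L" "u \<in> U" "s \<in> carrier R" "h s \<in> Units L" "x \<otimes>\<^bsub>L\<^esub> h s = h u"
      "y \<in> carrier L" "v \<in> U" "t \<in> carrier R" "h t \<in> Units L" "y \<otimes>\<^bsub>L\<^esub> h t = h v" by (auto simp: ext_def)
  have c: "u \<in> carrier R" "v \<in> carrier R" "h s \<in> carrier L" "h t \<in> carrier L" using R.ideal_carr[OF U] e by auto
  have "(x \<oplus>\<^bsub>L\<^esub> y) \<otimes>\<^bsub>L\<^esub> (h s \<otimes>\<^bsub>L\<^esub> h t) = h t \<otimes>\<^bsub>L\<^esub> (x \<otimes>\<^bsub>L\<^esub> h s) \<oplus>\<^bsub>L\<^esub> h s \<otimes>\<^bsub>L\<^esub> (y \<otimes>\<^bsub>L\<^esub> h t)" using e(1,6) c(3,4) by algebra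
  also have "\<dots> = h (t \<otimes> u \<oplus> s \<otimes> v)" unfolding e(5,10) using c e by simp
  finally have "(x \<oplus>\<^bsub>L\<^esub> y) \<otimes>\<^bsub>L\<^esub> h (s \<otimes> t) = h (t \<otimes> u \<oplus> s \<otimes> v)" using e by simp
  moreover have "t \<otimes> u \<oplus> s \<otimes> v \<in> U" using R.ideal_add[OF U] R.ideal_mult[OF U] e by auto
  ultimately show "x \<oplus>\<^bsub>L\<^esub> y \<in> ext U" using e unit_mult[OF e(3,8,4,9)] unfolding ext_def by blast
next
  fix z x assume z: "z \<in> carrier L" and "x \<in> ext U"
  then obtain u s where e: "x \<in> carrier L" "u \<in> U" "s \<in> carrier R" "h s \<in> Units L" "x \<otimes>\<^bsub>L\<^esub> h s = h u" by (auto simp: ext_def)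
  obtain r t where f: "r \<in> carrier R" "t \<in> carrier R" "h t \<in> Units L" "z \<otimes>\<^bsub>L\<^esub> h t = h r" using frac[OF z] by blast
  have c: "u \<in> carrier R" "h s \<in> carrier L" "h t \<in> carrier L" using R.ideal_carr[OF U] e f by auto
  have "(z \<otimes>\<^bsub>L\<^esub> x) \<otimes>\<^bsub>L\<^esub> (h t \<otimes>\<^bsub>L\<^esub> h s) = (z \<otimes>\<^bsub>L\<^esub> h t) \<otimes>\<^bsub>L\<^esub> (x \<otimes>\<^bsub>L\<^esub> h s)" using e(1) z c(2,3) by algebra
  then have "(z \<otimes>\<^bsub>L\<^esub> x) \<otimes>\<^bsub>L\<^esub> h (t \<otimes> s) = h (r \<otimes> u)" unfolding e(5) f(4) using c e f by simp
  then show "z \<otimes>\<^bsub>L\<^esub> x \<in> ext U"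
    using R.ideal_mult[OF U f(1) e(2)] unit_mult[OF f(2) e(3) f(3) e(4)] e f z unfolding ext_def by blast
qed (auto simp: ext_def)

lemma ext_minimal:
  assumes J: "ideal J L" and "h ` U \<subseteq> J" shows "ext U \<subseteq> J"
proof
  fix y assume "y \<in> ext U"
  then obtain u s where e: "y \<in> carrier L" "u \<in> U" "h s \<in> Units L" "y \<otimes>\<^bsub>L\<^esub> h s = h u" by (auto simp: ext_def)
  then show "y \<in> J" using unit_cancel_ideal[OF J e(1,3)] assms(2) by auto
qed

lemma genideal_image:
  assumes U: "ideal U R" shows "Idl\<^bsub>L\<^esub> (h ` U) = ext U"
proof
  have c: "h ` U \<subseteq> carrier L" using R.ideal_carr[OF U] by auto
  show "Idl\<^bsub>L\<^esub> (h ` U) \<subseteq> ext U" by (rule S.genideal_minimal[OF ideal_ext[OF U] image_subset_ext[OF U]])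
  show "ext U \<subseteq> Idl\<^bsub>L\<^esub> (h ` U)" by (rule ext_minimal[OF S.genideal_ideal[OF c] S.genideal_self[OF c]])
qed

lemma ext_ctr:
  assumes J: "ideal J L" shows "ext (ctr J) = J"
proof
  show "ext (ctr J) \<subseteq> J" by (rule ext_minimal[OF J]) (auto simp: ctr_def)
  show "J \<subseteq> ext (ctr J)"
  proof
    fix y assume y: "y \<in> J"
    have yc: "y \<in> carrier L" by (rule S.ideal_carr[OF J y])
    then obtain r s where rs: "r \<in> carrier R" "s \<in> carrier R" "h s \<in> Units L" "y \<otimes>\<^bsub>L\<^esub> h s = h r" using frac by blast
    have "h r \<in> J" using S.ideal_mult'[OF J, of "h s" y] rs y by simp
    then show "y \<in> ext (ctr J)" using rs yc by (auto simp: ext_def ctr_def)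
  qed
qed

lemma hom_mem_ext:
  assumes "ideal U R" "r \<in> carrier R"
  shows "h r \<in> ext U \<longleftrightarrow> (\<exists>s\<in>carrier R. h s \<in> Units L \<and> (\<exists>u\<in>U. h (s \<otimes> r) = h u))"
proof -
  have "h r \<otimes>\<^bsub>L\<^esub> h s = h (s \<otimes> r)" if "s \<in> carrier R" for s using that assms(2) S.m_comm by simp
  then show ?thesis using assms unfolding ext_def by auto
qed

lemma ideal_prod_ext:
  assumes U: "ideal U R" and V: "ideal V R"
  shows "ideal_prod L (ext U) (ext V) = ext (ideal_prod R U V)"
proof
  have UV: "ideal (ideal_prod R U V) R" by (rule R.ideal_prod_is_ideal[OF U V])
  show "ideal_prod L (ext U) (ext V) \<subseteq> ext (ideal_prod R U V)"
  proof (rule S.ideal_prod_subset[OF ideal_ext[OF UV]])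
    fix x y assume "x \<in> ext U" "y \<in> ext V"
    then obtain u s v t where e: "x \<in> carrier L" "u \<in> U" "s \<in> carrier R" "h s \<in> Units L" "x \<otimes>\<^bsub>L\<^esub> h s = h u"
      "y \<in> carrier L" "v \<in> V" "t \<in> carrier R" "h t \<in> Units L" "y \<otimes>\<^bsub>L\<^esub> h t = h v" by (auto simp: ext_def)
    have c: "u \<in> carrier R" "v \<in> carrier R" "h s \<in> carrier L" "h t \<in> carrier L"
      using R.ideal_carr[OF U] R.ideal_carr[OF V] e by auto
    have "(x \<otimes>\<^bsub>L\<^esub> y) \<otimes>\<^bsub>L\<^esub> (h s \<otimes>\<^bsub>L\<^esub> h t) = (x \<otimes>\<^bsub>L\<^esub> h s) \<otimes>\<^bsub>L\<^esub> (y \<otimes>\<^bsub>L\<^esub> h t)" using e(1,6) c(3,4) by algebra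
    then have "(x \<otimes>\<^bsub>L\<^esub> y) \<otimes>\<^bsub>L\<^esub> h (s \<otimes> t) = h (u \<otimes> v)" unfolding e(5,10) using c e by simp
    then show "x \<otimes>\<^bsub>L\<^esub> y \<in> ext (ideal_prod R U V)"
      using ideal_prod.prod[OF e(2,7), of R] unit_mult[OF e(3,8,4,9)] e unfolding ext_def by blast
  qed
  have i: "ideal (ideal_prod L (ext U) (ext V)) L" by (rule S.ideal_prod_is_ideal[OF ideal_ext[OF U] ideal_ext[OF V]])
  show "ext (ideal_prod R U V) \<subseteq> ideal_prod L (ext U) (ext V)"
  proof (rule ext_minimal[OF i])
    have "ideal_prod R U V \<subseteq> ctr (ideal_prod L (ext U) (ext V))"
    proof (rule R.ideal_prod_subset[OF ideal_ctr[OF i]])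
      fix x y assume xy: "x \<in> U" "y \<in> V"
      have "x \<in> carrier R" "y \<in> carrier R" using R.ideal_carr[OF U] R.ideal_carr[OF V] xy by auto
      moreover have "h x \<in> ext U" "h y \<in> ext V" using image_subset_ext[OF U] image_subset_ext[OF V] xy by auto
      ultimately show "x \<otimes> y \<in> ctr (ideal_prod L (ext U) (ext V))" by (auto simp: ctr_def intro: ideal_prod.prod)
    qed
    then show "h ` ideal_prod R U V \<subseteq> ideal_prod L (ext U) (ext V)" by (auto simp: ctr_def)
  qed
qed

lemma ideal_pow_ext:
  assumes U: "ideal U R" shows "ideal_pow L (ext U) n = ext (ideal_pow R U n)"
proof (induction n)
  case 0
  have "\<one>\<^bsub>L\<^esub> \<in> ext (carrier R)" using image_subset_ext[OF R.oneideal] hom_one by force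
  then have "ext (carrier R) = carrier L" using ideal.one_imp_carrier[OF ideal_ext[OF R.oneideal]] by simp
  then show ?case by simp
next
  case (Suc n)
  then show ?case using ideal_prod_ext[OF U R.ideal_pow_ideal[OF U]] by simp
qed

lemma noetherian_target:
  assumes "noetherian_ring R" shows "noeth_cring L"
proof -
  have "noetherian_ring L"
  proof (rule S.noetherian_ringI)
    fix J assume J: "ideal J L"
    obtain A where A: "A \<subseteq> carrier R" "finite A" "ctr J = Idl A"
      using noetherian_ring.finetely_gen[OF assms ideal_ctr[OF J]] by blast
    have c: "h ` A \<subseteq> carrier L" using A by auto
    have AJ: "A \<subseteq> ctr J" using A R.genideal_self[OF A(1)] by simp
    have "J = Idl\<^bsub>L\<^esub> (h ` A)"
    proof
      show "Idl\<^bsub>L\<^esub> (h ` A) \<subseteq> J" by (rule S.genideal_minimal[OF J]) (use AJ in \<open>auto simp: ctr_def\<close>)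
      have i: "ideal (Idl\<^bsub>L\<^esub> (h ` A)) L" by (rule S.genideal_ideal[OF c])
      have "ctr J \<subseteq> ctr (Idl\<^bsub>L\<^esub> (h ` A))" unfolding A(3)
        by (rule R.genideal_minimal[OF ideal_ctr[OF i]]) (use A(1) S.genideal_self[OF c] in \<open>auto simp: ctr_def\<close>)
      then show "J \<subseteq> Idl\<^bsub>L\<^esub> (h ` A)" using ctr_subset_iff[OF J i] by simp
    qed
    then show "\<exists>A\<subseteq>carrier L. finite A \<and> J = Idl\<^bsub>L\<^esub> A" using c A(2) by blast
  qed
  then show ?thesis by (simp add: noeth_cring_def S.is_cring)
qed

lemma prime_chain_ctr:
  assumes "prime_chain L Ps" shows "prime_chain R (map ctr Ps)"
proof -
  have "sorted_wrt (\<lambda>P Q. ctr P \<subset> ctr Q) Ps"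
    by (rule sorted_wrt_mono_rel[of Ps "(\<subset>)"])
      (use assms ctr_psubset_iff S.prime_ideal in \<open>auto simp: prime_chain_def\<close>)
  then show ?thesis using assms prime_ctr by (auto simp: prime_chain_def sorted_wrt_map)
qed

end

lemma frac_hom_comp:
  assumes "frac_hom R A g" "frac_hom A L h" shows "frac_hom R L (\<lambda>x. h (g x))"
proof -
  interpret g: frac_hom R A g by fact
  interpret h: frac_hom A L h by fact
  have "(\<lambda>x. h (g x)) \<in> ring_hom R L" by (rule ring_hom_memI) auto
  then interpret ring_hom_cring R L "\<lambda>x. h (g x)" by unfold_locales
  show ?thesis
  proof
    fix y assume y: "y \<in> carrier L"
    obtain u t where ut: "u \<in> carrier A" "t \<in> carrier A" "h t \<in> Units L" "y \<otimes>\<^bsub>L\<^esub> h t = h u" using h.frac[OF y] by blast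
    obtain r s where rs: "r \<in> carrier R" "s \<in> carrier R" "g s \<in> Units A" "u \<otimes>\<^bsub>A\<^esub> g s = g r" using g.frac[OF ut(1)] by blast
    obtain r' s' where rs': "r' \<in> carrier R" "s' \<in> carrier R" "g s' \<in> Units A" "t \<otimes>\<^bsub>A\<^esub> g s' = g r'" using g.frac[OF ut(2)] by blast
    have r'U: "h (g r') \<in> Units L" using ut(2,3) h.hom_Units[OF rs'(3)] rs'(2) unfolding rs'(4)[symmetric] by simp
    have c: "h t \<in> carrier L" "h (g s) \<in> carrier L" "h (g s') \<in> carrier L" "h (g r') \<in> carrier L" using ut rs rs' by auto
    have e1: "h t \<otimes>\<^bsub>L\<^esub> h (g s') = h (g r')" using rs' ut by (metis g.hom_closed h.hom_mult)
    have e2: "h u \<otimes>\<^bsub>L\<^esub> h (g s) = h (g r)" using rs ut by (metis g.hom_closed h.hom_mult)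
    have "y \<otimes>\<^bsub>L\<^esub> (h (g r') \<otimes>\<^bsub>L\<^esub> h (g s)) = ((y \<otimes>\<^bsub>L\<^esub> h t) \<otimes>\<^bsub>L\<^esub> h (g s)) \<otimes>\<^bsub>L\<^esub> h (g s')"
      unfolding e1[symmetric] using c y by algebra
    also have "\<dots> = h (g r) \<otimes>\<^bsub>L\<^esub> h (g s')" unfolding ut(4) e2 ..
    finally have "y \<otimes>\<^bsub>L\<^esub> h (g (r' \<otimes>\<^bsub>R\<^esub> s)) = h (g (r \<otimes>\<^bsub>R\<^esub> s'))" using rs rs' by simp
    moreover have "h (g (r' \<otimes>\<^bsub>R\<^esub> s)) \<in> Units L" using r'U h.hom_Units[OF rs(3)] rs rs' by simp
    moreover have "r \<otimes>\<^bsub>R\<^esub> s' \<in> carrier R" "r' \<otimes>\<^bsub>R\<^esub> s \<in> carrier R" using rs rs' by auto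
    ultimately show "\<exists>r\<in>carrier R. \<exists>s\<in>carrier R. h (g s) \<in> Units L \<and> y \<otimes>\<^bsub>L\<^esub> h (g s) = h (g r)"
      by blast
  qed
qed

context frac_hom
begin

lemma hom_eq_imp_diff: "a \<in> carrier R \<Longrightarrow> b \<in> carrier R \<Longrightarrow> h a = h b \<Longrightarrow> h (a \<ominus> b) = \<zero>\<^bsub>L\<^esub>"
  by (simp add: R.minus_eq S.r_neg)

lemma prime_ext:
  assumes p: "primeideal p R" and ker: "\<And>r. r \<in> carrier R \<Longrightarrow> h r = \<zero>\<^bsub>L\<^esub> \<Longrightarrow> r \<in> p"
    and units: "\<And>s. s \<in> carrier R \<Longrightarrow> h s \<in> Units L \<Longrightarrow> s \<notin> p"
  shows "ctr (ext p) = p" "primeideal (ext p) L"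
proof -
  note pi = R.prime_ideal[OF p]
  show c: "ctr (ext p) = p"
  proof
    show "p \<subseteq> ctr (ext p)" using image_subset_ext[OF pi] R.ideal_carr[OF pi] by (auto simp: ctr_def)
    show "ctr (ext p) \<subseteq> p"
    proof
      fix r assume "r \<in> ctr (ext p)"
      then have r: "r \<in> carrier R" "h r \<in> ext p" by (auto simp: ctr_def)
      then obtain s u where s: "s \<in> carrier R" "h s \<in> Units L" "u \<in> p" "h (s \<otimes> r) = h u"
        using hom_mem_ext[OF pi] by blast
      have uc: "u \<in> carrier R" by (rule R.ideal_carr[OF pi s(3)])
      have "s \<otimes> r \<ominus> u \<in> p" using ker hom_eq_imp_diff[OF _ uc s(4)] s(1) r(1) uc by auto
      then have "(s \<otimes> r \<ominus> u) \<oplus> u \<in> p" using R.ideal_add[OF pi] s(3) by blast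
      moreover have "(s \<otimes> r \<ominus> u) \<oplus> u = s \<otimes> r" using s(1) r(1) uc by algebra
      ultimately show "r \<in> p" using R.prime_mult[OF p s(1) r(1)] units[OF s(1,2)] by auto
    qed
  qed
  have ei: "ideal (ext p) L" by (rule ideal_ext[OF pi])
  show "primeideal (ext p) L"
  proof (rule S.primeI[OF ei])
    show "\<one>\<^bsub>L\<^esub> \<notin> ext p"
    proof
      assume "\<one>\<^bsub>L\<^esub> \<in> ext p"
      then have "\<one> \<in> ctr (ext p)" by (simp add: ctr_def)
      then show False using c R.prime_notone[OF p] by simp
    qed
    fix x y assume xy: "x \<in> carrier L" "y \<in> carrier L" "x \<otimes>\<^bsub>L\<^esub> y \<in> ext p"
    obtain r s where rs: "r \<in> carrier R" "s \<in> carrier R" "h s \<in> Units L" "x \<otimes>\<^bsub>L\<^esub> h s = h r" using frac[OF xy(1)] by blast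
    obtain v t where vt: "v \<in> carrier R" "t \<in> carrier R" "h t \<in> Units L" "y \<otimes>\<^bsub>L\<^esub> h t = h v" using frac[OF xy(2)] by blast
    have k: "h s \<in> carrier L" "h t \<in> carrier L" using rs vt by auto
    have "h (r \<otimes> v) = (x \<otimes>\<^bsub>L\<^esub> h s) \<otimes>\<^bsub>L\<^esub> (y \<otimes>\<^bsub>L\<^esub> h t)" unfolding rs(4) vt(4) using rs vt by simp
    also have "\<dots> = (h s \<otimes>\<^bsub>L\<^esub> h t) \<otimes>\<^bsub>L\<^esub> (x \<otimes>\<^bsub>L\<^esub> y)" using xy k by algebra
    also have "\<dots> \<in> ext p" using S.ideal_mult[OF ei _ xy(3)] k by simp
    finally have "r \<otimes> v \<in> ctr (ext p)" using rs vt by (simp add: ctr_def)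
    then have "r \<in> p \<or> v \<in> p" unfolding c using R.prime_mult[OF p rs(1) vt(1)] by blast
    then have "h r \<in> ext p \<or> h v \<in> ext p" using hom_in_ext rs(1) vt(1) by blast
    then show "x \<in> ext p \<or> y \<in> ext p"
      using unit_cancel_ideal[OF ei xy(1) rs(3)] unit_cancel_ideal[OF ei xy(2) vt(3)] rs(4) vt(4) by auto
  qed
qed

lemma prime_chain_ext:
  assumes ch: "prime_chain R Ps" and ex: "\<And>p. p \<in> set Ps \<Longrightarrow> ctr (ext p) = p \<and> primeideal (ext p) L"
  shows "prime_chain L (map ext Ps)"
proof -
  have so: "sorted_wrt (\<subset>) Ps" and ne: "Ps \<noteq> []" using ch by (auto simp: prime_chain_def)
  have "sorted_wrt (\<lambda>p q. ext p \<subset> ext q) Ps"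
  proof (rule sorted_wrt_mono_rel[OF _ so])
    fix p q assume pq: "p \<in> set Ps" "q \<in> set Ps" "p \<subset> q"
    have "ideal (ext p) L" "ideal (ext q) L" using ex pq S.prime_ideal by blast+
    then show "ext p \<subset> ext q" using ctr_psubset_iff[of "ext p" "ext q"] ex pq by simp
  qed
  then show ?thesis using ne ex by (auto simp: prime_chain_def sorted_wrt_map)
qed

text \<open>For surjective \<open>h\<close> a prime over the kernel contains no \<open>s\<close> with \<open>h(s)\<close> a unit: \<open>h(s) h(r) = 1\<close> would put
  \<open>1 = sr - (sr - 1)\<close> into it.\<close>

lemma prime_ext_surj:
  assumes surj: "h ` carrier R = carrier L" and p: "primeideal p R"
    and ker: "\<And>r. r \<in> carrier R \<Longrightarrow> h r = \<zero>\<^bsub>L\<^esub> \<Longrightarrow> r \<in> p"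
  shows "ctr (ext p) = p" "primeideal (ext p) L"
proof -
  have "s \<notin> p" if s: "s \<in> carrier R" "h s \<in> Units L" for s
  proof
    assume sp: "s \<in> p"
    note pi = R.prime_ideal[OF p]
    obtain y where y: "y \<in> carrier L" "h s \<otimes>\<^bsub>L\<^esub> y = \<one>\<^bsub>L\<^esub>" using s(2) unfolding Units_def by auto
    then obtain r where r: "r \<in> carrier R" "y = h r" using surj by auto
    have e: "h (s \<otimes> r \<ominus> \<one>) = \<zero>\<^bsub>L\<^esub>" by (rule hom_eq_imp_diff) (use s r y in auto)
    have "s \<otimes> r \<ominus> \<one> \<in> p" by (rule ker[OF _ e]) (use s r in simp)
    then have "s \<otimes> r \<ominus> (s \<otimes> r \<ominus> \<one>) \<in> p"
      using R.ideal_minus[OF pi R.ideal_mult'[OF pi r(1) sp]] by blast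
    moreover have "s \<otimes> r \<ominus> (s \<otimes> r \<ominus> \<one>) = \<one>" using s(1) r(1) by algebra
    ultimately show False using R.prime_notone[OF p] by simp
  qed
  then show "ctr (ext p) = p" "primeideal (ext p) L" using prime_ext[OF p ker] by blast+
qed

end

section \<open>Homomorphisms to local rings\<close>

text \<open>The target is a local ring, namely the localization at \<open>Q\<close> of \<open>R\<close> modulo the kernel of \<open>h\<close>.\<close>

locale frac_local = frac_hom +
  fixes Q
  assumes Q_prime: "primeideal Q R"
    and unit_iff: "s \<in> carrier R \<Longrightarrow> h s \<in> Units L \<longleftrightarrow> s \<notin> Q"

context frac_local
begin

lemma ker_subset_Q:
  assumes "r \<in> carrier R" "h r = \<zero>\<^bsub>L\<^esub>" shows "r \<in> Q"
proof (rule ccontr)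
  assume "r \<notin> Q"
  then have "\<zero>\<^bsub>L\<^esub> \<in> Units L" using unit_iff[OF assms(1)] unfolding assms(2) by simp
  then have "\<one>\<^bsub>L\<^esub> = \<zero>\<^bsub>L\<^esub>" unfolding Units_def by auto
  moreover have "\<one>\<^bsub>L\<^esub> \<in> Units L" by simp
  ultimately have "h \<zero> \<in> Units L" by simp
  then show False using unit_iff[OF R.zero_closed] R.ideal_zero[OF R.prime_ideal[OF Q_prime]] by simp
qed

lemma ctr_subset_Q:
  assumes J: "ideal J L" and "\<one>\<^bsub>L\<^esub> \<notin> J" shows "ctr J \<subseteq> Q"
proof
  fix r assume "r \<in> ctr J"
  then have r: "r \<in> carrier R" "h r \<in> J" by (auto simp: ctr_def)
  show "r \<in> Q"
  proof (rule ccontr)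
    assume "r \<notin> Q"
    then have u: "h r \<in> Units L" using unit_iff r by simp
    have "\<one>\<^bsub>L\<^esub> \<otimes>\<^bsub>L\<^esub> h r \<in> J" using r by simp
    then show False using unit_cancel_ideal[OF J S.one_closed u] assms(2) by simp
  qed
qed

lemma max_prime: "ctr (ext Q) = Q" "primeideal (ext Q) L"
  using prime_ext[OF Q_prime ker_subset_Q] unit_iff by auto

lemma local_max_ideal:
  assumes J: "ideal J L" and "\<one>\<^bsub>L\<^esub> \<notin> J" shows "J \<subseteq> ext Q"
  using ctr_subset_Q[OF assms] max_prime(1) ctr_subset_iff[OF J S.prime_ideal[OF max_prime(2)]] by simp

lemma maximal_ext: "maximalideal J L \<longleftrightarrow> J = ext Q"
proof
  assume "maximalideal J L"
  then interpret J: maximalideal J L .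
  have "\<one>\<^bsub>L\<^esub> \<notin> J" using J.one_imp_carrier J.I_notcarr by blast
  then have "J \<subseteq> ext Q" by (rule local_max_ideal[OF J.is_ideal])
  moreover have "ext Q \<noteq> carrier L" using S.prime_notone[OF max_prime(2)] by auto
  moreover have "ext Q \<subseteq> carrier L" by (auto simp: ext_def)
  ultimately show "J = ext Q" using J.I_maximal[OF S.prime_ideal[OF max_prime(2)]] by blast
next
  assume "J = ext Q"
  moreover have "maximalideal (ext Q) L"
  proof (rule maximalidealI[OF S.prime_ideal[OF max_prime(2)]])
    show "carrier L \<noteq> ext Q" using S.prime_notone[OF max_prime(2)] by auto
    fix K assume K: "ideal K L" "ext Q \<subseteq> K" "K \<subseteq> carrier L"
    show "K = ext Q \<or> K = carrier L"
      using local_max_ideal[OF K(1)] ideal.one_imp_carrier[OF K(1)] K(2) by blast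
  qed
  ultimately show "maximalideal J L" by simp
qed

text \<open>A tower of primes of \<open>L\<close> generated by images of elements \<open>a\<^sub>i\<close> of \<open>R\<close> contracts to the saturations of
  \<open>U + (a\<^sub>1, \<dots>, a\<^sub>i)\<close>. Since these are prime and do not contain \<open>a\<^sub>i\<^sub>+\<^sub>1\<close>, multiplication by \<open>a\<^sub>i\<^sub>+\<^sub>1\<close> is injective
  modulo each of them.\<close>

lemma tower_loc_regular:
  "set as \<subseteq> carrier R \<Longrightarrow> ideal U R \<Longrightarrow> (\<And>r. r \<in> carrier R \<Longrightarrow> h r = \<zero>\<^bsub>L\<^esub> \<Longrightarrow> r \<in> U) \<Longrightarrow> ideal J L \<Longrightarrow>
    ctr J = R.saturate Q U \<Longrightarrow> S.prime_tower J (map h as) \<Longrightarrow> R.loc_regular Q U (carrier R) as"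
proof (induction as arbitrary: U J)
  case (Cons a as)
  note U = Cons.prems(2) and ker = Cons.prems(3) and J = Cons.prems(4) and cJ = Cons.prems(5)
  have a: "a \<in> carrier R" and as: "set as \<subseteq> carrier R" using Cons.prems(1) by auto
  have Jp: "primeideal J L" and aJ: "h a \<notin> J" and tow: "S.prime_tower (S.adjoin J (h a) (carrier L)) (map h as)"
    using Cons.prems(6) by auto
  have "y \<in> R.saturate Q U" if y: "y \<in> carrier R" "a \<otimes> y \<in> R.saturate Q U" for y
  proof -
    have "h a \<otimes>\<^bsub>L\<^esub> h y \<in> J" using y a unfolding cJ[symmetric] by (auto simp: ctr_def)
    then have "h y \<in> J" using S.prime_mult[OF Jp] aJ a y by blast
    then show ?thesis using y unfolding cJ[symmetric] by (simp add: ctr_def)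
  qed
  moreover have "R.loc_regular Q (R.adjoin U a (carrier R)) (carrier R) as"
  proof (rule Cons.IH[OF as _ _ _ _ tow])
    let ?U = "R.adjoin U a (carrier R)" and ?J = "S.adjoin J (h a) (carrier L)"
    show U': "ideal ?U R" by (rule R.ideal_adjoin[OF U a R.oneideal])
    have ha: "h a \<in> carrier L" using a by simp
    show J': "ideal ?J L" by (rule S.ideal_adjoin[OF J ha S.oneideal])
    show "r \<in> ?U" if "r \<in> carrier R" "h r = \<zero>\<^bsub>L\<^esub>" for r
      using ker[OF that] R.adjoin_incl[OF U a R.oneideal] by auto
    show "ctr ?J = R.saturate Q ?U"
    proof
      show "ctr ?J \<subseteq> R.saturate Q ?U"
      proof
        fix r assume "r \<in> ctr ?J"
        then have r: "r \<in> carrier R" "h r \<in> ?J" by (auto simp: ctr_def)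
        then obtain j y where jy: "j \<in> J" "y \<in> carrier L" "h r = j \<oplus>\<^bsub>L\<^esub> h a \<otimes>\<^bsub>L\<^esub> y" by (auto elim!: S.adjoinE)
        have jc: "j \<in> carrier L" by (rule S.ideal_carr[OF J jy(1)])
        obtain j1 s1 where s1: "j1 \<in> carrier R" "s1 \<in> carrier R" "h s1 \<in> Units L" "j \<otimes>\<^bsub>L\<^esub> h s1 = h j1" using frac[OF jc] by blast
        obtain y2 s2 where s2: "y2 \<in> carrier R" "s2 \<in> carrier R" "h s2 \<in> Units L" "y \<otimes>\<^bsub>L\<^esub> h s2 = h y2" using frac[OF jy(2)] by blast
        have k: "h s1 \<in> carrier L" "h s2 \<in> carrier L" using s1 s2 by auto
        have "h j1 \<in> J" using S.ideal_mult'[OF J k(1) jy(1)] s1(4) by simp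
        then have "j1 \<in> R.saturate Q U" unfolding cJ[symmetric] using s1(1) by (simp add: ctr_def)
        then obtain t where t: "t \<in> carrier R" "t \<notin> Q" "t \<otimes> j1 \<in> U" by (auto elim!: R.saturateE)
        have "h ((s1 \<otimes> s2) \<otimes> r) = (h s1 \<otimes>\<^bsub>L\<^esub> h s2) \<otimes>\<^bsub>L\<^esub> (j \<oplus>\<^bsub>L\<^esub> h a \<otimes>\<^bsub>L\<^esub> y)" using r s1 s2 jy(3) by simp
        also have "\<dots> = h s2 \<otimes>\<^bsub>L\<^esub> (j \<otimes>\<^bsub>L\<^esub> h s1) \<oplus>\<^bsub>L\<^esub> h a \<otimes>\<^bsub>L\<^esub> (h s1 \<otimes>\<^bsub>L\<^esub> (y \<otimes>\<^bsub>L\<^esub> h s2))"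
          using k jc jy(2) ha by algebra
        also have "\<dots> = h (s2 \<otimes> j1 \<oplus> a \<otimes> (s1 \<otimes> y2))" unfolding s1(4) s2(4) using s1 s2 a by simp
        finally have e: "h ((s1 \<otimes> s2) \<otimes> r) = h (s2 \<otimes> j1 \<oplus> a \<otimes> (s1 \<otimes> y2))" .
        let ?d = "(s1 \<otimes> s2) \<otimes> r \<ominus> (s2 \<otimes> j1 \<oplus> a \<otimes> (s1 \<otimes> y2))"
        have d: "?d \<in> U" using ker hom_eq_imp_diff[OF _ _ e] s1 s2 r a by auto
        have "(t \<otimes> (s1 \<otimes> s2)) \<otimes> r = (t \<otimes> ?d \<oplus> s2 \<otimes> (t \<otimes> j1)) \<oplus> a \<otimes> (t \<otimes> (s1 \<otimes> y2))"
          using s1(1,2) s2(1,2) r(1) a t(1) by algebra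
        also have "\<dots> \<in> ?U"
          by (rule R.adjoinI) (use R.ideal_add[OF U] R.ideal_mult[OF U] d t s1 s2 in auto)
        finally have "(t \<otimes> (s1 \<otimes> s2)) \<otimes> r \<in> ?U" .
        moreover have "t \<otimes> (s1 \<otimes> s2) \<in> carrier R - Q"
          using R.prime_compl(2)[OF Q_prime] t s1 s2 unit_iff by auto
        ultimately show "r \<in> R.saturate Q ?U" using R.saturateI[of "t \<otimes> (s1 \<otimes> s2)" Q r ?U] r by auto
      qed
      show "R.saturate Q ?U \<subseteq> ctr ?J"
      proof
        fix r assume "r \<in> R.saturate Q ?U"
        then obtain s where s: "s \<in> carrier R" "s \<notin> Q" "r \<in> carrier R" "s \<otimes> r \<in> ?U" by (auto elim!: R.saturateE)
        then obtain u y where uy: "u \<in> U" "y \<in> carrier R" "s \<otimes> r = u \<oplus> a \<otimes> y" by (auto elim!: R.adjoinE)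
        have uc: "u \<in> carrier R" by (rule R.ideal_carr[OF U uy(1)])
        have "h u \<in> J" using R.saturate_incl[OF Q_prime U] uy(1) unfolding cJ[symmetric] by (auto simp: ctr_def)
        then have "h (u \<oplus> a \<otimes> y) \<in> ?J" using S.adjoinI uc a uy(2) by simp
        then have "h r \<otimes>\<^bsub>L\<^esub> h s \<in> ?J" unfolding uy(3)[symmetric] using s S.m_comm by simp
        then have "h r \<in> ?J" using unit_cancel_ideal[OF J', of "h r" "h s"] unit_iff[OF s(1)] s by simp
        then show "r \<in> ctr ?J" using s by (simp add: ctr_def)
      qed
    qed
  qed
  ultimately show ?case by simp
qed simp

lemma prime_chain_ext_between:
  assumes ker: "\<And>r. r \<in> carrier R \<Longrightarrow> h r = \<zero>\<^bsub>L\<^esub> \<Longrightarrow> r \<in> P"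
    and ch: "prime_chain R Ps" and hd: "P \<subseteq> hd Ps" and la: "last Ps \<subseteq> Q"
  shows "prime_chain L (map ext Ps)"
proof (rule prime_chain_ext[OF ch])
  fix p assume p: "p \<in> set Ps"
  then have "primeideal p R" "P \<subseteq> p" "p \<subseteq> Q" using ch prime_chain_between[OF ch p] hd la by (auto simp: prime_chain_def)
  then show "ctr (ext p) = p \<and> primeideal (ext p) L" using prime_ext[of p] ker unit_iff by blast
qed

end

lemma prime_chain_krull_dim:
  assumes "prime_chain R Ps" "krull_dim R \<le> enat d" shows "length Ps \<le> d + 1"
proof -
  have "enat (length Ps - 1) \<le> krull_dim R" unfolding krull_dim_def by (rule SUP_upper) (use assms in simp)
  then have "enat (length Ps - 1) \<le> enat d" using assms(2) by (rule order_trans)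
  then show ?thesis by simp
qed

lemma krull_dim_le:
  assumes "\<And>Ps. prime_chain R Ps \<Longrightarrow> length Ps \<le> d + 1" shows "krull_dim R \<le> enat d"
  unfolding krull_dim_def by (rule SUP_least) (use assms in fastforce)

lemma krull_dim_attained:
  assumes "krull_dim R = enat d" "primeideal P R"
  shows "\<exists>Ps. prime_chain R Ps \<and> length Ps = d + 1"
proof (rule ccontr)
  assume neg: "\<not> ?thesis"
  have len: "length Ps \<le> d" if "prime_chain R Ps" for Ps
    using prime_chain_krull_dim[OF that, of d] assms(1) neg that
    by (metis Suc_eq_plus1 le_Suc_eq order_refl)
  have "prime_chain R [P]" using assms(2) by (simp add: prime_chain_def)
  then have d: "d \<ge> 1" using len by force
  then have "krull_dim R \<le> enat (d - 1)" using len by (intro krull_dim_le) simp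
  then show False using assms(1) d by simp
qed

text \<open>A regular system of parameters of \<open>L = (R/P)\<^sub>Q\<close> can be taken from \<open>Q\<close>, by clearing denominators. It is a
  regular sequence whose length is the dimension, which bounds the chains of primes between \<open>P\<close> and \<open>Q\<close>.\<close>

theorem (in frac_local) regular_local_loc_regular:
  assumes ker: "\<And>r. r \<in> carrier R \<Longrightarrow> h r = \<zero>\<^bsub>L\<^esub> \<longleftrightarrow> r \<in> P" and Pc: "P \<subseteq> carrier R"
    and reg: "regular_local_ring L"
  shows "\<exists>as. set as \<subseteq> Q \<and> R.loc_regular Q P (carrier R) as \<and>
    (\<forall>Ps. prime_chain R Ps \<longrightarrow> P \<subseteq> hd Ps \<longrightarrow> last Ps \<subseteq> Q \<longrightarrow> length Ps \<le> length as + 1)"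
proof -
  obtain m T where nL: "noetherian_ring L" and m: "{M. maximalideal M L} = {m}" and T: "T \<subseteq> carrier L" "finite T"
      "Idl\<^bsub>L\<^esub> T = m" "enat (card T) = krull_dim L" using reg by (auto simp: regular_local_ring_def)
  have "m = ext Q" using m maximal_ext by blast
  note Tm = T(3)[unfolded this]
  note mp = max_prime(2) and mi = S.prime_ideal[OF max_prime(2)]
  interpret N: noetherian_ring L by (rule nL)
  interpret LN: local_noeth L "ext Q"
    by (intro local_noeth.intro local_noeth_axioms.intro noeth_cring.intro)
      (rule S.is_cring nL mp local_max_ideal | assumption)+
  have "\<exists>r. r \<in> carrier R \<and> (\<exists>s\<in>carrier R. h s \<in> Units L \<and> x \<otimes>\<^bsub>L\<^esub> h s = h r)" if "x \<in> T" for x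
    using frac[of x] that T(1) by blast
  then obtain a where a: "\<And>x. x \<in> T \<Longrightarrow> a x \<in> carrier R"
      "\<And>x. x \<in> T \<Longrightarrow> \<exists>s\<in>carrier R. h s \<in> Units L \<and> x \<otimes>\<^bsub>L\<^esub> h s = h (a x)" by metis
  obtain xs where xs: "set xs = T" "distinct xs" using finite_distinct_list[OF T(2)] by blast
  define as where "as = map a xs"
  define d where "d = card T"
  have len: "length as = d" using distinct_card[OF xs(2)] xs(1) by (simp add: as_def d_def)
  have asc: "set as \<subseteq> carrier R" using a xs by (auto simp: as_def)
  have ham: "h (a x) \<in> ext Q" if x: "x \<in> T" for x
  proof -
    obtain s where s: "s \<in> carrier R" "h s \<in> Units L" "x \<otimes>\<^bsub>L\<^esub> h s = h (a x)" using a(2)[OF x] by blast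
    have "x \<in> ext Q" using S.genideal_self[OF T(1)] Tm x by auto
    then show ?thesis using S.ideal_mult'[OF mi, of "h s" x] s by simp
  qed
  have asQ: "set as \<subseteq> Q"
  proof
    fix r assume "r \<in> set as"
    then obtain x where x: "x \<in> T" "r = a x" using xs by (auto simp: as_def)
    then have "r \<in> ctr (ext Q)" using ham[OF x(1)] a(1) by (simp add: ctr_def)
    then show "r \<in> Q" using max_prime(1) by simp
  qed
  have hasc: "set (map h as) \<subseteq> carrier L" using asc by auto
  let ?W = "S.adjoin_list {\<zero>\<^bsub>L\<^esub>} (carrier L) (map h as)"
  have W: "?W = ext Q"
  proof
    show "?W \<subseteq> ext Q"
    proof (rule S.adjoin_list_subset[OF mi])
      show "{\<zero>\<^bsub>L\<^esub>} \<subseteq> ext Q" using S.ideal_zero[OF mi] by simp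
      show "y \<otimes>\<^bsub>L\<^esub> u \<in> ext Q" if "y \<in> set (map h as)" "u \<in> carrier L" for y u
        using S.ideal_mult'[OF mi that(2)] ham that(1) xs by (auto simp: as_def)
    qed
    have Wi: "ideal ?W L" by (rule S.ideal_adjoin_list[OF S.zeroideal S.oneideal hasc])
    have "T \<subseteq> ?W"
    proof
      fix x assume x: "x \<in> T"
      obtain s where s: "s \<in> carrier R" "h s \<in> Units L" "x \<otimes>\<^bsub>L\<^esub> h s = h (a x)" using a(2)[OF x] by blast
      have "h (a x) \<otimes>\<^bsub>L\<^esub> \<one>\<^bsub>L\<^esub> \<in> ?W"
        by (rule S.adjoin_list_mem[OF S.zeroideal S.oneideal hasc]) (use x xs in \<open>auto simp: as_def\<close>)
      then have "x \<otimes>\<^bsub>L\<^esub> h s \<in> ?W" using s(3) a(1)[OF x] by simp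
      then show "x \<in> ?W" using unit_cancel_ideal[OF Wi _ s(2)] T(1) x by blast
    qed
    then show "ext Q \<subseteq> ?W" unfolding Tm[symmetric] by (rule S.genideal_minimal[OF Wi])
  qed
  have kd: "krull_dim L = enat d" using T(4) by (simp add: d_def)
  obtain Ps where Ps: "prime_chain L Ps" "length Ps = d + 1" using krull_dim_attained[OF kd mp] by blast
  define Qs where "Qs = butlast Ps @ [ext Q]"
  have ne: "Ps \<noteq> []" using Ps by auto
  have sp: "sorted_wrt (\<subset>) (butlast Ps @ [last Ps])" "\<And>p. p \<in> set Ps \<Longrightarrow> primeideal p L"
    using Ps(1) ne by (auto simp: prime_chain_def)
  have lp: "primeideal (last Ps) L" by (rule sp(2)[OF last_in_set[OF ne]])
  have lQ: "last Ps \<subseteq> ext Q" by (rule local_max_ideal[OF S.prime_ideal[OF lp] S.prime_notone[OF lp]])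
  have "prime_chain L Qs"
    unfolding prime_chain_def
  proof (intro conjI ballI)
    show "Qs \<noteq> []" by (simp add: Qs_def)
    show "primeideal p L" if "p \<in> set Qs" for p
      using that mp sp(2) in_set_butlastD[of p Ps] by (auto simp: Qs_def)
    show "sorted_wrt (\<subset>) Qs" using sp(1) lQ by (auto simp: Qs_def sorted_wrt_append)
  qed
  moreover have "length Qs = d + 1" "last Qs = ext Q" using Ps(2) by (auto simp: Qs_def)
  moreover have "{\<zero>\<^bsub>L\<^esub>} \<subseteq> hd Qs"
  proof -
    have "Qs \<noteq> []" by (simp add: Qs_def)
    then have "primeideal (hd Qs) L" using \<open>prime_chain L Qs\<close> by (simp add: prime_chain_def)
    then show ?thesis using S.ideal_zero[OF S.prime_ideal] by simp
  qed
  ultimately have tow: "S.prime_tower {\<zero>\<^bsub>L\<^esub>} (map h as)"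
    using LN.regular_prime_tower[OF S.zeroideal hasc W, of Qs] len by simp
  have cz: "ctr {\<zero>\<^bsub>L\<^esub>} = P" using ker Pc by (auto simp: ctr_def)
  have Pi: "ideal P R" using ideal_ctr[OF S.zeroideal] cz by simp
  have "R.saturate Q P = P"
  proof
    show "R.saturate Q P \<subseteq> P"
    proof
      fix r assume "r \<in> R.saturate Q P"
      then obtain s where s: "s \<in> carrier R" "s \<notin> Q" "r \<in> carrier R" "s \<otimes> r \<in> P" by (auto elim!: R.saturateE)
      have "h r \<otimes>\<^bsub>L\<^esub> h s = h (s \<otimes> r)" using s S.m_comm[of "h r" "h s"] by simp
      also have "\<dots> = \<zero>\<^bsub>L\<^esub>" using ker[of "s \<otimes> r"] s by blast
      finally have "h r \<otimes>\<^bsub>L\<^esub> h s \<in> {\<zero>\<^bsub>L\<^esub>}" by simp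
      then have "h r = \<zero>\<^bsub>L\<^esub>" using unit_cancel_ideal[OF S.zeroideal, of "h r" "h s"] unit_iff s by auto
      then show "r \<in> P" using ker s by simp
    qed
  qed (rule R.saturate_incl[OF Q_prime Pi])
  then have "R.loc_regular Q P (carrier R) as"
    using tower_loc_regular[OF asc Pi _ S.zeroideal _ tow] ker cz by simp
  moreover have "length Ps \<le> length as + 1" if "prime_chain R Ps" "P \<subseteq> hd Ps" "last Ps \<subseteq> Q" for Ps
    using prime_chain_krull_dim[OF prime_chain_ext_between[OF _ that], of d] ker kd len by simp
  ultimately show ?thesis using asQ by blast
qed

section \<open>Generic regularity\<close>

lemma (in cring) mult_set_prime_compl:
  assumes "primeideal Q R" shows "mult_set R (carrier R - Q)"
  by unfold_locales (use prime_compl[OF assms] in auto)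

lemma (in cring) frac_local_local_at:
  assumes Q: "primeideal Q R"
  shows "frac_local R (local_at R Q) (loc_map R (carrier R - Q)) Q"
proof -
  interpret M: mult_set R "carrier R - Q" by (rule mult_set_prime_compl[OF Q])
  interpret F: frac_hom R "local_at R Q" "loc_map R (carrier R - Q)" by (rule M.frac_hom_loc_map)
  have "s \<notin> Q" if s: "s \<in> carrier R" "M.lm s \<in> Units M.L" for s
  proof
    assume sQ: "s \<in> Q"
    obtain y where y: "y \<in> carrier M.L" "M.lm s \<otimes>\<^bsub>M.L\<^esub> y = \<one>\<^bsub>M.L\<^esub>" using s(2) unfolding Units_def by auto
    obtain a t where at: "a \<in> carrier R" "t \<in> carrier R - Q" "y = M.fr a t" using M.frac_cases[OF y(1)] by blast
    have "M.fr (s \<otimes> a) t = M.fr \<one> \<one>"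
      using y(2) at s(1) M.S_one M.frac_mult[of s a \<one> t] by (simp add: loc_map_def M.frac_one)
    then obtain u where u: "u \<in> carrier R - Q" "u \<otimes> \<one> \<otimes> (s \<otimes> a) = u \<otimes> t \<otimes> \<one>"
      using M.frac_eq_iff[of "s \<otimes> a" \<one> t \<one>] at s(1) M.S_one by auto
    have "s \<otimes> a \<in> Q" by (rule ideal_mult'[OF prime_ideal[OF Q] at(1) sQ])
    then have "u \<otimes> \<one> \<otimes> (s \<otimes> a) \<in> Q" using ideal_mult[OF prime_ideal[OF Q], of "u \<otimes> \<one>"] u(1) by simp
    then have "u \<otimes> t \<otimes> \<one> \<in> Q" unfolding u(2) .
    then show False using M.S_mult[OF u(1) at(2)] by simp
  qed
  then show ?thesis
    by (intro frac_local.intro frac_local_axioms.intro F.frac_hom_axioms Q) (use M.loc_map_unit in blast)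
qed

lemma frac_local_comp:
  assumes "frac_hom R A g" "frac_local A L h p"
  shows "frac_local R L (\<lambda>x. h (g x)) {r \<in> carrier R. g r \<in> p}"
proof -
  interpret g: frac_hom R A g by fact
  interpret h: frac_local A L h p by fact
  interpret c: frac_hom R L "\<lambda>x. h (g x)" by (rule frac_hom_comp[OF assms(1) h.frac_hom_axioms])
  have "primeideal {r \<in> carrier R. g r \<in> p} R" using g.prime_ctr[OF h.Q_prime] by (simp add: g.ctr_def)
  then show ?thesis
    by (intro frac_local.intro frac_local_axioms.intro c.frac_hom_axioms) (simp_all add: h.unit_iff)
qed

lemma surj_frac_hom:
  fixes R (structure)
  assumes "cring R" "cring A" "g \<in> ring_hom R A" "g ` carrier R = carrier A"
  shows "frac_hom R A g"
proof -
  interpret R: cring R by fact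
  interpret A: cring A by fact
  interpret ring_hom_cring R A g by unfold_locales (rule assms(3))
  show ?thesis
  proof
    fix y assume "y \<in> carrier A"
    then obtain r where "r \<in> carrier R" "y = g r" using assms(4) by auto
    then show "\<exists>r\<in>carrier R. \<exists>s\<in>carrier R. g s \<in> Units A \<and> y \<otimes>\<^bsub>A\<^esub> g s = g r"
      by (intro bexI[of _ r] bexI[of _ \<one>]) auto
  qed
qed

text \<open>Representing cosets by lists makes \<open>R/P\<close> a ring whose elements are lists over \<open>R\<close>, the form in which the
  J-2 property speaks about finitely generated \<open>R\<close>-algebras.\<close>

definition coset_code :: "('a, 'm) ring_scheme \<Rightarrow> 'a set \<Rightarrow> 'a \<Rightarrow> 'a list" where
  "coset_code R P r = [SOME x. x \<in> P +>\<^bsub>R\<^esub> r]"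

lemma (in cring) coset_code_eq_iff:
  assumes P: "ideal P R" and ab: "a \<in> carrier R" "b \<in> carrier R"
  shows "coset_code R P a = coset_code R P b \<longleftrightarrow> a \<ominus> b \<in> P"
proof -
  interpret P: ideal P R by (rule P)
  have rep: "P +> (SOME x. x \<in> P +> r) = P +> r" if r: "r \<in> carrier R" for r
  proof -
    have "r \<in> P +> r" by (rule P.a_rcos_self[OF r])
    then have "(SOME x. x \<in> P +> r) \<in> P +> r" by (rule someI)
    then obtain p where p: "p \<in> P" "(SOME x. x \<in> P +> r) = p \<oplus> r" by (auto simp: a_r_coset_def')
    have pc: "p \<in> carrier R" using p(1) by simp
    have "(p \<oplus> r) \<ominus> r = p" using pc r by algebra
    then show ?thesis unfolding p(2) using quotient_eq_iff_same_a_r_cos[OF P, of "p \<oplus> r" r] p(1) pc r by simp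
  qed
  show ?thesis
  proof
    assume "coset_code R P a = coset_code R P b"
    then have e: "(SOME x. x \<in> P +> a) = (SOME x. x \<in> P +> b)" by (simp add: coset_code_def)
    have "P +> a = P +> b" using rep[OF ab(1)] unfolding e rep[OF ab(2)] by (rule sym)
    then show "a \<ominus> b \<in> P" using quotient_eq_iff_same_a_r_cos[OF P ab] by blast
  next
    assume "a \<ominus> b \<in> P"
    then have "P +> a = P +> b" using quotient_eq_iff_same_a_r_cos[OF P ab] by blast
    then show "coset_code R P a = coset_code R P b" by (simp add: coset_code_def)
  qed
qed

lemma regular_local_ring_field:
  assumes "cring L" "noetherian_ring L" and max: "\<And>M. maximalideal M L \<longleftrightarrow> M = {\<zero>\<^bsub>L\<^esub>}"
    and ids: "\<And>P. primeideal P L \<Longrightarrow> P = {\<zero>\<^bsub>L\<^esub>}"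
  shows "regular_local_ring L"
proof -
  interpret L: cring L by fact
  have "krull_dim L \<le> enat 0"
  proof (rule krull_dim_le)
    fix Ps assume Ps: "prime_chain L Ps"
    show "length Ps \<le> 0 + 1"
    proof (rule ccontr)
      assume "\<not> ?thesis"
      then obtain p q Qs where "Ps = p # q # Qs" by (cases Ps; cases "tl Ps") auto
      then show False using Ps ids[of p] ids[of q] by (auto simp: prime_chain_def)
    qed
  qed
  then have kd: "krull_dim L = 0" by (simp add: zero_enat_def[symmetric])
  have "Idl\<^bsub>L\<^esub> {} = {\<zero>\<^bsub>L\<^esub>}"
  proof
    show "Idl\<^bsub>L\<^esub> {} \<subseteq> {\<zero>\<^bsub>L\<^esub>}" by (rule L.genideal_minimal[OF L.zeroideal]) simp
    show "{\<zero>\<^bsub>L\<^esub>} \<subseteq> Idl\<^bsub>L\<^esub> {}" using L.ideal_zero[OF L.genideal_ideal[of "{}"]] by simp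
  qed
  then show ?thesis unfolding regular_local_ring_def using assms(1,2) max kd
    by (intro conjI exI[of _ "{\<zero>\<^bsub>L\<^esub>}"] exI[of _ "{}"]) (auto simp: zero_enat_def)
qed

text \<open>The regular locus of \<open>R/P\<close> is open by the J-2 property. It contains the generic point, where the local
  ring is a field, so it contains a basic open set.\<close>

theorem (in noeth_cring) generic_regular:
  assumes J2: "J2_ring R" and P: "primeideal P R"
  shows "\<exists>f\<in>carrier R. f \<notin> P \<and> (\<forall>Q. primeideal Q R \<longrightarrow> P \<subseteq> Q \<longrightarrow> f \<notin> Q \<longrightarrow>
    (\<exists>as. set as \<subseteq> Q \<and> loc_regular Q P (carrier R) as \<and>
      (\<forall>Ps. prime_chain R Ps \<longrightarrow> P \<subseteq> hd Ps \<longrightarrow> last Ps \<subseteq> Q \<longrightarrow> length Ps \<le> length as + 1)))"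
proof -
  note Pi = prime_ideal[OF P]
  define u where "u = coset_code R P"
  define A where "A = image_ring u R"
  have wk: "weak_ring_morphism u P R"
    by (rule weak_ring_morphismI[OF Pi]) (simp add: u_def coset_code_eq_iff[OF Pi])
  have uh: "u \<in> ring_hom R A" unfolding A_def by (rule weak_ring_morphism_is_hom[OF wk])
  have Ac: "carrier A = u ` carrier R" unfolding A_def by (rule image_ring_carrier)
  have rA: "ring A" unfolding A_def by (rule image_ring_is_ring[OF wk])
  have "cring A"
  proof (rule cring.intro[OF rA], rule comm_monoid.intro[OF ring.axioms(2)[OF rA]], rule comm_monoid_axioms.intro)
    fix x y assume "x \<in> carrier A" "y \<in> carrier A"
    then obtain r s where "r \<in> carrier R" "s \<in> carrier R" "x = u r" "y = u s" using Ac by auto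
    then show "x \<otimes>\<^bsub>A\<^esub> y = y \<otimes>\<^bsub>A\<^esub> x" using ring_hom_mult[OF uh, symmetric] m_comm[of r s] by simp
  qed
  then interpret A: cring A .
  interpret F: frac_hom R A u by (rule surj_frac_hom[OF is_cring A.is_cring uh Ac[symmetric]])
  have uz: "u r = \<zero>\<^bsub>A\<^esub> \<longleftrightarrow> r \<in> P" if r: "r \<in> carrier R" for r
  proof -
    have "u r = \<zero>\<^bsub>A\<^esub> \<longleftrightarrow> u r = u \<zero>" using F.hom_zero by simp
    also have "\<dots> \<longleftrightarrow> r \<ominus> \<zero> \<in> P" unfolding u_def by (rule coset_code_eq_iff[OF Pi r zero_closed])
    finally show ?thesis using r by (simp add: minus_eq)
  qed
  have "generate_ring A (u ` carrier R \<union> {}) = carrier A"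
  proof
    show "generate_ring A (u ` carrier R \<union> {}) \<subseteq> carrier A" by (rule A.generate_ring_incl) (simp add: Ac)
    show "carrier A \<subseteq> generate_ring A (u ` carrier R \<union> {})" unfolding Ac by (auto intro: generate_ring.incl)
  qed
  then have "fg_algebra R A u" unfolding fg_algebra_def using A.is_cring uh by blast
  then have "open_regular_locus A" using J2 unfolding J2_ring_def by blast
  then obtain J where J: "ideal J A" "\<And>p. primeideal p A \<Longrightarrow> regular_local_ring (local_at A p) \<longleftrightarrow> \<not> J \<subseteq> p"
    unfolding open_regular_locus_def by blast
  have nA: "noetherian_ring A" using F.noetherian_target[OF noetherian_ring_axioms] by (simp add: noeth_cring_def)
  have exP: "F.ctr (F.ext p) = p" "primeideal (F.ext p) A" if p: "primeideal p R" "P \<subseteq> p" for p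
    using F.prime_ext_surj[OF Ac[symmetric] p(1)] uz p(2) by blast+
  have zP: "F.ext P = {\<zero>\<^bsub>A\<^esub>}"
  proof -
    have "F.ctr {\<zero>\<^bsub>A\<^esub>} = P" using uz ideal_carr[OF Pi] by (auto simp: F.ctr_def)
    then show ?thesis using F.ext_ctr[OF A.zeroideal] by simp
  qed
  \<comment> \<open>The generic point of \<open>A = R/P\<close>.\<close>
  have zp: "primeideal {\<zero>\<^bsub>A\<^esub>} A" using exP(2)[OF P subset_refl] zP by simp
  interpret Z: frac_local A "local_at A {\<zero>\<^bsub>A\<^esub>}" "loc_map A (carrier A - {\<zero>\<^bsub>A\<^esub>})" "{\<zero>\<^bsub>A\<^esub>}"
    by (rule A.frac_local_local_at[OF zp])
  have extz: "Z.ext {\<zero>\<^bsub>A\<^esub>} = {\<zero>\<^bsub>local_at A {\<zero>\<^bsub>A\<^esub>}\<^esub>}"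
  proof
    show "Z.ext {\<zero>\<^bsub>A\<^esub>} \<subseteq> {\<zero>\<^bsub>local_at A {\<zero>\<^bsub>A\<^esub>}\<^esub>}" by (rule Z.ext_minimal[OF Z.S.zeroideal]) auto
    show "{\<zero>\<^bsub>local_at A {\<zero>\<^bsub>A\<^esub>}\<^esub>} \<subseteq> Z.ext {\<zero>\<^bsub>A\<^esub>}" using Z.S.ideal_zero[OF Z.ideal_ext[OF A.zeroideal]] by simp
  qed
  have "regular_local_ring (local_at A {\<zero>\<^bsub>A\<^esub>})"
  proof (rule regular_local_ring_field)
    show "cring (local_at A {\<zero>\<^bsub>A\<^esub>})" by (rule Z.S.is_cring)
    show "noetherian_ring (local_at A {\<zero>\<^bsub>A\<^esub>})" using Z.noetherian_target[OF nA] by (simp add: noeth_cring_def)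
    show "maximalideal M (local_at A {\<zero>\<^bsub>A\<^esub>}) \<longleftrightarrow> M = {\<zero>\<^bsub>local_at A {\<zero>\<^bsub>A\<^esub>}\<^esub>}" for M
      using Z.maximal_ext[of M] extz by simp
    fix p assume p: "primeideal p (local_at A {\<zero>\<^bsub>A\<^esub>})"
    have "p \<subseteq> Z.ext {\<zero>\<^bsub>A\<^esub>}" by (rule Z.local_max_ideal[OF Z.S.prime_ideal[OF p] Z.S.prime_notone[OF p]])
    then show "p = {\<zero>\<^bsub>local_at A {\<zero>\<^bsub>A\<^esub>}\<^esub>}" using extz Z.S.ideal_zero[OF Z.S.prime_ideal[OF p]] by auto
  qed
  then have "\<not> J \<subseteq> {\<zero>\<^bsub>A\<^esub>}" using J(2)[OF zp] by simp
  then obtain j where j: "j \<in> J" "j \<noteq> \<zero>\<^bsub>A\<^esub>" by blast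
  have "j \<in> carrier A" by (rule A.ideal_carr[OF J(1) j(1)])
  then obtain f where f: "f \<in> carrier R" "j = u f" using Ac by auto
  have fP: "f \<notin> P" using uz[OF f(1)] j f by simp
  have "\<exists>as. set as \<subseteq> Q \<and> loc_regular Q P (carrier R) as \<and>
      (\<forall>Ps. prime_chain R Ps \<longrightarrow> P \<subseteq> hd Ps \<longrightarrow> last Ps \<subseteq> Q \<longrightarrow> length Ps \<le> length as + 1)"
    if Q: "primeideal Q R" "P \<subseteq> Q" "f \<notin> Q" for Q
  proof -
    let ?q = "F.ext Q"
    have q: "F.ctr ?q = Q" "primeideal ?q A" using exP[OF Q(1,2)] by auto
    have "j \<notin> ?q" using q(1) f Q(3) by (auto simp: F.ctr_def)
    then have reg: "regular_local_ring (local_at A ?q)" using J(2)[OF q(2)] j by blast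
    let ?l = "loc_map A (carrier A - ?q)"
    have "{r \<in> carrier R. u r \<in> ?q} = Q" using q(1) by (simp add: F.ctr_def)
    then interpret G: frac_local R "local_at A ?q" "\<lambda>x. ?l (u x)" Q
      using frac_local_comp[OF F.frac_hom_axioms A.frac_local_local_at[OF q(2)]] by simp
    interpret M: mult_set A "carrier A - ?q" by (rule A.mult_set_prime_compl[OF q(2)])
    have ker: "?l (u r) = \<zero>\<^bsub>local_at A ?q\<^esub> \<longleftrightarrow> r \<in> P" if r: "r \<in> carrier R" for r
    proof
      assume "r \<in> P"
      then have "u r = \<zero>\<^bsub>A\<^esub>" using uz r by simp
      then show "?l (u r) = \<zero>\<^bsub>local_at A ?q\<^esub>" using G.hom_zero F.hom_zero by simp
    next
      assume "?l (u r) = \<zero>\<^bsub>local_at A ?q\<^esub>"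
      then obtain v where v: "v \<in> carrier A - ?q" "v \<otimes>\<^bsub>A\<^esub> u r = \<zero>\<^bsub>A\<^esub>" using M.loc_map_zero_iff[of "u r"] r by auto
      then obtain w where w: "w \<in> carrier R" "v = u w" using Ac by auto
      have "w \<otimes> r \<in> P" using v(2) w r uz[of "w \<otimes> r"] by simp
      moreover have "w \<notin> P"
      proof
        assume "w \<in> P"
        then have "v = \<zero>\<^bsub>A\<^esub>" using uz w by simp
        then show False using v(1) A.ideal_zero[OF A.prime_ideal[OF q(2)]] by simp
      qed
      ultimately show "r \<in> P" using prime_mult[OF P w(1) r] by blast
    qed
    show ?thesis by (rule G.regular_local_loc_regular[OF ker _ reg]) (use ideal_carr[OF Pi] in auto)
  qed
  then show ?thesis using f(1) fP by blast
qed

section \<open>Gluing along the minimal primes\<close>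

lemma (in cring) common_element_avoiding_prime:
  assumes P: "primeideal P R"
  shows "finite N \<Longrightarrow> (\<And>K. K \<in> N \<Longrightarrow> ideal K R \<and> \<not> K \<subseteq> P) \<Longrightarrow> \<exists>e\<in>carrier R. e \<notin> P \<and> (\<forall>K\<in>N. e \<in> K)"
proof (induction N rule: finite_induct)
  case empty
  then show ?case using prime_notone[OF P] by auto
next
  case (insert K N)
  obtain e where e: "e \<in> carrier R" "e \<notin> P" "\<forall>K\<in>N. e \<in> K" using insert by blast
  obtain x where x: "x \<in> K" "x \<notin> P" using insert.prems[of K] by auto
  have Ki: "ideal K R" using insert.prems by auto
  have xc: "x \<in> carrier R" by (rule ideal_carr[OF Ki x(1)])
  have "e \<otimes> x \<notin> P" using prime_mult[OF P e(1) xc] e(2) x(2) by blast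
  moreover have "e \<otimes> x \<in> K" by (rule ideal_mult[OF Ki e(1) x(1)])
  moreover have "\<forall>K'\<in>N. e \<otimes> x \<in> K'" using ideal_mult'[OF _ xc] e(3) insert.prems by blast
  ultimately show ?case using e(1) xc by (intro bexI[of _ "e \<otimes> x"]) auto
qed

text \<open>The sum of the \<open>g\<^sub>P\<close>, \<open>P \<in> N\<close>: modulo \<open>P\<close> only the summand \<open>g\<^sub>P\<close> survives, and a prime that omits the sum omits
  one of the summands.\<close>

lemma (in cring) glue_at_primes:
  assumes pr: "\<And>P. P \<in> M \<Longrightarrow> primeideal P R"
    and g: "\<And>P. P \<in> M \<Longrightarrow> g P \<in> carrier R \<and> g P \<notin> P"
    and g0: "\<And>P P'. P \<in> M \<Longrightarrow> P' \<in> M \<Longrightarrow> P' \<noteq> P \<Longrightarrow> g P \<in> P'"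
    and "finite N"
  shows "N \<subseteq> M \<Longrightarrow> \<exists>f\<in>carrier R. (\<forall>P\<in>N. f \<notin> P) \<and> (\<forall>P\<in>M - N. f \<in> P) \<and>
    (\<forall>Q. primeideal Q R \<longrightarrow> f \<notin> Q \<longrightarrow> (\<exists>P\<in>N. g P \<notin> Q))"
  using \<open>finite N\<close>
proof (induction N rule: finite_induct)
  case empty
  have "\<zero> \<in> P" if "primeideal P R" for P by (rule ideal_zero[OF prime_ideal[OF that]])
  then show ?case using pr by (intro bexI[of _ \<zero>]) auto
next
  case (insert P N)
  obtain f where f: "f \<in> carrier R" "\<forall>P\<in>N. f \<notin> P" "\<forall>P\<in>M - N. f \<in> P"
    "\<forall>Q. primeideal Q R \<longrightarrow> f \<notin> Q \<longrightarrow> (\<exists>P\<in>N. g P \<notin> Q)" using insert by auto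
  have P: "P \<in> M" using insert by auto
  note gP = g[OF P]
  show ?case
  proof (rule bexI[of _ "f \<oplus> g P"], intro conjI ballI allI impI)
    fix P' assume P': "P' \<in> insert P N"
    then have P'M: "P' \<in> M" using insert.prems by auto
    note i = prime_ideal[OF pr[OF P'M]]
    show "f \<oplus> g P \<notin> P'"
    proof (cases "P' = P")
      case True
      then have "f \<in> P'" using f(3) P insert.hyps by auto
      then show ?thesis using ideal_add_cancel[OF i, of f "g P"] gP True by auto
    next
      case False
      then have "f \<notin> P'" using f(2) P' by auto
      moreover have "g P \<in> P'" by (rule g0[OF P P'M False])
      moreover have "f \<oplus> g P = g P \<oplus> f" using f(1) gP by (simp add: a_comm)
      ultimately show ?thesis using ideal_add_cancel[OF i, of "g P" f] f(1) by auto
    qed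
  next
    fix P' assume P': "P' \<in> M - insert P N"
    then show "f \<oplus> g P \<in> P'"
      using f(3) g0[OF P, of P'] ideal_add[OF prime_ideal[OF pr[of P']], of f "g P"] by auto
  next
    fix Q assume Q: "primeideal Q R" "f \<oplus> g P \<notin> Q"
    then have "f \<notin> Q \<or> g P \<notin> Q" using ideal_add[OF prime_ideal[OF Q(1)]] by blast
    then show "\<exists>P\<in>insert P N. g P \<notin> Q" using f(4) Q(1) by auto
  qed (use f gP in auto)
qed

text \<open>For each minimal prime \<open>P\<close> of \<open>I\<close> take \<open>g\<^sub>P = e\<^sub>P f\<^sub>P\<close>, where \<open>f\<^sub>P \<notin> P\<close> defines a neighbourhood of \<open>P\<close> as provided by
  the two genericity theorems, and \<open>e\<^sub>P \<notin> P\<close> lies in all other minimal primes. If \<open>e\<^sub>P \<notin> Q\<close>, then \<open>P\<close> is the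
  only minimal prime of \<open>I\<close> inside \<open>Q\<close>, so chains of primes over \<open>I\<close> below \<open>Q\<close> are chains over \<open>P\<close>.\<close>

theorem (in noeth_cring) generic_gr_loc_regular:
  assumes J2: "J2_ring R" and I: "ideal I R"
  shows "\<exists>f\<in>carrier R. (\<forall>P\<in>minimal_primes R I. f \<notin> P) \<and>
    (\<forall>Q. primeideal Q R \<longrightarrow> I \<subseteq> Q \<longrightarrow> f \<notin> Q \<longrightarrow>
      (\<exists>as. set as \<subseteq> Q \<and> (\<forall>n. loc_regular Q (ideal_pow R I (Suc n)) (ideal_pow R I n) as) \<and>
        (\<forall>Ps. prime_chain R Ps \<longrightarrow> I \<subseteq> hd Ps \<longrightarrow> last Ps \<subseteq> Q \<longrightarrow> length Ps \<le> length as + 1)))"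
proof -
  let ?M = "minimal_primes R I"
  let ?good = "\<lambda>P Q. \<exists>as. set as \<subseteq> Q \<and> (\<forall>n. loc_regular Q (ideal_pow R I (Suc n)) (ideal_pow R I n) as) \<and>
        (\<forall>Ps. prime_chain R Ps \<longrightarrow> P \<subseteq> hd Ps \<longrightarrow> last Ps \<subseteq> Q \<longrightarrow> length Ps \<le> length as + 1)"
  have fin: "finite ?M" by (rule minimal_primes_finite(1)[OF I])
  have pr: "primeideal P R" if "P \<in> ?M" for P using that by (simp add: minimal_primes_def)
  have ex: "\<exists>g. g \<in> carrier R \<and> g \<notin> P \<and> (\<forall>P'\<in>?M. P' \<noteq> P \<longrightarrow> g \<in> P') \<and>
      (\<forall>Q. primeideal Q R \<longrightarrow> P \<subseteq> Q \<longrightarrow> g \<notin> Q \<longrightarrow> ?good P Q)" if P: "P \<in> ?M" for P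
  proof -
    note Pp = pr[OF P]
    have "\<exists>e\<in>carrier R. e \<notin> P \<and> (\<forall>K\<in>?M - {P}. e \<in> K)"
    proof (rule common_element_avoiding_prime[OF Pp])
      show "finite (?M - {P})" using fin by simp
      fix K assume K: "K \<in> ?M - {P}"
      then have "ideal K R" using pr prime_ideal by blast
      moreover have "\<not> K \<subseteq> P" using K P unfolding minimal_primes_def by auto
      ultimately show "ideal K R \<and> \<not> K \<subseteq> P" by blast
    qed
    then obtain e where e: "e \<in> carrier R" "e \<notin> P" "\<forall>K\<in>?M - {P}. e \<in> K" by blast
    obtain f1 where f1: "f1 \<in> carrier R" "f1 \<notin> P" and f1r: "\<forall>Q. primeideal Q R \<longrightarrow> P \<subseteq> Q \<longrightarrow> f1 \<notin> Q \<longrightarrow>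
      (\<exists>as. set as \<subseteq> Q \<and> loc_regular Q P (carrier R) as \<and>
      (\<forall>Ps. prime_chain R Ps \<longrightarrow> P \<subseteq> hd Ps \<longrightarrow> last Ps \<subseteq> Q \<longrightarrow> length Ps \<le> length as + 1))"
      using generic_regular[OF J2 Pp] by blast
    obtain f2 where f2: "f2 \<in> carrier R" "f2 \<notin> P" and f2w: "\<forall>Q as. primeideal Q R \<longrightarrow> f2 \<notin> Q \<longrightarrow> set as \<subseteq> carrier R \<longrightarrow>
      loc_regular Q P (carrier R) as \<longrightarrow> (\<forall>n. loc_regular Q (ideal_pow R I (Suc n)) (ideal_pow R I n) as)"
      using generic_loc_regular_pow[OF P I] by blast
    let ?g = "e \<otimes> (f1 \<otimes> f2)"
    have "?g \<in> carrier R" using e f1 f2 by simp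
    moreover have "?g \<notin> P" using prime_mult[OF Pp] e f1 f2 by blast
    moreover have "?g \<in> P'" if "P' \<in> ?M" "P' \<noteq> P" for P'
      using ideal_mult'[OF prime_ideal[OF pr[OF that(1)]], of "f1 \<otimes> f2" e] e(3) that f1 f2 by auto
    moreover have "?good P Q" if Q: "primeideal Q R" "P \<subseteq> Q" "?g \<notin> Q" for Q
    proof -
      note Qi = prime_ideal[OF Q(1)]
      have "f1 \<otimes> f2 \<notin> Q" using ideal_mult[OF Qi e(1)] Q(3) by blast
      then have "f1 \<notin> Q" "f2 \<notin> Q" using ideal_mult[OF Qi f1(1)] ideal_mult'[OF Qi f2(1)] by blast+
      then obtain as where as: "set as \<subseteq> Q" "loc_regular Q P (carrier R) as"
        "\<forall>Ps. prime_chain R Ps \<longrightarrow> P \<subseteq> hd Ps \<longrightarrow> last Ps \<subseteq> Q \<longrightarrow> length Ps \<le> length as + 1"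
        using f1r Q(1,2) by blast
      have "set as \<subseteq> carrier R" using as(1) ideal_carr[OF Qi] by blast
      then have "\<forall>n. loc_regular Q (ideal_pow R I (Suc n)) (ideal_pow R I n) as" using f2w Q(1) \<open>f2 \<notin> Q\<close> as(2) by blast
      then show ?thesis using as by blast
    qed
    ultimately show ?thesis by blast
  qed
  let ?X = "\<lambda>P g. g \<in> carrier R \<and> g \<notin> P \<and> (\<forall>P'\<in>?M. P' \<noteq> P \<longrightarrow> g \<in> P') \<and>
      (\<forall>Q. primeideal Q R \<longrightarrow> P \<subseteq> Q \<longrightarrow> g \<notin> Q \<longrightarrow> ?good P Q)"
  have "\<forall>P\<in>?M. \<exists>g. ?X P g" using ex by blast
  from bchoice[OF this] obtain g where X: "\<forall>P\<in>?M. ?X P (g P)" ..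
  have g: "\<And>P. P \<in> ?M \<Longrightarrow> g P \<in> carrier R \<and> g P \<notin> P"
    and g0: "\<And>P P'. P \<in> ?M \<Longrightarrow> P' \<in> ?M \<Longrightarrow> P' \<noteq> P \<Longrightarrow> g P \<in> P'" using X by blast+
  have gg: "?good P Q" if "P \<in> ?M" "primeideal Q R" "P \<subseteq> Q" "g P \<notin> Q" for P Q
    using X[rule_format, OF that(1)] that(2-4) by blast
  obtain f where f: "f \<in> carrier R" "\<forall>P\<in>?M. f \<notin> P"
    "\<forall>Q. primeideal Q R \<longrightarrow> f \<notin> Q \<longrightarrow> (\<exists>P\<in>?M. g P \<notin> Q)"
    using glue_at_primes[of ?M g ?M, OF pr g g0 fin subset_refl] by blast
  have "?good I Q" if Q: "primeideal Q R" "I \<subseteq> Q" "f \<notin> Q" for Q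
  proof -
    obtain P where P: "P \<in> ?M" "g P \<notin> Q" using f(3) Q by blast
    \<comment> \<open>\<open>g P\<close> lies in every minimal prime of \<open>I\<close> other than \<open>P\<close>, but not in \<open>Q\<close>.\<close>
    have below: "P \<subseteq> p" if p: "primeideal p R" "I \<subseteq> p" "p \<subseteq> Q" for p
    proof -
      obtain P' where P': "P' \<in> ?M" "P' \<subseteq> p" using minimal_primes_finite(2)[OF I p(1,2)] by blast
      then have "P' = P" using g0[OF P(1) P'(1)] P(2) p(3) by blast
      then show ?thesis using P' by simp
    qed
    obtain as where as: "set as \<subseteq> Q" "\<forall>n. loc_regular Q (ideal_pow R I (Suc n)) (ideal_pow R I n) as"
        "\<And>Ps. prime_chain R Ps \<Longrightarrow> P \<subseteq> hd Ps \<Longrightarrow> last Ps \<subseteq> Q \<Longrightarrow> length Ps \<le> length as + 1"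
      using gg[OF P(1) Q(1) below[OF Q(1,2) subset_refl] P(2)] by blast
    have "length Ps \<le> length as + 1" if Ps: "prime_chain R Ps" "I \<subseteq> hd Ps" "last Ps \<subseteq> Q" for Ps
    proof -
      have "hd Ps \<in> set Ps" using Ps(1) by (simp add: prime_chain_def)
      then have "primeideal (hd Ps) R" "hd Ps \<subseteq> last Ps"
        using Ps(1) prime_chain_between(2)[OF Ps(1)] by (auto simp: prime_chain_def)
      then have "P \<subseteq> hd Ps" using below[of "hd Ps"] Ps(2,3) by blast
      then show ?thesis using as(3) Ps by blast
    qed
    then show ?thesis using as(1,2) by blast
  qed
  then show ?thesis using f by blast
qed

section \<open>Depth and dimension\<close>

context module
begin

lemma submod_gen_submodule:
  assumes "T \<subseteq> carrier M" shows "submodule (submod_gen R M T) R M"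
proof (rule submoduleI)
  show "submod_gen R M T \<subseteq> carrier M" unfolding submod_gen_def using carrier_is_submodule assms by blast
  show "\<zero>\<^bsub>M\<^esub> \<in> submod_gen R M T"
    unfolding submod_gen_def using submodule.axioms(1) subgroup.one_closed by fastforce
qed (use submoduleE in \<open>auto simp: submod_gen_def\<close>)

lemma submod_gen_incl: "T \<subseteq> submod_gen R M T" by (auto simp: submod_gen_def)

lemma submod_gen_minimal: "submodule N R M \<Longrightarrow> T \<subseteq> N \<Longrightarrow> submod_gen R M T \<subseteq> N"
  by (auto simp: submod_gen_def)

lemma submodule_zero: "submodule N R M \<Longrightarrow> \<zero>\<^bsub>M\<^esub> \<in> N"
  using submodule.axioms(1) subgroup.one_closed by fastforce

lemma seq_submod_submodule: "set xs \<subseteq> carrier R \<Longrightarrow> submodule (seq_submod R M xs) R M"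
  unfolding seq_submod_def by (rule submod_gen_submodule) auto

lemma seq_submod_mem: "x \<in> set xs \<Longrightarrow> y \<in> carrier M \<Longrightarrow> x \<odot>\<^bsub>M\<^esub> y \<in> seq_submod R M xs"
  unfolding seq_submod_def by (rule subsetD[OF submod_gen_incl]) auto

lemma seq_submod_mono: "set xs \<subseteq> set ys \<Longrightarrow> seq_submod R M xs \<subseteq> seq_submod R M ys"
  unfolding seq_submod_def submod_gen_def by blast

lemma ideal_conductor:
  assumes N: "submodule N R M"
  shows "ideal {t \<in> carrier R. \<forall>y\<in>carrier M. t \<odot>\<^bsub>M\<^esub> y \<in> N} R"
  by (rule R.ideal_of_closure)
    (use submodule_zero[OF N] submoduleE(4,5)[OF N] in \<open>auto simp: smult_l_distr smult_assoc1\<close>)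

lemma ideal_annihilator: "ideal (annihilator R M) R"
proof -
  have "submodule {\<zero>\<^bsub>M\<^esub>} R M" by (rule submoduleI) auto
  from ideal_conductor[OF this] show ?thesis by (simp add: annihilator_def)
qed

text \<open>Let \<open>c\<^sub>i\<close> be the annihilator of \<open>M/(x\<^sub>1, \<dots>, x\<^sub>i)M\<close>. A prime \<open>Q\<close> over \<open>c\<^sub>i\<^sub>+\<^sub>1\<close> contains \<open>x = x\<^sub>i\<^sub>+\<^sub>1\<close>. As \<open>x\<close> is a
  nonzerodivisor on \<open>M/(x\<^sub>1, \<dots>, x\<^sub>i)M\<close>, no product \<open>s x\<^sup>n\<close> with \<open>s \<notin> Q\<close> lies in \<open>c\<^sub>i\<close>, so some prime over \<open>c\<^sub>i\<close>
  inside \<open>Q\<close> avoids \<open>x\<close>. The chain is built downwards in this way, starting from a prime over the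
  annihilator of \<open>M/(x\<^sub>1, \<dots>, x\<^sub>k)M \<noteq> 0\<close>.\<close>

lemma regular_sequence_prime_chain:
  assumes "noetherian_ring R" and reg: "regular_sequence R M xs"
    and "j \<le> length xs"
  shows "\<exists>Ps. prime_chain R Ps \<and> length Ps = j + 1 \<and>
    {t \<in> carrier R. \<forall>y\<in>carrier M. t \<odot>\<^bsub>M\<^esub> y \<in> seq_submod R M (take (length xs - j) xs)} \<subseteq> hd Ps"
proof -
  interpret N: noeth_cring R using assms(1) R.is_cring by (simp add: noeth_cring_def)
  let ?N = "\<lambda>i. seq_submod R M (take i xs)"
  let ?a = "\<lambda>i. {t \<in> carrier R. \<forall>y\<in>carrier M. t \<odot>\<^bsub>M\<^esub> y \<in> ?N i}"
  have xsc: "set xs \<subseteq> carrier R" using reg by (simp add: regular_sequence_def)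
  have Ni: "submodule (?N i) R M" for i
    using xsc set_take_subset[of i xs] by (intro seq_submod_submodule) auto
  have ai: "ideal (?a i) R" for i by (rule ideal_conductor[OF Ni])
  have base: "\<exists>Ps. prime_chain R Ps \<and> length Ps = 0 + 1 \<and> ?a (length xs - 0) \<subseteq> hd Ps"
  proof -
    have "\<one> \<notin> ?a (length xs)"
      using reg submoduleE(1)[OF Ni[of "length xs"]] unfolding regular_sequence_def by auto
    then obtain P where "primeideal P R" "?a (length xs) \<subseteq> P" using N.proper_ideal_in_prime[OF ai] by blast
    then show ?thesis by (intro exI[of _ "[P]"]) (simp add: prime_chain_def)
  qed
  have step: "\<exists>Ps. prime_chain R Ps \<and> length Ps = Suc j + 1 \<and> ?a (length xs - Suc j) \<subseteq> hd Ps"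
    if Suc: "\<exists>Ps. prime_chain R Ps \<and> length Ps = j + 1 \<and> ?a (length xs - j) \<subseteq> hd Ps" "Suc j \<le> length xs" for j
  proof -
    define i where "i = length xs - Suc j"
    have i: "i < length xs" "length xs - j = Suc i" using Suc(2) by (auto simp: i_def)
    obtain Ps where Ps: "prime_chain R Ps" "length Ps = j + 1" "?a (Suc i) \<subseteq> hd Ps" using Suc(1) unfolding i(2) by blast
    have ne: "Ps \<noteq> []" using Ps(2) by auto
    define Q where "Q = hd Ps"
    have Q: "primeideal Q R" using Ps(1) ne by (simp add: prime_chain_def Q_def)
    define x where "x = xs ! i"
    have x: "x \<in> carrier R" using xsc i by (auto simp: x_def)
    have xa: "x \<in> ?a (Suc i)"
      using x i seq_submod_mem[of x "take (Suc i) xs"] by (auto simp: x_def take_Suc_conv_app_nth)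
    have aa: "?a i \<subseteq> Q"
    proof -
      have "?N i \<subseteq> ?N (Suc i)" by (rule seq_submod_mono) (simp add: set_take_subset_set_take)
      then show ?thesis using Ps(3) unfolding Q_def by auto
    qed
    have pw: "y \<in> ?N i" if "x [^] n \<odot>\<^bsub>M\<^esub> y \<in> ?N i" "y \<in> carrier M" for n :: nat and y
      using that
    proof (induction n arbitrary: y)
      case (Suc n)
      have "x \<odot>\<^bsub>M\<^esub> (x [^] n \<odot>\<^bsub>M\<^esub> y) \<in> ?N i"
        using Suc.prems x smult_assoc1[of x "x [^] n" y] R.m_comm[of x "x [^] n"] by simp
      then have "x [^] n \<odot>\<^bsub>M\<^esub> y \<in> ?N i"
        using reg i(1) Suc.prems(2) x unfolding regular_sequence_def x_def by simp
      then show ?case using Suc by blast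
    qed simp
    \<comment> \<open>A prime disjoint from this multiplicative set lies inside \<open>Q\<close> and avoids \<open>x\<close>.\<close>
  let ?S = "{s \<otimes> x [^] n | s n :: nat. s \<in> carrier R - Q}"
    have "\<exists>P. primeideal P R \<and> ?a i \<subseteq> P \<and> ?S \<inter> P = {}"
    proof (rule N.prime_avoiding[OF ai])
      show "?S \<subseteq> carrier R" using x by auto
      show "\<one> \<in> ?S" using R.prime_compl(1)[OF Q] by (intro CollectI exI[of _ \<one>] exI[of _ "0::nat"]) auto
      show "s \<otimes> t \<in> ?S" if st: "s \<in> ?S" "t \<in> ?S" for s t
      proof -
        obtain a n b k where e: "s = a \<otimes> x [^] (n::nat)" "t = b \<otimes> x [^] (k::nat)" "a \<in> carrier R - Q" "b \<in> carrier R - Q"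
          using st by auto
        define u v where "u = x [^] n" and "v = x [^] k"
        have c: "u \<in> carrier R" "v \<in> carrier R" "a \<in> carrier R" "b \<in> carrier R" using x e by (auto simp: u_def v_def)
        have "(a \<otimes> u) \<otimes> (b \<otimes> v) = (a \<otimes> b) \<otimes> (u \<otimes> v)" using c by algebra
        then have "s \<otimes> t = (a \<otimes> b) \<otimes> x [^] (n + k)"
          using R.nat_pow_mult[OF x, of n k] unfolding e(1,2) u_def v_def by simp
        then show ?thesis using R.prime_compl(2)[OF Q e(3,4)] by blast
      qed
      show "?S \<inter> ?a i = {}"
      proof (rule ccontr)
        assume "?S \<inter> ?a i \<noteq> {}"
        then obtain s n where s: "s \<in> carrier R" "s \<notin> Q" "s \<otimes> x [^] (n::nat) \<in> ?a i" by blast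
        have "s \<odot>\<^bsub>M\<^esub> y \<in> ?N i" if y: "y \<in> carrier M" for y
        proof (rule pw)
          have "(s \<otimes> x [^] n) \<odot>\<^bsub>M\<^esub> y \<in> ?N i" using s(3) y by blast
          then show "x [^] n \<odot>\<^bsub>M\<^esub> (s \<odot>\<^bsub>M\<^esub> y) \<in> ?N i"
            using s(1) x y R.m_comm[of s "x [^] n"] smult_assoc1[of "x [^] n" s y] by simp
        qed (use s y in simp)
        then have "s \<in> ?a i" using s(1) by blast
        then show False using aa s(2) by blast
      qed
    qed
    then obtain P where P: "primeideal P R" "?a i \<subseteq> P" "?S \<inter> P = {}" by blast
    have "P \<subseteq> Q"
    proof
      fix s assume s: "s \<in> P"
      have sc: "s \<in> carrier R" by (rule R.ideal_carr[OF R.prime_ideal[OF P(1)] s])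
      show "s \<in> Q"
      proof (rule ccontr)
        assume "s \<notin> Q"
        then have "s \<otimes> x [^] (0::nat) \<in> ?S" using sc by blast
        then show False using P(3) s sc by auto
      qed
    qed
    moreover have "x \<notin> P"
    proof
      assume "x \<in> P"
      moreover have "\<one> \<otimes> x [^] (1::nat) \<in> ?S" using R.prime_compl(1)[OF Q] by blast
      ultimately show False using P(3) x by auto
    qed
    moreover have "x \<in> Q" using xa Ps(3) unfolding Q_def by blast
    ultimately have "P \<subset> Q" by blast
    then have "prime_chain R (P # Ps)" using Ps(1) P(1) by (simp add: prime_chain_Cons Q_def)
    then show ?thesis using Ps(2) P(2) unfolding i_def by (intro exI[of _ "P # Ps"]) simp
  qed
  show ?thesis using \<open>j \<le> length xs\<close>
  proof (induction j)
    case 0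
    show ?case by (rule base)
  next
    case (Suc j)
    show ?case by (rule step[OF _ Suc.prems]) (use Suc in simp)
  qed
qed

end

lemma (in cring) quot_frac_hom:
  assumes I: "ideal I R" shows "frac_hom R (R Quot I) ((+>) I)" "(+>) I ` carrier R = carrier (R Quot I)"
proof -
  interpret I: ideal I R by (rule I)
  show s: "(+>) I ` carrier R = carrier (R Quot I)" by (auto simp: FactRing_def A_RCOSETS_def')
  show "frac_hom R (R Quot I) ((+>) I)"
    by (rule surj_frac_hom[OF is_cring I.quotient_is_cring[OF is_cring] I.rcos_ring_hom s])
qed

lemma (in cring) quot_zero_iff:
  assumes I: "ideal I R" and r: "r \<in> carrier R"
  shows "I +> r = \<zero>\<^bsub>R Quot I\<^esub> \<longleftrightarrow> r \<in> I"
proof -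
  interpret I: ideal I R by (rule I)
  have "I +> r = I \<longleftrightarrow> r \<in> I"
    using I.rcos_const_imp_mem[OF r] I.a_rcos_const by blast
  then show ?thesis by (simp add: FactRing_def)
qed

text \<open>Hence the depth of a module over a Noetherian ring, with respect to any set of elements, is at most its
  dimension.\<close>

theorem (in module) length_regular_sequence_le_dim:
  assumes "noetherian_ring R" and reg: "regular_sequence R M xs"
  shows "enat (length xs) \<le> module_dim R M"
proof -
  note Ai = ideal_annihilator
  interpret F: frac_hom R "R Quot annihilator R M" "a_r_coset R (annihilator R M)" by (rule R.quot_frac_hom(1)[OF Ai])
  obtain Ps where Ps: "prime_chain R Ps" "length Ps = length xs + 1"
    "{t \<in> carrier R. \<forall>y\<in>carrier M. t \<odot>\<^bsub>M\<^esub> y \<in> seq_submod R M (take (length xs - length xs) xs)} \<subseteq> hd Ps"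
    using regular_sequence_prime_chain[OF assms order_refl] by blast
  have "annihilator R M \<subseteq> hd Ps"
    using Ps(3) submodule_zero[OF seq_submod_submodule[of "[]"]] by (auto simp: annihilator_def)
  then have ann: "annihilator R M \<subseteq> p" if "p \<in> set Ps" for p
    using prime_chain_between(1)[OF Ps(1) that] by blast
  have "prime_chain (R Quot annihilator R M) (map F.ext Ps)"
  proof (rule F.prime_chain_ext[OF Ps(1)])
    fix p assume p: "p \<in> set Ps"
    then have "primeideal p R" using Ps(1) by (simp add: prime_chain_def)
    then show "F.ctr (F.ext p) = p \<and> primeideal (F.ext p) (R Quot annihilator R M)"
      using F.prime_ext_surj[OF R.quot_frac_hom(2)[OF Ai], of p] R.quot_zero_iff[OF Ai] ann[OF p] by blast
  qed
  then have "enat (length (map F.ext Ps) - 1) \<le> krull_dim (R Quot annihilator R M)"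
    unfolding krull_dim_def by (intro SUP_upper) simp
  then show ?thesis using Ps(2) by (simp add: module_dim_def)
qed

text \<open>Here \<open>M\<close> is the localization of \<open>U/V\<close> at \<open>Q\<close>, described through the map \<open>k : U \<rightarrow> M\<close>. Its depth is at least
  \<open>d = length as\<close>, as \<open>as\<close> is regular on it, and its dimension is at most \<open>d\<close>, as chains of primes of \<open>L\<close>
  contract to chains between \<open>I\<close> and \<open>Q\<close>. Since depth never exceeds dimension, both are \<open>d\<close>.\<close>

theorem (in frac_local) depth_eq_dim_criterion:
  assumes nR: "noetherian_ring R" and "module L M"
    and U: "ideal U R" and V: "ideal V R" and VU: "V \<subseteq> U"
    and k_closed: "\<And>u. u \<in> U \<Longrightarrow> k u \<in> carrier M"
    and k_add: "\<And>u v. u \<in> U \<Longrightarrow> v \<in> U \<Longrightarrow> k (u \<oplus> v) = k u \<oplus>\<^bsub>M\<^esub> k v"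
    and k_smult: "\<And>r u. r \<in> carrier R \<Longrightarrow> u \<in> U \<Longrightarrow> k (r \<otimes> u) = h r \<odot>\<^bsub>M\<^esub> k u"
    and k_frac: "\<And>y. y \<in> carrier M \<Longrightarrow> \<exists>s\<in>carrier R. s \<notin> Q \<and> (\<exists>u\<in>U. h s \<odot>\<^bsub>M\<^esub> y = k u)"
    and k_ker: "\<And>u. u \<in> U \<Longrightarrow> k u = \<zero>\<^bsub>M\<^esub> \<longleftrightarrow> u \<in> R.saturate Q V"
    and as: "set as \<subseteq> Q" and wr: "R.loc_regular Q V U as"
    and hI: "\<And>r. r \<in> I \<Longrightarrow> r \<in> carrier R \<and> h r = \<zero>\<^bsub>L\<^esub>"
    and ch: "\<And>Ps. prime_chain R Ps \<Longrightarrow> I \<subseteq> hd Ps \<Longrightarrow> last Ps \<subseteq> Q \<Longrightarrow> length Ps \<le> length as + 1"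
    and nz: "carrier M \<noteq> {\<zero>\<^bsub>M\<^esub>}"
  shows "depth L (ext Q) M = module_dim L M"
proof -
  interpret M: module L M by fact
  interpret RN: noeth_cring R using nR R.is_cring by (simp add: noeth_cring_def)
  have nL: "noetherian_ring L" using noetherian_target[OF nR] by (simp add: noeth_cring_def)
  note Qi = R.prime_ideal[OF Q_prime]
  have asc: "set as \<subseteq> carrier R" using as R.ideal_carr[OF Qi] by blast
  have uc: "u \<in> carrier R" if "u \<in> U" for u by (rule R.ideal_carr[OF U that])
  have unit_cancel: "y \<in> N" if N: "submodule N L M" and s: "s \<in> carrier R" "s \<notin> Q" "y \<in> carrier M" "h s \<odot>\<^bsub>M\<^esub> y \<in> N" for N s y
  proof -
    have hs: "h s \<in> Units L" using unit_iff s by simp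
    have "inv\<^bsub>L\<^esub> (h s) \<odot>\<^bsub>M\<^esub> (h s \<odot>\<^bsub>M\<^esub> y) = y"
      using M.smult_assoc1[of "inv\<^bsub>L\<^esub> (h s)" "h s" y, symmetric] hs s by simp
    then show ?thesis using M.submoduleE(4)[OF N _ s(4), of "inv\<^bsub>L\<^esub> (h s)"] hs by simp
  qed
  have swap: "x \<odot>\<^bsub>M\<^esub> (z \<odot>\<^bsub>M\<^esub> y) = z \<odot>\<^bsub>M\<^esub> (x \<odot>\<^bsub>M\<^esub> y)"
    if c: "x \<in> carrier L" "z \<in> carrier L" "y \<in> carrier M" for x z y
    unfolding M.smult_assoc1[OF c(1,2,3), symmetric] M.smult_assoc1[OF c(2,1,3), symmetric] S.m_comm[OF c(1,2)] ..
  \<comment> \<open>\<open>NV W\<close> is the submodule of \<open>M\<close> generated by the image of \<open>W\<close>.\<close>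
  define NV where "NV W = {y \<in> carrier M. \<exists>s\<in>carrier R. s \<notin> Q \<and> (\<exists>u\<in>W. h s \<odot>\<^bsub>M\<^esub> y = k u)}" for W
  have NVsub: "submodule (NV W) L M" if W: "ideal W R" "W \<subseteq> U" for W
  proof -
    have add: "x \<oplus>\<^bsub>M\<^esub> y \<in> NV W" if xy: "x \<in> NV W" "y \<in> NV W" for x y
    proof -
      obtain s u where su: "x \<in> carrier M" "s \<in> carrier R" "s \<notin> Q" "u \<in> W" "h s \<odot>\<^bsub>M\<^esub> x = k u" using xy by (auto simp: NV_def)
      obtain t v where tv: "y \<in> carrier M" "t \<in> carrier R" "t \<notin> Q" "v \<in> W" "h t \<odot>\<^bsub>M\<^esub> y = k v" using xy by (auto simp: NV_def)
      have c: "h s \<in> carrier L" "h t \<in> carrier L" using su tv by auto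
      have "h (s \<otimes> t) \<odot>\<^bsub>M\<^esub> (x \<oplus>\<^bsub>M\<^esub> y) = (h t \<otimes>\<^bsub>L\<^esub> h s) \<odot>\<^bsub>M\<^esub> x \<oplus>\<^bsub>M\<^esub> (h s \<otimes>\<^bsub>L\<^esub> h t) \<odot>\<^bsub>M\<^esub> y"
        using su tv c by (simp add: M.smult_r_distr S.m_comm)
      also have "\<dots> = h t \<odot>\<^bsub>M\<^esub> k u \<oplus>\<^bsub>M\<^esub> h s \<odot>\<^bsub>M\<^esub> k v" using su tv c by (simp add: M.smult_assoc1)
      also have "\<dots> = k (t \<otimes> u \<oplus> s \<otimes> v)"
        using k_smult k_add su tv W(2) R.ideal_mult[OF U] by (simp add: subset_iff)
      finally have "h (s \<otimes> t) \<odot>\<^bsub>M\<^esub> (x \<oplus>\<^bsub>M\<^esub> y) = k (t \<otimes> u \<oplus> s \<otimes> v)" .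
      moreover have "t \<otimes> u \<oplus> s \<otimes> v \<in> W" using R.ideal_add[OF W(1)] R.ideal_mult[OF W(1)] su tv by auto
      moreover have "s \<otimes> t \<in> carrier R - Q" using R.prime_compl(2)[OF Q_prime] su tv by auto
      ultimately show ?thesis using su(1) tv(1) unfolding NV_def by blast
    qed
    have smult: "z \<odot>\<^bsub>M\<^esub> x \<in> NV W" if zx: "z \<in> carrier L" "x \<in> NV W" for z x
    proof -
      obtain s u where su: "x \<in> carrier M" "s \<in> carrier R" "s \<notin> Q" "u \<in> W" "h s \<odot>\<^bsub>M\<^esub> x = k u" using zx by (auto simp: NV_def)
      obtain r t where rt: "r \<in> carrier R" "t \<in> carrier R" "h t \<in> Units L" "z \<otimes>\<^bsub>L\<^esub> h t = h r" using frac[OF zx(1)] by blast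
      have c: "h s \<in> carrier L" "h t \<in> carrier L" using su rt by auto
      have "(h t \<otimes>\<^bsub>L\<^esub> h s) \<otimes>\<^bsub>L\<^esub> z = (z \<otimes>\<^bsub>L\<^esub> h t) \<otimes>\<^bsub>L\<^esub> h s" using c zx(1) by algebra
      then have "h (t \<otimes> s) \<odot>\<^bsub>M\<^esub> (z \<odot>\<^bsub>M\<^esub> x) = h r \<odot>\<^bsub>M\<^esub> (h s \<odot>\<^bsub>M\<^esub> x)"
        using su rt zx(1) c M.smult_assoc1[of "h t \<otimes>\<^bsub>L\<^esub> h s" z x] M.smult_assoc1[of "h r" "h s" x] by simp
      also have "\<dots> = k (r \<otimes> u)" unfolding su(5) using k_smult[OF rt(1)] su(4) W(2) by auto
      finally have "h (t \<otimes> s) \<odot>\<^bsub>M\<^esub> (z \<odot>\<^bsub>M\<^esub> x) = k (r \<otimes> u)" .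
      moreover have "t \<otimes> s \<in> carrier R - Q" using R.prime_compl(2)[OF Q_prime, of t s] su rt unit_iff by auto
      moreover have "r \<otimes> u \<in> W" by (rule R.ideal_mult[OF W(1) rt(1) su(4)])
      ultimately show ?thesis using su(1) zx(1) unfolding NV_def by blast
    qed
    have k0: "k \<zero> = \<zero>\<^bsub>M\<^esub>"
      using k_ker[OF R.ideal_zero[OF U]] R.ideal_zero[OF R.ideal_saturate[OF Q_prime V]] by simp
    show ?thesis
    proof (rule M.submoduleI)
      show "NV W \<subseteq> carrier M" by (auto simp: NV_def)
      have "h \<one> \<odot>\<^bsub>M\<^esub> \<zero>\<^bsub>M\<^esub> = k \<zero>" using k0 by simp
      then show "\<zero>\<^bsub>M\<^esub> \<in> NV W" using R.ideal_zero[OF W(1)] R.prime_notone[OF Q_prime] unfolding NV_def by blast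
      show "\<ominus>\<^bsub>M\<^esub> x \<in> NV W" if x: "x \<in> NV W" for x
      proof -
        have xc: "x \<in> carrier M" using x by (auto simp: NV_def)
        have "(\<ominus>\<^bsub>L\<^esub> \<one>\<^bsub>L\<^esub>) \<odot>\<^bsub>M\<^esub> x \<in> NV W" by (rule smult[OF _ x]) simp
        then show ?thesis using M.smult_l_minus[of "\<one>\<^bsub>L\<^esub>" x] xc by simp
      qed
    qed (use add smult in auto)
  qed
  have NVmem: "k u \<in> NV W \<longleftrightarrow> u \<in> R.saturate Q W" if W: "ideal W R" "V \<subseteq> W" "W \<subseteq> U" and u: "u \<in> U" for W u
  proof
    assume "k u \<in> NV W"
    then obtain s w where sw: "s \<in> carrier R" "s \<notin> Q" "w \<in> W" "h s \<odot>\<^bsub>M\<^esub> k u = k w" by (auto simp: NV_def)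
    have su: "s \<otimes> u \<in> U" by (rule R.ideal_mult[OF U sw(1) u])
    have wU: "w \<in> U" and wc: "w \<in> carrier R" using sw W uc by auto
    have d: "s \<otimes> u \<ominus> w \<in> U" by (rule R.ideal_minus[OF U su wU])
    have "k (s \<otimes> u \<ominus> w) \<oplus>\<^bsub>M\<^esub> k w = k ((s \<otimes> u \<ominus> w) \<oplus> w)" using k_add[OF d wU] by simp
    also have "(s \<otimes> u \<ominus> w) \<oplus> w = s \<otimes> u" using sw(1) uc[OF u] wc by algebra
    also have "k (s \<otimes> u) = k w" using k_smult[OF sw(1) u] sw(4) by simp
    finally have "k (s \<otimes> u \<ominus> w) \<oplus>\<^bsub>M\<^esub> k w = k w" .
    then have "k (s \<otimes> u \<ominus> w) = \<zero>\<^bsub>M\<^esub>" using M.add.r_cancel_one[OF k_closed[OF wU] k_closed[OF d]] by simp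
    then have "s \<otimes> u \<ominus> w \<in> R.saturate Q W" using k_ker[OF d] R.saturate_mono[OF W(2)] by blast
    then have "(s \<otimes> u \<ominus> w) \<oplus> w \<in> R.saturate Q W"
      using R.ideal_add[OF R.ideal_saturate[OF Q_prime W(1)]] R.saturate_incl[OF Q_prime W(1)] sw(3) by blast
    then have "s \<otimes> u \<in> R.saturate Q W" using \<open>(s \<otimes> u \<ominus> w) \<oplus> w = s \<otimes> u\<close> by simp
    then show "u \<in> R.saturate Q W" by (rule R.saturate_multD[OF Q_prime sw(1,2) uc[OF u]])
  next
    assume "u \<in> R.saturate Q W"
    then obtain s where s: "s \<in> carrier R" "s \<notin> Q" "s \<otimes> u \<in> W" by (auto elim!: R.saturateE)
    then show "k u \<in> NV W" using k_smult[OF s(1) u] k_closed[OF u] unfolding NV_def by force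
  qed
  have wU: "ideal (R.adjoin_list V U bs) R" "V \<subseteq> R.adjoin_list V U bs" "R.adjoin_list V U bs \<subseteq> U" if bs: "set bs \<subseteq> carrier R" for bs
    using R.ideal_adjoin_list[OF V U bs] R.adjoin_list_incl[OF V U bs] R.adjoin_list_subset[OF U VU, of bs U] R.ideal_mult[OF U] bs by blast+
  have seq: "seq_submod L M (map h bs) = NV (R.adjoin_list V U bs)" if bs: "set bs \<subseteq> carrier R" for bs
  proof
    let ?W = "R.adjoin_list V U bs"
    note W = wU[OF bs]
    show "seq_submod L M (map h bs) \<subseteq> NV ?W"
      unfolding seq_submod_def
    proof (rule M.submod_gen_minimal[OF NVsub[OF W(1,3)]], safe)
      fix x y assume x: "x \<in> set (map h bs)" and y: "y \<in> carrier M"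
      then obtain b where b: "b \<in> set bs" "x = h b" by auto
      have bc: "b \<in> carrier R" using b bs by auto
      obtain s u where su: "s \<in> carrier R" "s \<notin> Q" "u \<in> U" "h s \<odot>\<^bsub>M\<^esub> y = k u" using k_frac[OF y] by blast
      have "h s \<odot>\<^bsub>M\<^esub> (h b \<odot>\<^bsub>M\<^esub> y) = h b \<odot>\<^bsub>M\<^esub> (h s \<odot>\<^bsub>M\<^esub> y)"
        using swap[of "h s" "h b" y] su(1) bc y by simp
      also have "\<dots> = k (b \<otimes> u)" unfolding su(4) using k_smult[OF bc su(3)] by simp
      finally have "h s \<odot>\<^bsub>M\<^esub> (h b \<odot>\<^bsub>M\<^esub> y) = k (b \<otimes> u)" .
      moreover have "b \<otimes> u \<in> ?W" by (rule R.adjoin_list_mem[OF V U bs b(1) su(3)])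
      moreover have "h b \<odot>\<^bsub>M\<^esub> y \<in> carrier M" using bc y by simp
      ultimately show "x \<odot>\<^bsub>M\<^esub> y \<in> NV ?W" using su(1,2) b(2) unfolding NV_def by blast
    qed
    let ?N = "seq_submod L M (map h bs)"
    have N: "submodule ?N L M" by (rule M.seq_submod_submodule) (use bs in auto)
    have K: "ideal {w \<in> U. k w \<in> ?N} R"
    proof (rule R.ideal_of_closure)
      show "\<zero> \<in> {w \<in> U. k w \<in> ?N}"
        using k_ker[OF R.ideal_zero[OF U]] R.ideal_zero[OF R.ideal_saturate[OF Q_prime V]] R.ideal_zero[OF U] M.submodule_zero[OF N] by simp
    qed (use uc R.ideal_add[OF U] R.ideal_mult[OF U] k_add k_smult M.submoduleE(4,5)[OF N] in auto)
    have Wk: "?W \<subseteq> {w \<in> U. k w \<in> ?N}"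
    proof (rule R.adjoin_list_subset[OF K])
      show "V \<subseteq> {w \<in> U. k w \<in> ?N}"
      proof
        fix v assume v: "v \<in> V"
        then have "k v = \<zero>\<^bsub>M\<^esub>" using k_ker VU R.saturate_incl[OF Q_prime V] by blast
        then show "v \<in> {w \<in> U. k w \<in> ?N}" using v VU M.submodule_zero[OF N] by auto
      qed
      fix a u assume au: "a \<in> set bs" "u \<in> U"
      have ac: "a \<in> carrier R" using au bs by auto
      have "h a \<odot>\<^bsub>M\<^esub> k u \<in> ?N" by (rule M.seq_submod_mem) (use au k_closed in auto)
      then show "a \<otimes> u \<in> {w \<in> U. k w \<in> ?N}" using R.ideal_mult[OF U ac au(2)] k_smult[OF ac au(2)] by simp
    qed
    show "NV ?W \<subseteq> ?N"
    proof
      fix y assume "y \<in> NV ?W"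
      then obtain s u where su: "y \<in> carrier M" "s \<in> carrier R" "s \<notin> Q" "u \<in> ?W" "h s \<odot>\<^bsub>M\<^esub> y = k u" by (auto simp: NV_def)
      then have "h s \<odot>\<^bsub>M\<^esub> y \<in> ?N" using Wk by auto
      then show "y \<in> ?N" by (rule unit_cancel[OF N su(2,3,1)])
    qed
  qed
  have tk: "set (take i as) \<subseteq> carrier R" for i using asc set_take_subset[of i as] by blast
  have regs: "regular_sequence L M (map h as)"
    unfolding regular_sequence_def
  proof (intro conjI allI impI ballI)
    show "set (map h as) \<subseteq> carrier L" using asc by auto
    fix i y assume i: "i < length (map h as)" and y: "y \<in> carrier M"
      and m: "map h as ! i \<odot>\<^bsub>M\<^esub> y \<in> seq_submod L M (take i (map h as))"
    let ?W = "R.adjoin_list V U (take i as)"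
    note W = wU[OF tk[of i]] and sq = seq[OF tk[of i]]
    have il: "i < length as" using i by simp
    have ac: "as ! i \<in> carrier R" using il asc by auto
    have m': "h (as ! i) \<odot>\<^bsub>M\<^esub> y \<in> NV ?W" using m il sq by (simp add: take_map)
    obtain s u where su: "s \<in> carrier R" "s \<notin> Q" "u \<in> U" "h s \<odot>\<^bsub>M\<^esub> y = k u" using k_frac[OF y] by blast
    have "k (as ! i \<otimes> u) = h s \<odot>\<^bsub>M\<^esub> (h (as ! i) \<odot>\<^bsub>M\<^esub> y)"
      unfolding k_smult[OF ac su(3)] su(4)[symmetric] using swap[of "h (as ! i)" "h s" y] su(1) ac y by simp
    also have "\<dots> \<in> NV ?W" by (rule M.submoduleE(4)[OF NVsub[OF W(1,3)] _ m']) (use su in simp)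
    finally have "as ! i \<otimes> u \<in> R.saturate Q ?W" using NVmem[OF W] R.ideal_mult[OF U ac su(3)] by blast
    then have "u \<in> R.saturate Q ?W" by (rule R.loc_regular_nth[OF wr il su(3)])
    then have "h s \<odot>\<^bsub>M\<^esub> y \<in> NV ?W" using NVmem[OF W su(3)] su(4) by simp
    then have "y \<in> NV ?W" by (rule unit_cancel[OF NVsub[OF W(1,3)] su(1,2) y])
    then show "y \<in> seq_submod L M (take i (map h as))" using sq by (simp add: take_map)
  next
    show "seq_submod L M (map h as) \<noteq> carrier M"
    proof
      assume "seq_submod L M (map h as) = carrier M"
      then have full: "NV (R.adjoin_list V U as) = carrier M" using seq[OF asc] by simp
      note W = wU[OF asc]
      have "U \<subseteq> R.saturate Q (R.adjoin_list V U as)" using NVmem[OF W] full k_closed by blast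
      then have UV: "U \<subseteq> R.saturate Q V" by (rule RN.nakayama[OF Q_prime V U as])
      have "y = \<zero>\<^bsub>M\<^esub>" if y: "y \<in> carrier M" for y
      proof -
        obtain s u where su: "s \<in> carrier R" "s \<notin> Q" "u \<in> U" "h s \<odot>\<^bsub>M\<^esub> y = k u" using k_frac[OF y] by blast
        then have "h s \<odot>\<^bsub>M\<^esub> y \<in> {\<zero>\<^bsub>M\<^esub>}" using k_ker UV by auto
        moreover have "submodule {\<zero>\<^bsub>M\<^esub>} L M" by (rule M.submoduleI) auto
        ultimately show ?thesis using unit_cancel su(1,2) y by blast
      qed
      then show False using nz M.zero_closed by blast
    qed
  qed
  have lower: "enat (length as) \<le> depth L (ext Q) M"
  proof -
    have "set (map h as) \<subseteq> ext Q" using as asc hom_in_ext by auto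
    then have "enat (length (map h as)) \<le> depth L (ext Q) M"
      unfolding depth_def by (intro SUP_upper) (use regs in simp)
    then show ?thesis by simp
  qed
  have upper: "depth L (ext Q) M \<le> module_dim L M"
    unfolding depth_def by (rule SUP_least) (use M.length_regular_sequence_le_dim[OF nL] in auto)
  have "module_dim L M \<le> enat (length as)"
    unfolding module_dim_def
  proof (rule krull_dim_le)
    fix Ps assume Ps: "prime_chain (L Quot annihilator L M) Ps"
    interpret F: frac_hom L "L Quot annihilator L M" "a_r_coset L (annihilator L M)"
      by (rule S.quot_frac_hom(1)[OF M.ideal_annihilator])
    have c1: "prime_chain L (map F.ctr Ps)" by (rule F.prime_chain_ctr[OF Ps])
    let ?Ps = "map ctr (map F.ctr Ps)"
    have c2: "prime_chain R ?Ps" by (rule prime_chain_ctr[OF c1])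
    have ne: "map F.ctr Ps \<noteq> []" using c1 by (simp add: prime_chain_def)
    have pr: "primeideal p L" if "p \<in> set (map F.ctr Ps)" for p using c1 that unfolding prime_chain_def by blast
    have "I \<subseteq> hd ?Ps"
    proof -
      have p: "primeideal (hd (map F.ctr Ps)) L" using pr ne hd_in_set by blast
      have "hd ?Ps = ctr (hd (map F.ctr Ps))" by (rule hd_map[OF ne])
      then show ?thesis using hI S.ideal_zero[OF S.prime_ideal[OF p]] by (auto simp: ctr_def)
    qed
    moreover have "last ?Ps \<subseteq> Q"
    proof -
      have p: "primeideal (last (map F.ctr Ps)) L" using pr ne last_in_set by blast
      have "last ?Ps = ctr (last (map F.ctr Ps))" by (rule last_map[OF ne])
      then show ?thesis using ctr_subset_Q[OF S.prime_ideal[OF p] S.prime_notone[OF p]] by simp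
    qed
    ultimately show "length Ps \<le> length as + 1" using ch[OF c2] by simp
  qed
  then show ?thesis using lower upper by (meson order_antisym order_trans)
qed

section \<open>Localized modules\<close>

locale mult_module = module R M + mult_set R S for R (structure) and M (structure) and S
begin

abbreviation "mfr \<equiv> loc_mfrac R S M"
abbreviation "LM \<equiv> loc_module R S M"

lemma mfrac_mem_iff: "(y, t) \<in> mfr x s \<longleftrightarrow> y \<in> carrier M \<and> t \<in> S \<and> (\<exists>u\<in>S. (u \<otimes> t) \<odot>\<^bsub>M\<^esub> x = (u \<otimes> s) \<odot>\<^bsub>M\<^esub> y)"
  by (simp add: loc_mfrac_def)

lemma mfrac_refl: "x \<in> carrier M \<Longrightarrow> s \<in> S \<Longrightarrow> (x, s) \<in> mfr x s"
  using S_one by (auto simp: mfrac_mem_iff)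

lemma smult_swap:
  assumes "a \<in> carrier R" "b \<in> carrier R" "x \<in> carrier M"
  shows "a \<odot>\<^bsub>M\<^esub> (b \<odot>\<^bsub>M\<^esub> x) = b \<odot>\<^bsub>M\<^esub> (a \<odot>\<^bsub>M\<^esub> x)"
  unfolding smult_assoc1[OF assms(1,2,3), symmetric] smult_assoc1[OF assms(2,1,3), symmetric] R.m_comm[OF assms(1,2)] ..

lemma mfrac_subset:
  assumes xy: "x \<in> carrier M" "y \<in> carrier M" and st: "s \<in> S" "t \<in> S" "u \<in> S" and e: "(u \<otimes> t) \<odot>\<^bsub>M\<^esub> x = (u \<otimes> s) \<odot>\<^bsub>M\<^esub> y"
  shows "mfr x s \<subseteq> mfr y t"
proof
  fix p assume "p \<in> mfr x s"
  then obtain z w v where p: "p = (z, w)" "z \<in> carrier M" "w \<in> S" "v \<in> S" "(v \<otimes> w) \<odot>\<^bsub>M\<^esub> x = (v \<otimes> s) \<odot>\<^bsub>M\<^esub> z"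
    by (cases p) (auto simp: mfrac_mem_iff)
  note c = Sc[OF st(1)] Sc[OF st(2)] Sc[OF st(3)] Sc[OF p(3)] Sc[OF p(4)]
  have r1: "(u \<otimes> v \<otimes> s) \<otimes> w = (v \<otimes> w) \<otimes> (u \<otimes> s)" and r2: "(u \<otimes> t) \<otimes> (v \<otimes> s) = (u \<otimes> v \<otimes> s) \<otimes> t"
    using c by algebra+
  have "((u \<otimes> v \<otimes> s) \<otimes> w) \<odot>\<^bsub>M\<^esub> y = (v \<otimes> w) \<odot>\<^bsub>M\<^esub> ((u \<otimes> s) \<odot>\<^bsub>M\<^esub> y)"
    unfolding r1 using smult_assoc1[of "v \<otimes> w" "u \<otimes> s" y] c xy by simp
  also have "\<dots> = (u \<otimes> t) \<odot>\<^bsub>M\<^esub> ((v \<otimes> w) \<odot>\<^bsub>M\<^esub> x)"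
    unfolding e[symmetric] using smult_swap[of "v \<otimes> w" "u \<otimes> t" x] c xy by simp
  also have "\<dots> = ((u \<otimes> v \<otimes> s) \<otimes> t) \<odot>\<^bsub>M\<^esub> z"
    unfolding p(5) r2[symmetric] using smult_assoc1[of "u \<otimes> t" "v \<otimes> s" z] c p(2) by simp
  finally show "p \<in> mfr y t" using p S_mult st by (auto simp: mfrac_mem_iff intro!: bexI[of _ "u \<otimes> v \<otimes> s"])
qed

lemma mfrac_eqI:
  assumes "x \<in> carrier M" "y \<in> carrier M" "s \<in> S" "t \<in> S" "u \<in> S" "(u \<otimes> t) \<odot>\<^bsub>M\<^esub> x = (u \<otimes> s) \<odot>\<^bsub>M\<^esub> y"
  shows "mfr x s = mfr y t"
  using mfrac_subset[OF assms] mfrac_subset[OF assms(2,1,4,3,5) assms(6)[symmetric]] by blast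

lemma mfrac_eq_iff:
  assumes "x \<in> carrier M" "y \<in> carrier M" "s \<in> S" "t \<in> S"
  shows "mfr x s = mfr y t \<longleftrightarrow> (\<exists>u\<in>S. (u \<otimes> t) \<odot>\<^bsub>M\<^esub> x = (u \<otimes> s) \<odot>\<^bsub>M\<^esub> y)"
proof
  assume "mfr x s = mfr y t"
  then have "(y, t) \<in> mfr x s" using mfrac_refl assms by simp
  then show "\<exists>u\<in>S. (u \<otimes> t) \<odot>\<^bsub>M\<^esub> x = (u \<otimes> s) \<odot>\<^bsub>M\<^esub> y" by (simp add: mfrac_mem_iff)
qed (use mfrac_eqI[OF assms] in blast)

lemma mfrac_carr: "x \<in> carrier M \<Longrightarrow> s \<in> S \<Longrightarrow> mfr x s \<in> carrier LM"
  by (auto simp: loc_module_def)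

lemma mfrac_cases:
  assumes "y \<in> carrier LM" obtains x s where "x \<in> carrier M" "s \<in> S" "y = mfr x s"
  using assms by (auto simp: loc_module_def)

lemma mfrac_add:
  assumes a: "x \<in> carrier M" "y \<in> carrier M" "s \<in> S" "t \<in> S"
  shows "mfr x s \<oplus>\<^bsub>LM\<^esub> mfr y t = mfr (t \<odot>\<^bsub>M\<^esub> x \<oplus>\<^bsub>M\<^esub> s \<odot>\<^bsub>M\<^esub> y) (s \<otimes> t)"
proof -
  have eq: "mfr (t' \<odot>\<^bsub>M\<^esub> x' \<oplus>\<^bsub>M\<^esub> s' \<odot>\<^bsub>M\<^esub> y') (s' \<otimes> t') = mfr (t \<odot>\<^bsub>M\<^esub> x \<oplus>\<^bsub>M\<^esub> s \<odot>\<^bsub>M\<^esub> y) (s \<otimes> t)"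
    if m: "(x', s') \<in> mfr x s" "(y', t') \<in> mfr y t" for x' s' y' t'
  proof -
    obtain u where u: "x' \<in> carrier M" "s' \<in> S" "u \<in> S" "(u \<otimes> s') \<odot>\<^bsub>M\<^esub> x = (u \<otimes> s) \<odot>\<^bsub>M\<^esub> x'" using m by (auto simp: mfrac_mem_iff)
    obtain v where v: "y' \<in> carrier M" "t' \<in> S" "v \<in> S" "(v \<otimes> t') \<odot>\<^bsub>M\<^esub> y = (v \<otimes> t) \<odot>\<^bsub>M\<^esub> y'" using m by (auto simp: mfrac_mem_iff)
    note c = Sc[OF a(3)] Sc[OF a(4)] Sc[OF u(2)] Sc[OF u(3)] Sc[OF v(2)] Sc[OF v(3)]
    have r: "((u \<otimes> v) \<otimes> (s \<otimes> t)) \<otimes> t' = (v \<otimes> t \<otimes> t') \<otimes> (u \<otimes> s)"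
      "((u \<otimes> v) \<otimes> (s \<otimes> t)) \<otimes> s' = (u \<otimes> s \<otimes> s') \<otimes> (v \<otimes> t)"
      "((u \<otimes> v) \<otimes> (s' \<otimes> t')) \<otimes> t = (v \<otimes> t \<otimes> t') \<otimes> (u \<otimes> s')"
      "((u \<otimes> v) \<otimes> (s' \<otimes> t')) \<otimes> s = (u \<otimes> s \<otimes> s') \<otimes> (v \<otimes> t')" using c by algebra+
    have "((u \<otimes> v) \<otimes> (s \<otimes> t)) \<odot>\<^bsub>M\<^esub> (t' \<odot>\<^bsub>M\<^esub> x' \<oplus>\<^bsub>M\<^esub> s' \<odot>\<^bsub>M\<^esub> y') =
        (((u \<otimes> v) \<otimes> (s \<otimes> t)) \<otimes> t') \<odot>\<^bsub>M\<^esub> x' \<oplus>\<^bsub>M\<^esub> (((u \<otimes> v) \<otimes> (s \<otimes> t)) \<otimes> s') \<odot>\<^bsub>M\<^esub> y'"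
      using c u(1) v(1) by (simp add: smult_r_distr smult_assoc1)
    also have "\<dots> = (v \<otimes> t \<otimes> t') \<odot>\<^bsub>M\<^esub> ((u \<otimes> s) \<odot>\<^bsub>M\<^esub> x') \<oplus>\<^bsub>M\<^esub> (u \<otimes> s \<otimes> s') \<odot>\<^bsub>M\<^esub> ((v \<otimes> t) \<odot>\<^bsub>M\<^esub> y')"
      unfolding r using c u(1) v(1) by (simp add: smult_assoc1)
    also have "\<dots> = (((u \<otimes> v) \<otimes> (s' \<otimes> t')) \<otimes> t) \<odot>\<^bsub>M\<^esub> x \<oplus>\<^bsub>M\<^esub> (((u \<otimes> v) \<otimes> (s' \<otimes> t')) \<otimes> s) \<odot>\<^bsub>M\<^esub> y"
      unfolding r u(4)[symmetric] v(4)[symmetric] using c a(1,2) by (simp add: smult_assoc1)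
    also have "\<dots> = ((u \<otimes> v) \<otimes> (s' \<otimes> t')) \<odot>\<^bsub>M\<^esub> (t \<odot>\<^bsub>M\<^esub> x \<oplus>\<^bsub>M\<^esub> s \<odot>\<^bsub>M\<^esub> y)"
      using c a(1,2) by (simp add: smult_r_distr smult_assoc1)
    finally show ?thesis by (intro mfrac_eqI[of _ _ _ _ "u \<otimes> v"]) (use c a u v S_mult in auto)
  qed
  have "{mfr (t' \<odot>\<^bsub>M\<^esub> x' \<oplus>\<^bsub>M\<^esub> s' \<odot>\<^bsub>M\<^esub> y') (s' \<otimes> t') | x' s' y' t'. (x', s') \<in> mfr x s \<and> (y', t') \<in> mfr y t} =
      {mfr (t \<odot>\<^bsub>M\<^esub> x \<oplus>\<^bsub>M\<^esub> s \<odot>\<^bsub>M\<^esub> y) (s \<otimes> t)}"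
    using eq mfrac_refl a by blast
  then show ?thesis by (simp add: loc_module_def)
qed

lemma mfrac_smult:
  assumes a: "a \<in> carrier R" "y \<in> carrier M" "s \<in> S" "t \<in> S"
  shows "fr a s \<odot>\<^bsub>LM\<^esub> mfr y t = mfr (a \<odot>\<^bsub>M\<^esub> y) (s \<otimes> t)"
proof -
  have eq: "mfr (a' \<odot>\<^bsub>M\<^esub> y') (s' \<otimes> t') = mfr (a \<odot>\<^bsub>M\<^esub> y) (s \<otimes> t)"
    if m: "(a', s') \<in> fr a s" "(y', t') \<in> mfr y t" for a' s' y' t'
  proof -
    obtain u where u: "a' \<in> carrier R" "s' \<in> S" "u \<in> S" "u \<otimes> s' \<otimes> a = u \<otimes> s \<otimes> a'" using m by (auto simp: frac_mem_iff)
    obtain v where v: "y' \<in> carrier M" "t' \<in> S" "v \<in> S" "(v \<otimes> t') \<odot>\<^bsub>M\<^esub> y = (v \<otimes> t) \<odot>\<^bsub>M\<^esub> y'" using m by (auto simp: mfrac_mem_iff)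
    note c = a(1) u(1) Sc[OF a(3)] Sc[OF a(4)] Sc[OF u(2)] Sc[OF u(3)] Sc[OF v(2)] Sc[OF v(3)]
    have r: "((u \<otimes> v) \<otimes> (s \<otimes> t)) \<otimes> a' = (u \<otimes> s \<otimes> a') \<otimes> (v \<otimes> t)"
      "((u \<otimes> v) \<otimes> (s' \<otimes> t')) \<otimes> a = (u \<otimes> s' \<otimes> a) \<otimes> (v \<otimes> t')" using c by algebra+
    have "((u \<otimes> v) \<otimes> (s \<otimes> t)) \<odot>\<^bsub>M\<^esub> (a' \<odot>\<^bsub>M\<^esub> y') = (((u \<otimes> v) \<otimes> (s \<otimes> t)) \<otimes> a') \<odot>\<^bsub>M\<^esub> y'"
      using c v(1) by (simp add: smult_assoc1)
    also have "\<dots> = (u \<otimes> s \<otimes> a') \<odot>\<^bsub>M\<^esub> ((v \<otimes> t) \<odot>\<^bsub>M\<^esub> y')" unfolding r using c v(1) by (simp add: smult_assoc1)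
    also have "\<dots> = (((u \<otimes> v) \<otimes> (s' \<otimes> t')) \<otimes> a) \<odot>\<^bsub>M\<^esub> y"
      unfolding r u(4)[symmetric] v(4)[symmetric] using c a(2) by (simp add: smult_assoc1)
    also have "\<dots> = ((u \<otimes> v) \<otimes> (s' \<otimes> t')) \<odot>\<^bsub>M\<^esub> (a \<odot>\<^bsub>M\<^esub> y)" using c a(2) by (simp add: smult_assoc1)
    finally show ?thesis by (intro mfrac_eqI[of _ _ _ _ "u \<otimes> v"]) (use c a u v S_mult in auto)
  qed
  have "{mfr (a' \<odot>\<^bsub>M\<^esub> y') (s' \<otimes> t') | a' s' y' t'. (a', s') \<in> fr a s \<and> (y', t') \<in> mfr y t} =
      {mfr (a \<odot>\<^bsub>M\<^esub> y) (s \<otimes> t)}" (is "?X = _")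
  proof
    show "?X \<subseteq> {mfr (a \<odot>\<^bsub>M\<^esub> y) (s \<otimes> t)}" using eq by auto
    show "{mfr (a \<odot>\<^bsub>M\<^esub> y) (s \<otimes> t)} \<subseteq> ?X" using frac_refl[OF a(1,3)] mfrac_refl[OF a(2,4)] by auto
  qed
  then show ?thesis by (simp add: loc_module_def)
qed

lemma mfrac_zero: "\<zero>\<^bsub>LM\<^esub> = mfr \<zero>\<^bsub>M\<^esub> \<one>"
  by (simp add: loc_module_def)

lemma mfrac_cancel:
  assumes "x \<in> carrier M" "s \<in> S" "t \<in> S"
  shows "mfr (t \<odot>\<^bsub>M\<^esub> x) (t \<otimes> s) = mfr x s"
proof (rule mfrac_eqI[of _ _ _ _ \<one>])
  show "(\<one> \<otimes> s) \<odot>\<^bsub>M\<^esub> (t \<odot>\<^bsub>M\<^esub> x) = (\<one> \<otimes> (t \<otimes> s)) \<odot>\<^bsub>M\<^esub> x"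
    using assms Sc smult_assoc1[of t s x] smult_swap[of s t x] by simp
qed (use assms Sc S_mult S_one in auto)

lemma mfrac_zero_eq: "s \<in> S \<Longrightarrow> mfr \<zero>\<^bsub>M\<^esub> s = mfr \<zero>\<^bsub>M\<^esub> \<one>"
  using mfrac_cancel[of "\<zero>\<^bsub>M\<^esub>" \<one> s] S_one Sc by simp

lemma loc_module_module: "module L LM"
proof (rule moduleI)
  show "cring L" by (rule localization_cring)
  show "abelian_group LM"
  proof (rule abelian_groupI)
    fix p q assume "p \<in> carrier LM" "q \<in> carrier LM"
    then obtain x s y t where e: "x \<in> carrier M" "s \<in> S" "p = mfr x s" "y \<in> carrier M" "t \<in> S" "q = mfr y t"
      by (metis mfrac_cases)
    show "p \<oplus>\<^bsub>LM\<^esub> q \<in> carrier LM" using e Sc S_mult by (auto simp: mfrac_add intro!: mfrac_carr)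
    show "p \<oplus>\<^bsub>LM\<^esub> q = q \<oplus>\<^bsub>LM\<^esub> p" using e Sc R.m_comm[of s t] M.a_comm[of "t \<odot>\<^bsub>M\<^esub> x" "s \<odot>\<^bsub>M\<^esub> y"] by (simp add: mfrac_add)
  next
    show "\<zero>\<^bsub>LM\<^esub> \<in> carrier LM" unfolding mfrac_zero by (rule mfrac_carr[OF M.zero_closed S_one])
  next
    fix p q r assume "p \<in> carrier LM" "q \<in> carrier LM" "r \<in> carrier LM"
    then obtain x s y t z w where e: "x \<in> carrier M" "s \<in> S" "p = mfr x s" "y \<in> carrier M" "t \<in> S" "q = mfr y t"
       "z \<in> carrier M" "w \<in> S" "r = mfr z w" by (metis mfrac_cases)
    note k = Sc[OF e(2)] Sc[OF e(5)] Sc[OF e(8)]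
    have "w \<odot>\<^bsub>M\<^esub> (t \<odot>\<^bsub>M\<^esub> x \<oplus>\<^bsub>M\<^esub> s \<odot>\<^bsub>M\<^esub> y) \<oplus>\<^bsub>M\<^esub> (s \<otimes> t) \<odot>\<^bsub>M\<^esub> z =
        (t \<otimes> w) \<odot>\<^bsub>M\<^esub> x \<oplus>\<^bsub>M\<^esub> s \<odot>\<^bsub>M\<^esub> (w \<odot>\<^bsub>M\<^esub> y \<oplus>\<^bsub>M\<^esub> t \<odot>\<^bsub>M\<^esub> z)"
      using e(1,4,7) k smult_swap[of w t x] smult_swap[of w s y]
      by (simp add: smult_r_distr smult_assoc1 M.a_assoc)
    then show "p \<oplus>\<^bsub>LM\<^esub> q \<oplus>\<^bsub>LM\<^esub> r = p \<oplus>\<^bsub>LM\<^esub> (q \<oplus>\<^bsub>LM\<^esub> r)"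
      using e(1,2,4,5,7,8) k S_mult R.m_assoc[OF k] unfolding e(3,6,9) by (simp add: mfrac_add)
  next
    fix p assume "p \<in> carrier LM"
    then obtain x s where e: "x \<in> carrier M" "s \<in> S" "p = mfr x s" by (metis mfrac_cases)
    show "\<zero>\<^bsub>LM\<^esub> \<oplus>\<^bsub>LM\<^esub> p = p" using e Sc S_one by (simp add: mfrac_zero mfrac_add)
    have "s \<odot>\<^bsub>M\<^esub> (\<ominus>\<^bsub>M\<^esub> x) \<oplus>\<^bsub>M\<^esub> s \<odot>\<^bsub>M\<^esub> x = \<zero>\<^bsub>M\<^esub>"
      using e(1) Sc[OF e(2)] smult_r_distr[of s "\<ominus>\<^bsub>M\<^esub> x" x] by (simp add: M.l_neg)
    then have "mfr (\<ominus>\<^bsub>M\<^esub> x) s \<oplus>\<^bsub>LM\<^esub> p = \<zero>\<^bsub>LM\<^esub>"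
      using e mfrac_zero_eq[OF S_mult[OF e(2) e(2)]] by (simp add: mfrac_zero mfrac_add)
    then show "\<exists>q\<in>carrier LM. q \<oplus>\<^bsub>LM\<^esub> p = \<zero>\<^bsub>LM\<^esub>" using mfrac_carr[of "\<ominus>\<^bsub>M\<^esub> x" s] e by blast
  qed
next
  fix a p assume "a \<in> carrier L" "p \<in> carrier LM"
  then obtain b s x t where e: "b \<in> carrier R" "s \<in> S" "a = fr b s" "x \<in> carrier M" "t \<in> S" "p = mfr x t"
    by (metis frac_cases mfrac_cases)
  then show "a \<odot>\<^bsub>LM\<^esub> p \<in> carrier LM" using S_mult by (auto simp: mfrac_smult intro!: mfrac_carr)
next
  fix a b p assume "a \<in> carrier L" "b \<in> carrier L" "p \<in> carrier LM"
  then obtain c s d t x w where e: "c \<in> carrier R" "s \<in> S" "a = fr c s" "d \<in> carrier R" "t \<in> S" "b = fr d t"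
      "x \<in> carrier M" "w \<in> S" "p = mfr x w"
    by (metis frac_cases mfrac_cases)
  note k = Sc[OF e(2)] Sc[OF e(5)] Sc[OF e(8)]
  have r: "(t \<otimes> w) \<otimes> c = w \<otimes> (t \<otimes> c)" "(s \<otimes> w) \<otimes> d = w \<otimes> (s \<otimes> d)" "(s \<otimes> w) \<otimes> (t \<otimes> w) = w \<otimes> (s \<otimes> t \<otimes> w)"
    using k e(1,4) by algebra+
  have "(t \<otimes> w) \<odot>\<^bsub>M\<^esub> (c \<odot>\<^bsub>M\<^esub> x) \<oplus>\<^bsub>M\<^esub> (s \<otimes> w) \<odot>\<^bsub>M\<^esub> (d \<odot>\<^bsub>M\<^esub> x) = ((t \<otimes> w) \<otimes> c) \<odot>\<^bsub>M\<^esub> x \<oplus>\<^bsub>M\<^esub> ((s \<otimes> w) \<otimes> d) \<odot>\<^bsub>M\<^esub> x"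
    using k e(1,4,7) by (simp add: smult_assoc1)
  also have "\<dots> = w \<odot>\<^bsub>M\<^esub> ((t \<otimes> c \<oplus> s \<otimes> d) \<odot>\<^bsub>M\<^esub> x)"
    unfolding r using k e(1,4,7) by (simp add: smult_l_distr smult_r_distr smult_assoc1)
  finally have m: "(t \<otimes> w) \<odot>\<^bsub>M\<^esub> (c \<odot>\<^bsub>M\<^esub> x) \<oplus>\<^bsub>M\<^esub> (s \<otimes> w) \<odot>\<^bsub>M\<^esub> (d \<odot>\<^bsub>M\<^esub> x) = w \<odot>\<^bsub>M\<^esub> ((t \<otimes> c \<oplus> s \<otimes> d) \<odot>\<^bsub>M\<^esub> x)" .
  have "a \<odot>\<^bsub>LM\<^esub> p \<oplus>\<^bsub>LM\<^esub> b \<odot>\<^bsub>LM\<^esub> p = mfr (w \<odot>\<^bsub>M\<^esub> ((t \<otimes> c \<oplus> s \<otimes> d) \<odot>\<^bsub>M\<^esub> x)) (w \<otimes> (s \<otimes> t \<otimes> w))"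
    unfolding m[symmetric] r(3)[symmetric] e(3,6,9) using e(1,2,4,5,7,8) k S_mult by (simp add: mfrac_smult mfrac_add)
  also have "\<dots> = mfr ((t \<otimes> c \<oplus> s \<otimes> d) \<odot>\<^bsub>M\<^esub> x) (s \<otimes> t \<otimes> w)"
    by (rule mfrac_cancel) (use e(1,2,4,5,7,8) k S_mult in auto)
  finally show "(a \<oplus>\<^bsub>L\<^esub> b) \<odot>\<^bsub>LM\<^esub> p = a \<odot>\<^bsub>LM\<^esub> p \<oplus>\<^bsub>LM\<^esub> b \<odot>\<^bsub>LM\<^esub> p"
    unfolding e(3,6,9) using e(1,2,4,5,7,8) k S_mult by (simp add: mfrac_smult frac_add)
next
  fix a p q assume "a \<in> carrier L" "p \<in> carrier LM" "q \<in> carrier LM"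
  then obtain c s x t y w where e: "c \<in> carrier R" "s \<in> S" "a = fr c s" "x \<in> carrier M" "t \<in> S" "p = mfr x t"
      "y \<in> carrier M" "w \<in> S" "q = mfr y w"
    by (metis frac_cases mfrac_cases)
  note k = Sc[OF e(2)] Sc[OF e(5)] Sc[OF e(8)]
  have r: "(s \<otimes> w) \<otimes> c = (s \<otimes> c) \<otimes> w" "(s \<otimes> t) \<otimes> c = (s \<otimes> c) \<otimes> t" "(s \<otimes> t) \<otimes> (s \<otimes> w) = s \<otimes> (s \<otimes> (t \<otimes> w))"
    using k e(1) by algebra+
  have "(s \<otimes> w) \<odot>\<^bsub>M\<^esub> (c \<odot>\<^bsub>M\<^esub> x) \<oplus>\<^bsub>M\<^esub> (s \<otimes> t) \<odot>\<^bsub>M\<^esub> (c \<odot>\<^bsub>M\<^esub> y) = ((s \<otimes> w) \<otimes> c) \<odot>\<^bsub>M\<^esub> x \<oplus>\<^bsub>M\<^esub> ((s \<otimes> t) \<otimes> c) \<odot>\<^bsub>M\<^esub> y"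
    using k e(1,4,7) by (simp add: smult_assoc1)
  also have "\<dots> = s \<odot>\<^bsub>M\<^esub> (c \<odot>\<^bsub>M\<^esub> (w \<odot>\<^bsub>M\<^esub> x \<oplus>\<^bsub>M\<^esub> t \<odot>\<^bsub>M\<^esub> y))"
    unfolding r using k e(1,4,7) by (simp add: smult_r_distr smult_assoc1)
  finally have m: "(s \<otimes> w) \<odot>\<^bsub>M\<^esub> (c \<odot>\<^bsub>M\<^esub> x) \<oplus>\<^bsub>M\<^esub> (s \<otimes> t) \<odot>\<^bsub>M\<^esub> (c \<odot>\<^bsub>M\<^esub> y) = s \<odot>\<^bsub>M\<^esub> (c \<odot>\<^bsub>M\<^esub> (w \<odot>\<^bsub>M\<^esub> x \<oplus>\<^bsub>M\<^esub> t \<odot>\<^bsub>M\<^esub> y))" .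
  have "a \<odot>\<^bsub>LM\<^esub> p \<oplus>\<^bsub>LM\<^esub> a \<odot>\<^bsub>LM\<^esub> q = mfr (s \<odot>\<^bsub>M\<^esub> (c \<odot>\<^bsub>M\<^esub> (w \<odot>\<^bsub>M\<^esub> x \<oplus>\<^bsub>M\<^esub> t \<odot>\<^bsub>M\<^esub> y))) (s \<otimes> (s \<otimes> (t \<otimes> w)))"
    unfolding m[symmetric] r(3)[symmetric] e(3,6,9) using e(1,2,4,5,7,8) k S_mult by (simp add: mfrac_smult mfrac_add)
  also have "\<dots> = mfr (c \<odot>\<^bsub>M\<^esub> (w \<odot>\<^bsub>M\<^esub> x \<oplus>\<^bsub>M\<^esub> t \<odot>\<^bsub>M\<^esub> y)) (s \<otimes> (t \<otimes> w))"
    by (rule mfrac_cancel) (use e(1,2,4,5,7,8) k S_mult in auto)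
  finally show "a \<odot>\<^bsub>LM\<^esub> (p \<oplus>\<^bsub>LM\<^esub> q) = a \<odot>\<^bsub>LM\<^esub> p \<oplus>\<^bsub>LM\<^esub> a \<odot>\<^bsub>LM\<^esub> q"
    unfolding e(3,6,9) using e(1,2,4,5,7,8) k S_mult by (simp add: mfrac_smult mfrac_add)
next
  fix a b p assume "a \<in> carrier L" "b \<in> carrier L" "p \<in> carrier LM"
  then obtain c s d t x w where e: "c \<in> carrier R" "s \<in> S" "a = fr c s" "d \<in> carrier R" "t \<in> S" "b = fr d t"
      "x \<in> carrier M" "w \<in> S" "p = mfr x w"
    by (metis frac_cases mfrac_cases)
  then show "(a \<otimes>\<^bsub>L\<^esub> b) \<odot>\<^bsub>LM\<^esub> p = a \<odot>\<^bsub>LM\<^esub> (b \<odot>\<^bsub>LM\<^esub> p)"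
    using Sc S_mult by (simp add: frac_mult mfrac_smult smult_assoc1 R.m_assoc)
next
  fix p assume "p \<in> carrier LM"
  then obtain x s where e: "x \<in> carrier M" "s \<in> S" "p = mfr x s" by (metis mfrac_cases)
  then show "\<one>\<^bsub>L\<^esub> \<odot>\<^bsub>LM\<^esub> p = p" using Sc S_one by (simp add: frac_one mfrac_smult)
qed

end

section \<open>Graded components\<close>

context cring
begin

lemma gr_coset_eq_iff:
  assumes J: "ideal J R" and "x \<in> carrier R" "y \<in> carrier R"
  shows "ideal_pow R J n +> x = ideal_pow R J n +> y \<longleftrightarrow> x \<ominus> y \<in> ideal_pow R J n"
  using quotient_eq_iff_same_a_r_cos[OF ideal_pow_ideal[OF J] assms(2,3)] by simp

lemma gr_carr: "x \<in> ideal_pow R J n \<Longrightarrow> ideal_pow R J (Suc n) +> x \<in> carrier (gr_component R J n)"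
  by (auto simp: gr_component_def)

lemma gr_cases:
  assumes "y \<in> carrier (gr_component R J n)"
  obtains x where "x \<in> ideal_pow R J n" "y = ideal_pow R J (Suc n) +> x"
  using assms by (auto simp: gr_component_def)

lemma gr_add:
  assumes J: "ideal J R" and x: "x \<in> ideal_pow R J n" and y: "y \<in> ideal_pow R J n"
  shows "(ideal_pow R J (Suc n) +> x) \<oplus>\<^bsub>gr_component R J n\<^esub> (ideal_pow R J (Suc n) +> y) = ideal_pow R J (Suc n) +> (x \<oplus> y)"
  unfolding gr_component_def
  using ideal.a_rcos_sum[OF ideal_pow_ideal[OF J, of "Suc n"]] ideal_carr[OF ideal_pow_ideal[OF J]] x y by simp

text \<open>The product does not depend on the representatives, because \<open>J J\<^sup>n = J\<^sup>n\<^sup>+\<^sup>1\<close>.\<close>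

lemma gr_smult:
  assumes J: "ideal J R" and a: "a \<in> carrier R" and x: "x \<in> ideal_pow R J n"
  shows "(J +> a) \<odot>\<^bsub>gr_component R J n\<^esub> (ideal_pow R J (Suc n) +> x) = ideal_pow R J (Suc n) +> (a \<otimes> x)"
proof -
  let ?q = "ideal_pow R J (Suc n)"
  note qi = ideal_pow_ideal[OF J, of "Suc n"] and pi = ideal_pow_ideal[OF J, of n]
  have xc: "x \<in> carrier R" by (rule ideal_carr[OF pi x])
  have eq: "?q +> (a' \<otimes> x') = ?q +> (a \<otimes> x)" if m: "a' \<in> J +> a" "x' \<in> ?q +> x" for a' x'
  proof -
    obtain j z where e: "j \<in> J" "a' = j \<oplus> a" "z \<in> ?q" "x' = z \<oplus> x" using m unfolding a_r_coset_def' by blast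
    have c: "j \<in> carrier R" "z \<in> carrier R" using ideal_carr[OF J e(1)] ideal_carr[OF qi e(3)] .
    have "a' \<otimes> x' \<ominus> a \<otimes> x = (j \<oplus> a) \<otimes> z \<oplus> j \<otimes> x" unfolding e(2,4) using c a xc by algebra
    also have "\<dots> \<in> ?q" using ideal_add[OF qi] ideal_mult[OF qi _ e(3), of "j \<oplus> a"] ideal_pow_mult1[OF e(1) x] c a by blast
    finally have d: "a' \<otimes> x' \<ominus> a \<otimes> x \<in> ?q" .
    have "a' \<otimes> x' \<in> carrier R" "a \<otimes> x \<in> carrier R" using e c a xc by auto
    then show ?thesis using gr_coset_eq_iff[OF J, of "a' \<otimes> x'" "a \<otimes> x" "Suc n"] d by blast
  qed
  interpret J: ideal J R by (rule J)
  interpret q: ideal ?q R by (rule qi)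
  have ne: "a \<in> J +> a" "x \<in> ?q +> x" using J.a_rcos_self[OF a] q.a_rcos_self[OF xc] .
  have "(\<Union>a'\<in>J +> a. \<Union>x'\<in>?q +> x. ?q +> (a' \<otimes> x')) = ?q +> (a \<otimes> x)"
    using eq ne by blast
  then show ?thesis by (simp add: gr_component_def)
qed

lemma gr_zero:
  assumes J: "ideal J R" shows "\<zero>\<^bsub>gr_component R J n\<^esub> = ideal_pow R J (Suc n) +> \<zero>"
proof -
  interpret q: ideal "ideal_pow R J (Suc n)" R by (rule ideal_pow_ideal[OF J])
  have "ideal_pow R J (Suc n) +> \<zero> = ideal_pow R J (Suc n)" by (rule q.a_rcos_const) (rule ideal_zero[OF q.is_ideal])
  then show ?thesis by (simp add: gr_component_def)
qed

lemma gr_zero_iff: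
  assumes J: "ideal J R" and x: "x \<in> ideal_pow R J n"
  shows "ideal_pow R J (Suc n) +> x = \<zero>\<^bsub>gr_component R J n\<^esub> \<longleftrightarrow> x \<in> ideal_pow R J (Suc n)"
proof -
  have xc: "x \<in> carrier R" by (rule ideal_carr[OF ideal_pow_ideal[OF J] x])
  then have "x \<ominus> \<zero> = x" by (simp add: minus_eq)
  then show ?thesis unfolding gr_zero[OF J] gr_coset_eq_iff[OF J xc zero_closed] by (simp only:)
qed

lemma quot_cases:
  assumes "a \<in> carrier (R Quot J)" obtains r where "r \<in> carrier R" "a = J +> r"
  using assms by (auto simp: FactRing_def A_RCOSETS_def')

lemma gr_module:
  assumes J: "ideal J R" shows "module (R Quot J) (gr_component R J n)"
proof -
  interpret J: ideal J R by (rule J)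
  let ?G = "gr_component R J n" and ?C = "\<lambda>x. ideal_pow R J (Suc n) +> x"
  note pi = ideal_pow_ideal[OF J, of n]
  note pc = ideal_carr[OF pi]
  have hom: "J +> (r \<oplus> s) = (J +> r) \<oplus>\<^bsub>R Quot J\<^esub> (J +> s)" "J +> (r \<otimes> s) = (J +> r) \<otimes>\<^bsub>R Quot J\<^esub> (J +> s)"
    if "r \<in> carrier R" "s \<in> carrier R" for r s
    using ring_hom_add[OF J.rcos_ring_hom that] ring_hom_mult[OF J.rcos_ring_hom that] .
  show ?thesis
  proof (rule moduleI)
    show "cring (R Quot J)" by (rule J.quotient_is_cring[OF is_cring])
    show "abelian_group ?G"
    proof (rule abelian_groupI)
      fix u v assume "u \<in> carrier ?G" "v \<in> carrier ?G"
      then obtain x y where e: "x \<in> ideal_pow R J n" "u = ?C x" "y \<in> ideal_pow R J n" "v = ?C y" by (metis gr_cases)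
      show "u \<oplus>\<^bsub>?G\<^esub> v \<in> carrier ?G" unfolding e(2,4) gr_add[OF J e(1,3)] by (rule gr_carr[OF ideal_add[OF pi e(1,3)]])
      show "u \<oplus>\<^bsub>?G\<^esub> v = v \<oplus>\<^bsub>?G\<^esub> u"
        unfolding e(2,4) gr_add[OF J e(1,3)] gr_add[OF J e(3,1)] a_comm[OF pc[OF e(1)] pc[OF e(3)]] ..
    next
      show "\<zero>\<^bsub>?G\<^esub> \<in> carrier ?G" unfolding gr_zero[OF J] by (rule gr_carr[OF ideal_zero[OF pi]])
    next
      fix u v w assume "u \<in> carrier ?G" "v \<in> carrier ?G" "w \<in> carrier ?G"
      then obtain x y z where e: "x \<in> ideal_pow R J n" "u = ?C x" "y \<in> ideal_pow R J n" "v = ?C y"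
        "z \<in> ideal_pow R J n" "w = ?C z" by (metis gr_cases)
      show "u \<oplus>\<^bsub>?G\<^esub> v \<oplus>\<^bsub>?G\<^esub> w = u \<oplus>\<^bsub>?G\<^esub> (v \<oplus>\<^bsub>?G\<^esub> w)"
        unfolding e(2,4,6) gr_add[OF J e(1,3)] gr_add[OF J e(3,5)] gr_add[OF J ideal_add[OF pi e(1,3)] e(5)]
          gr_add[OF J e(1) ideal_add[OF pi e(3,5)]] a_assoc[OF pc[OF e(1)] pc[OF e(3)] pc[OF e(5)]] ..
    next
      fix u assume "u \<in> carrier ?G"
      then obtain x where e: "x \<in> ideal_pow R J n" "u = ?C x" by (metis gr_cases)
      note xc = pc[OF e(1)]
      show "\<zero>\<^bsub>?G\<^esub> \<oplus>\<^bsub>?G\<^esub> u = u"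
        unfolding e(2) gr_zero[OF J] gr_add[OF J ideal_zero[OF pi] e(1)] using xc by simp
      have m: "\<ominus> x \<in> ideal_pow R J n" using ideal_minus[OF pi ideal_zero[OF pi] e(1)] xc by (simp add: minus_eq)
      have "?C (\<ominus> x) \<oplus>\<^bsub>?G\<^esub> u = \<zero>\<^bsub>?G\<^esub>"
        unfolding e(2) gr_zero[OF J] gr_add[OF J m e(1)] using xc by (simp add: l_neg)
      then show "\<exists>v\<in>carrier ?G. v \<oplus>\<^bsub>?G\<^esub> u = \<zero>\<^bsub>?G\<^esub>" using gr_carr[OF m] by blast
    qed
  next
    fix a u assume "a \<in> carrier (R Quot J)" "u \<in> carrier ?G"
    then obtain r x where e: "r \<in> carrier R" "a = J +> r" "x \<in> ideal_pow R J n" "u = ?C x" by (metis gr_cases quot_cases)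
    show "a \<odot>\<^bsub>?G\<^esub> u \<in> carrier ?G" unfolding e(2,4) gr_smult[OF J e(1,3)] by (rule gr_carr[OF ideal_mult[OF pi e(1,3)]])
  next
    fix a b u assume "a \<in> carrier (R Quot J)" "b \<in> carrier (R Quot J)" "u \<in> carrier ?G"
    then obtain r s x where e: "r \<in> carrier R" "a = J +> r" "s \<in> carrier R" "b = J +> s" "x \<in> ideal_pow R J n" "u = ?C x"
      by (metis gr_cases quot_cases)
    have c: "r \<oplus> s \<in> carrier R" "r \<otimes> s \<in> carrier R" using e by auto
    show "(a \<oplus>\<^bsub>R Quot J\<^esub> b) \<odot>\<^bsub>?G\<^esub> u = a \<odot>\<^bsub>?G\<^esub> u \<oplus>\<^bsub>?G\<^esub> b \<odot>\<^bsub>?G\<^esub> u"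
      unfolding e(2,4,6) hom(1)[OF e(1,3), symmetric] gr_smult[OF J c(1) e(5)] gr_smult[OF J e(1,5)] gr_smult[OF J e(3,5)]
        gr_add[OF J ideal_mult[OF pi e(1,5)] ideal_mult[OF pi e(3,5)]] l_distr[OF e(1,3) pc[OF e(5)]] ..
    show "(a \<otimes>\<^bsub>R Quot J\<^esub> b) \<odot>\<^bsub>?G\<^esub> u = a \<odot>\<^bsub>?G\<^esub> (b \<odot>\<^bsub>?G\<^esub> u)"
      unfolding e(2,4,6) hom(2)[OF e(1,3), symmetric] gr_smult[OF J c(2) e(5)] gr_smult[OF J e(3,5)]
        gr_smult[OF J e(1) ideal_mult[OF pi e(3,5)]] m_assoc[OF e(1,3) pc[OF e(5)]] ..
  next
    fix a u v assume "a \<in> carrier (R Quot J)" "u \<in> carrier ?G" "v \<in> carrier ?G"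
    then obtain r x y where e: "r \<in> carrier R" "a = J +> r" "x \<in> ideal_pow R J n" "u = ?C x" "y \<in> ideal_pow R J n" "v = ?C y"
      by (metis gr_cases quot_cases)
    show "a \<odot>\<^bsub>?G\<^esub> (u \<oplus>\<^bsub>?G\<^esub> v) = a \<odot>\<^bsub>?G\<^esub> u \<oplus>\<^bsub>?G\<^esub> a \<odot>\<^bsub>?G\<^esub> v"
      unfolding e(2,4,6) gr_add[OF J e(3,5)] gr_smult[OF J e(1,3)] gr_smult[OF J e(1,5)] gr_smult[OF J e(1) ideal_add[OF pi e(3,5)]]
        gr_add[OF J ideal_mult[OF pi e(1,3)] ideal_mult[OF pi e(1,5)]] r_distr[OF pc[OF e(3)] pc[OF e(5)] e(1)] ..
  next
    fix u assume "u \<in> carrier ?G"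
    then obtain x where e: "x \<in> ideal_pow R J n" "u = ?C x" by (metis gr_cases)
    have "\<one>\<^bsub>R Quot J\<^esub> = J +> \<one>" by (rule ring_hom_one[OF J.rcos_ring_hom, symmetric])
    then show "\<one>\<^bsub>R Quot J\<^esub> \<odot>\<^bsub>?G\<^esub> u = u"
      unfolding e(2) using gr_smult[OF J one_closed e(1)] pc[OF e(1)] by simp
  qed
qed

end

lemma (in noeth_cring) gr_fg_module:
  assumes J: "ideal J R" shows "fg_module (R Quot J) (gr_component R J n)"
proof -
  interpret G: module "R Quot J" "gr_component R J n" by (rule gr_module[OF J])
  let ?G = "gr_component R J n" and ?C = "\<lambda>x. ideal_pow R J (Suc n) +> x"
  note pi = ideal_pow_ideal[OF J, of n]
  obtain A where A: "A \<subseteq> carrier R" "finite A" "ideal_pow R J n = Idl A" using finetely_gen[OF pi] by blast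
  have Ap: "A \<subseteq> ideal_pow R J n" using genideal_self[OF A(1)] A(3) by simp
  have Tc: "?C ` A \<subseteq> carrier ?G" using Ap gr_carr by blast
  have "submod_gen (R Quot J) ?G (?C ` A) = carrier ?G"
  proof
    show "submod_gen (R Quot J) ?G (?C ` A) \<subseteq> carrier ?G" by (rule G.submod_gen_minimal[OF G.carrier_is_submodule Tc])
    let ?N = "submod_gen (R Quot J) ?G (?C ` A)"
    have N: "submodule ?N (R Quot J) ?G" by (rule G.submod_gen_submodule[OF Tc])
    have K: "ideal {x \<in> ideal_pow R J n. ?C x \<in> ?N} R"
    proof (rule ideal_of_closure)
      show "{x \<in> ideal_pow R J n. ?C x \<in> ?N} \<subseteq> carrier R" using ideal_carr[OF pi] by blast
      show "\<zero> \<in> {x \<in> ideal_pow R J n. ?C x \<in> ?N}"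
        using G.submodule_zero[OF N] unfolding gr_zero[OF J] using ideal_zero[OF pi] by blast
      fix x y assume "x \<in> {x \<in> ideal_pow R J n. ?C x \<in> ?N}" "y \<in> {x \<in> ideal_pow R J n. ?C x \<in> ?N}"
      then have xy: "x \<in> ideal_pow R J n" "?C x \<in> ?N" "y \<in> ideal_pow R J n" "?C y \<in> ?N" by blast+
      have "?C (x \<oplus> y) \<in> ?N" using G.submoduleE(5)[OF N xy(2,4)] unfolding gr_add[OF J xy(1,3)] .
      then show "x \<oplus> y \<in> {x \<in> ideal_pow R J n. ?C x \<in> ?N}" using ideal_add[OF pi xy(1,3)] by blast
    next
      fix r x assume r: "r \<in> carrier R" and "x \<in> {x \<in> ideal_pow R J n. ?C x \<in> ?N}"
      then have x: "x \<in> ideal_pow R J n" "?C x \<in> ?N" by blast+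
      have "J +> r \<in> carrier (R Quot J)" using quot_frac_hom(2)[OF J] r by blast
      then have "?C (r \<otimes> x) \<in> ?N" using G.submoduleE(4)[OF N _ x(2)] gr_smult[OF J r x(1)] by metis
      then show "r \<otimes> x \<in> {x \<in> ideal_pow R J n. ?C x \<in> ?N}" using ideal_mult[OF pi r x(1)] by blast
    qed
    have "A \<subseteq> {x \<in> ideal_pow R J n. ?C x \<in> ?N}" using Ap G.submod_gen_incl[of "?C ` A"] by blast
    then have "ideal_pow R J n \<subseteq> {x \<in> ideal_pow R J n. ?C x \<in> ?N}" unfolding A(3) by (rule genideal_minimal[OF K, unfolded A(3)])
    then show "carrier ?G \<subseteq> ?N" by (auto elim!: gr_cases)
  qed
  then show ?thesis unfolding fg_module_def using G.module_axioms Tc A(2) gr_module[OF J] by blast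
qed

section \<open>The Cohen-Macaulay locus of the associated graded ring\<close>

lemma (in cring) mult_set_powers:
  assumes "f \<in> carrier R" shows "mult_set R (powers R f)"
proof
  show "powers R f \<subseteq> carrier R" using assms by (auto simp: powers_def)
  show "\<one> \<in> powers R f" by (auto simp: powers_def intro!: exI[of _ "0::nat"])
  show "s \<otimes> t \<in> powers R f" if "s \<in> powers R f" "t \<in> powers R f" for s t
    using that nat_pow_mult[OF assms] by (auto simp: powers_def)
qed

text \<open>A prime of \<open>R\<^sub>f/I\<^sub>f\<close> contracts to a prime \<open>Q\<close> of \<open>R\<close> with \<open>I \<subseteq> Q\<close> and \<open>f \<notin> Q\<close>, and the localization there of the
  \<open>n\<close>-th graded component is that of \<open>I\<^sup>n/I\<^sup>n\<^sup>+\<^sup>1\<close> at \<open>Q\<close>.\<close>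

theorem (in noeth_cring) gr_cohen_macaulay_away_from:
  assumes I: "ideal I R" and f: "f \<in> carrier R"
    and good: "\<And>Q. primeideal Q R \<Longrightarrow> I \<subseteq> Q \<Longrightarrow> f \<notin> Q \<Longrightarrow>
      \<exists>as. set as \<subseteq> Q \<and> (\<forall>n. loc_regular Q (ideal_pow R I (Suc n)) (ideal_pow R I n) as) \<and>
        (\<forall>Ps. prime_chain R Ps \<longrightarrow> I \<subseteq> hd Ps \<longrightarrow> last Ps \<subseteq> Q \<longrightarrow> length Ps \<le> length as + 1)"
  shows "gr_cohen_macaulay (localization R (powers R f)) (loc_ideal R (powers R f) I)"
  unfolding gr_cohen_macaulay_def
proof
  fix n
  let ?S = "powers R f"
  interpret S: mult_set R ?S by (rule mult_set_powers[OF f])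
  define B where "B = localization R ?S"
  define g1 where "g1 = loc_map R ?S"
  interpret F: frac_hom R B g1 unfolding B_def g1_def by (rule S.frac_hom_loc_map)
  define J where "J = loc_ideal R ?S I"
  have JF: "J = F.ext I" unfolding J_def loc_ideal_def using F.genideal_image[OF I] by (simp add: B_def g1_def)
  have Bn: "noeth_cring B" by (rule F.noetherian_target[OF noetherian_ring_axioms])
  have J: "ideal J B" unfolding JF by (rule F.ideal_ext[OF I])
  have Jpow: "ideal_pow B J k = F.ext (ideal_pow R I k)" for k unfolding JF by (rule F.ideal_pow_ext[OF I])
  define A where "A = B Quot J"
  define g where "g r = J +>\<^bsub>B\<^esub> g1 r" for r
  interpret q: frac_hom B A "a_r_coset B J" unfolding A_def by (rule F.S.quot_frac_hom(1)[OF J])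
  interpret G: frac_hom R A g unfolding g_def by (rule frac_hom_comp[OF F.frac_hom_axioms q.frac_hom_axioms])
  define M where "M = gr_component B J n"
  interpret M: module A M unfolding A_def M_def by (rule F.S.gr_module[OF J])
  let ?C = "\<lambda>x. ideal_pow B J (Suc n) +>\<^bsub>B\<^esub> x"
  note pI = ideal_pow_ideal[OF I]
  have g1_pow: "g1 u \<in> ideal_pow B J k" if "u \<in> ideal_pow R I k" for u k
    unfolding Jpow by (rule F.hom_in_ext[OF ideal_carr[OF pI that] that])
  have nB: "noetherian_ring B" using Bn by (simp add: noeth_cring_def)
  have nA: "noetherian_ring A" using q.noetherian_target[OF nB] by (simp add: noeth_cring_def)
  have unitg: "g s \<in> Units A" if "g1 s \<in> Units B" for s unfolding g_def by (rule q.hom_Units[OF that])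
  have gI: "g r = \<zero>\<^bsub>A\<^esub>" if r: "r \<in> I" for r
  proof -
    have rc: "r \<in> carrier R" by (rule ideal_carr[OF I r])
    have "g1 r \<in> J" unfolding JF by (rule F.hom_in_ext[OF rc r])
    then show ?thesis unfolding g_def A_def using F.S.quot_zero_iff[OF J, of "g1 r"] rc by simp
  qed
  have smultC: "g r \<odot>\<^bsub>M\<^esub> ?C x = ?C (g1 r \<otimes>\<^bsub>B\<^esub> x)" if "r \<in> carrier R" "x \<in> ideal_pow B J n" for r x
    unfolding g_def M_def by (rule F.S.gr_smult[OF J _ that(2)]) (use that(1) in simp)
  have Cc: "?C x \<in> carrier M" if "x \<in> ideal_pow B J n" for x unfolding M_def by (rule F.S.gr_carr[OF that])
  have "depth (local_at A p) (local_max A p) (loc_module A (carrier A - p) M) = module_dim (local_at A p) (loc_module A (carrier A - p) M)"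
    if p: "primeideal p A" and nz: "carrier (loc_module A (carrier A - p) M) \<noteq> {\<zero>\<^bsub>loc_module A (carrier A - p) M\<^esub>}" for p
  proof -
    interpret N: mult_set A "carrier A - p" by (rule q.S.mult_set_prime_compl[OF p])
    interpret MM: mult_module A M "carrier A - p" by unfold_locales
    define l where "l = loc_map A (carrier A - p)"
    interpret Z: frac_local A "local_at A p" l p unfolding l_def by (rule q.S.frac_local_local_at[OF p])
    define Q where "Q = {r \<in> carrier R. g r \<in> p}"
    interpret H: frac_local R "local_at A p" "\<lambda>r. l (g r)" Q
      unfolding Q_def by (rule frac_local_comp[OF G.frac_hom_axioms Z.frac_local_axioms])
    note Q = H.Q_prime
    note pA = q.S.prime_ideal[OF p]
    have unit_notin: "s \<notin> Q" if "s \<in> carrier R" "g s \<in> Units A" for s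
      using q.S.unit_notin_prime[OF p that(2)] by (simp add: Q_def)
    have IQ: "I \<subseteq> Q" unfolding Q_def using gI q.S.ideal_zero[OF pA] ideal_carr[OF I] by auto
    have fS: "f [^] m \<in> ?S" for m :: nat by (auto simp: powers_def)
    have "f \<in> ?S" using fS[of 1] f by simp
    then have fQ: "f \<notin> Q" using unit_notin[OF f] unitg S.loc_map_unit unfolding B_def g1_def by blast
    obtain as where as: "set as \<subseteq> Q" "\<forall>n. loc_regular Q (ideal_pow R I (Suc n)) (ideal_pow R I n) as"
        "\<And>Ps. prime_chain R Ps \<Longrightarrow> I \<subseteq> hd Ps \<Longrightarrow> last Ps \<subseteq> Q \<Longrightarrow> length Ps \<le> length as + 1"
      using good[OF Q IQ fQ] by blast
    define k where "k u = loc_mfrac A (carrier A - p) M (?C (g1 u)) \<one>\<^bsub>A\<^esub>" for u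
    note N1 = N.S_one
    have "depth (local_at A p) (H.ext Q) (MM.LM) = module_dim (local_at A p) (MM.LM)"
    proof (rule H.depth_eq_dim_criterion[where U = "ideal_pow R I n" and V = "ideal_pow R I (Suc n)" and k = k and I = I and as = as])
      show "noetherian_ring R" by (rule noetherian_ring_axioms)
      show "module (local_at A p) (MM.LM)" by (rule MM.loc_module_module)
      show "ideal (ideal_pow R I n) R" "ideal (ideal_pow R I (Suc n)) R" by (rule pI)+
      show "ideal_pow R I (Suc n) \<subseteq> ideal_pow R I n" by (rule ideal_pow_Suc_subset[OF I])
      show "set as \<subseteq> Q" "loc_regular Q (ideal_pow R I (Suc n)) (ideal_pow R I n) as" using as by auto
      show "carrier (MM.LM) \<noteq> {\<zero>\<^bsub>MM.LM\<^esub>}" by (rule nz)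
      show "r \<in> carrier R \<and> l (g r) = \<zero>\<^bsub>local_at A p\<^esub>" if "r \<in> I" for r
        using ideal_carr[OF I that] gI[OF that] Z.hom_zero by simp
      show "length Ps \<le> length as + 1" if "prime_chain R Ps" "I \<subseteq> hd Ps" "last Ps \<subseteq> Q" for Ps
        using as(3)[OF that] .
      show "k u \<in> carrier (MM.LM)" if "u \<in> ideal_pow R I n" for u
        unfolding k_def by (rule MM.mfrac_carr[OF Cc[OF g1_pow[OF that]] N1])
      show "k (u \<oplus> v) = k u \<oplus>\<^bsub>MM.LM\<^esub> k v"
        if u: "u \<in> ideal_pow R I n" and v: "v \<in> ideal_pow R I n" for u v
      proof -
        note Cu = Cc[OF g1_pow[OF u]] and Cv = Cc[OF g1_pow[OF v]]
        have "?C (g1 (u \<oplus> v)) = ?C (g1 u) \<oplus>\<^bsub>M\<^esub> ?C (g1 v)"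
          unfolding M_def F.S.gr_add[OF J g1_pow[OF u] g1_pow[OF v]] using ideal_carr[OF pI u] ideal_carr[OF pI v] by simp
        then show ?thesis unfolding k_def MM.mfrac_add[OF Cu Cv N1 N1] using Cu Cv by simp
      qed
      have k_smult: "k (r \<otimes> u) = l (g r) \<odot>\<^bsub>MM.LM\<^esub> k u"
        if r: "r \<in> carrier R" and u: "u \<in> ideal_pow R I n" for r u
      proof -
        note Cu = Cc[OF g1_pow[OF u]]
        have gr: "g r \<in> carrier A" using r by simp
        have "?C (g1 (r \<otimes> u)) = g r \<odot>\<^bsub>M\<^esub> ?C (g1 u)"
          unfolding smultC[OF r g1_pow[OF u]] using r ideal_carr[OF pI u] by simp
        then show ?thesis unfolding k_def l_def loc_map_def MM.mfrac_smult[OF gr Cu N1 N1] by simp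
      qed
      then show "\<And>r u. r \<in> carrier R \<Longrightarrow> u \<in> ideal_pow R I n \<Longrightarrow> k (r \<otimes> u) = l (g r) \<odot>\<^bsub>MM.LM\<^esub> k u" .
      show "\<exists>s\<in>carrier R. s \<notin> Q \<and> (\<exists>u\<in>ideal_pow R I n. l (g s) \<odot>\<^bsub>MM.LM\<^esub> y = k u)"
        if y: "y \<in> carrier (MM.LM)" for y
      proof -
        obtain c t where ct: "c \<in> carrier M" "t \<in> carrier A - p" "y = MM.mfr c t" by (rule MM.mfrac_cases[OF y])
        obtain x where x: "x \<in> ideal_pow B J n" "c = ?C x" using F.S.gr_cases ct(1) unfolding M_def by metis
        have "x \<in> F.ext (ideal_pow R I n)" using x(1) unfolding Jpow .
        then obtain u s where us: "x \<in> carrier B" "u \<in> ideal_pow R I n" "s \<in> carrier R" "g1 s \<in> Units B" "x \<otimes>\<^bsub>B\<^esub> g1 s = g1 u"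
          by (auto simp: F.ext_def)
        obtain r' s' where rs: "r' \<in> carrier R" "s' \<in> carrier R" "g s' \<in> Units A" "t \<otimes>\<^bsub>A\<^esub> g s' = g r'"
          using G.frac[of t] ct(2) by blast
        have tc: "t \<in> carrier A" using ct(2) by simp
        have uc: "u \<in> carrier R" by (rule ideal_carr[OF pI us(2)])
        have "g s' \<in> carrier A - p" using unit_notin[OF rs(2,3)] rs(2) by (auto simp: Q_def)
        then have "g r' \<in> carrier A - p" unfolding rs(4)[symmetric] by (rule N.S_mult[OF ct(2)])
        then have r'Q: "r' \<notin> Q" by (simp add: Q_def)
        have sQ: "s \<notin> Q" by (rule unit_notin[OF us(3) unitg[OF us(4)]])
        have srQ: "r' \<otimes> s \<in> carrier R - Q" using prime_compl(2)[OF Q] r'Q sQ rs(1) us(3) by auto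
        have s'u: "s' \<otimes> u \<in> ideal_pow R I n" by (rule ideal_mult[OF pI rs(2) us(2)])
        have gs: "g (r' \<otimes> s) \<in> carrier A" using rs us by simp
        \<comment> \<open>With \<open>x = u/s\<close> and \<open>t = r'/s'\<close>, the fraction \<open>x/t\<close> is \<open>s'u/(r's)\<close>.\<close>
        have "g1 (r' \<otimes> s) \<otimes>\<^bsub>B\<^esub> x = g1 r' \<otimes>\<^bsub>B\<^esub> (x \<otimes>\<^bsub>B\<^esub> g1 s)"
          using rs(1) us(1,3) F.S.m_comm[of "g1 s" x] F.S.m_assoc[of "g1 r'" "g1 s" x] by simp
        then have "g (r' \<otimes> s) \<odot>\<^bsub>M\<^esub> c = ?C (g1 r' \<otimes>\<^bsub>B\<^esub> g1 u)"
          unfolding x(2) us(5) using smultC[OF _ x(1), of "r' \<otimes> s"] rs(1) us(3) by simp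
        also have "\<dots> = g r' \<odot>\<^bsub>M\<^esub> ?C (g1 u)" by (rule smultC[OF rs(1) g1_pow[OF us(2)], symmetric])
        also have "\<dots> = t \<odot>\<^bsub>M\<^esub> (g s' \<odot>\<^bsub>M\<^esub> ?C (g1 u))"
          unfolding rs(4)[symmetric] by (rule M.smult_assoc1[OF tc _ Cc[OF g1_pow[OF us(2)]]]) (use rs(2) in simp)
        also have "g s' \<odot>\<^bsub>M\<^esub> ?C (g1 u) = ?C (g1 (s' \<otimes> u))" unfolding smultC[OF rs(2) g1_pow[OF us(2)]] using rs(2) uc by simp
        finally have e: "g (r' \<otimes> s) \<odot>\<^bsub>M\<^esub> c = t \<odot>\<^bsub>M\<^esub> ?C (g1 (s' \<otimes> u))" .
        have "l (g (r' \<otimes> s)) \<odot>\<^bsub>MM.LM\<^esub> y = MM.mfr (t \<odot>\<^bsub>M\<^esub> ?C (g1 (s' \<otimes> u))) (\<one>\<^bsub>A\<^esub> \<otimes>\<^bsub>A\<^esub> t)"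
          unfolding ct(3) l_def loc_map_def MM.mfrac_smult[OF gs ct(1) N1 ct(2)] e ..
        also have "\<dots> = k (s' \<otimes> u)"
          unfolding k_def using MM.mfrac_cancel[OF Cc[OF g1_pow[OF s'u]] N1 ct(2)] tc by simp
        finally show ?thesis using srQ s'u by blast
      qed
      show "k u = \<zero>\<^bsub>MM.LM\<^esub> \<longleftrightarrow> u \<in> saturate Q (ideal_pow R I (Suc n))"
        if u: "u \<in> ideal_pow R I n" for u
      proof -
        have uc: "u \<in> carrier R" by (rule ideal_carr[OF pI u])
        note Cu = Cc[OF g1_pow[OF u]]
        have ru: "r \<otimes> u \<in> ideal_pow R I n" if "r \<in> carrier R" for r by (rule ideal_mult[OF pI that u])
        have act: "g r \<odot>\<^bsub>M\<^esub> ?C (g1 u) = \<zero>\<^bsub>M\<^esub> \<longleftrightarrow> g1 (r \<otimes> u) \<in> F.ext (ideal_pow R I (Suc n))" if r: "r \<in> carrier R" for r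
        proof -
          have "g r \<odot>\<^bsub>M\<^esub> ?C (g1 u) = ?C (g1 (r \<otimes> u))" unfolding smultC[OF r g1_pow[OF u]] using r uc by simp
          then show ?thesis using F.S.gr_zero_iff[OF J g1_pow[OF ru[OF r]]] unfolding M_def Jpow by simp
        qed
        have "k u = \<zero>\<^bsub>MM.LM\<^esub> \<longleftrightarrow> (\<exists>v\<in>carrier A - p. v \<odot>\<^bsub>M\<^esub> ?C (g1 u) = \<zero>\<^bsub>M\<^esub>)"
          unfolding k_def MM.mfrac_zero MM.mfrac_eq_iff[OF Cu M.zero_closed N1 N1] by auto
        also have "\<dots> \<longleftrightarrow> u \<in> saturate Q (ideal_pow R I (Suc n))"
        proof
          assume "\<exists>v\<in>carrier A - p. v \<odot>\<^bsub>M\<^esub> ?C (g1 u) = \<zero>\<^bsub>M\<^esub>"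
          then obtain v where v: "v \<in> carrier A - p" "v \<odot>\<^bsub>M\<^esub> ?C (g1 u) = \<zero>\<^bsub>M\<^esub>" by blast
          obtain r s where rs: "r \<in> carrier R" "s \<in> carrier R" "g s \<in> Units A" "v \<otimes>\<^bsub>A\<^esub> g s = g r"
            using G.frac[of v] v(1) by blast
          have vc: "v \<in> carrier A" and gsc: "g s \<in> carrier A" using v(1) rs(2) by auto
          have "g s \<in> carrier A - p" using unit_notin[OF rs(2,3)] rs(2) by (auto simp: Q_def)
          then have "g r \<in> carrier A - p" unfolding rs(4)[symmetric] by (rule N.S_mult[OF v(1)])
          then have rQ: "r \<notin> Q" by (simp add: Q_def)
          have "g r = g s \<otimes>\<^bsub>A\<^esub> v" unfolding rs(4)[symmetric] by (rule q.S.m_comm[OF vc gsc])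
          then have "g r \<odot>\<^bsub>M\<^esub> ?C (g1 u) = g s \<odot>\<^bsub>M\<^esub> (v \<odot>\<^bsub>M\<^esub> ?C (g1 u))" using M.smult_assoc1[OF gsc vc Cu] by simp
          also have "\<dots> = \<zero>\<^bsub>M\<^esub>" unfolding v(2) by (rule M.smult_r_null[OF gsc])
          finally have "g1 (r \<otimes> u) \<in> F.ext (ideal_pow R I (Suc n))" using act[OF rs(1)] by blast
          then obtain s1 w where s1: "s1 \<in> carrier R" "g1 s1 \<in> Units B" "w \<in> ideal_pow R I (Suc n)" "g1 (s1 \<otimes> (r \<otimes> u)) = g1 w"
            using F.hom_mem_ext[OF pI, of "r \<otimes> u" "Suc n"] rs(1) uc by auto
          have wc: "w \<in> carrier R" by (rule ideal_carr[OF pI s1(3)])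
          let ?d = "s1 \<otimes> (r \<otimes> u) \<ominus> w"
          have dc: "?d \<in> carrier R" using s1 rs uc wc by simp
          have "g1 ?d = \<zero>\<^bsub>B\<^esub>" by (rule F.hom_eq_imp_diff[OF _ wc s1(4)]) (use s1 rs uc in simp)
          then obtain z where z: "z \<in> ?S" "z \<otimes> ?d = \<zero>" using S.loc_map_zero_iff[OF dc] unfolding B_def g1_def by blast
          have zc: "z \<in> carrier R" by (rule S.Sc[OF z(1)])
          have zQ: "z \<notin> Q" using unit_notin[OF zc] unitg S.loc_map_unit[OF z(1)] unfolding B_def g1_def by blast
          have "(z \<otimes> (s1 \<otimes> r)) \<otimes> u = z \<otimes> ?d \<oplus> z \<otimes> w" using zc s1(1) rs(1) uc wc by algebra
          also have "\<dots> = z \<otimes> w" unfolding z(2) using zc wc by simp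
          also have "\<dots> \<in> ideal_pow R I (Suc n)" by (rule ideal_mult[OF pI zc s1(3)])
          finally have m: "(z \<otimes> (s1 \<otimes> r)) \<otimes> u \<in> ideal_pow R I (Suc n)" .
          have s1Q: "s1 \<notin> Q" by (rule unit_notin[OF s1(1) unitg[OF s1(2)]])
          have "s1 \<otimes> r \<in> carrier R - Q" using prime_compl(2)[OF Q, of s1 r] s1(1) s1Q rs(1) rQ by blast
          then have "z \<otimes> (s1 \<otimes> r) \<in> carrier R - Q" using prime_compl(2)[OF Q, of z] zc zQ by blast
          then show "u \<in> saturate Q (ideal_pow R I (Suc n))" using saturateI[OF _ _ uc m] by blast
        next
          assume "u \<in> saturate Q (ideal_pow R I (Suc n))"
          then obtain s where s: "s \<in> carrier R" "s \<notin> Q" "s \<otimes> u \<in> ideal_pow R I (Suc n)" by (auto simp only: saturate_def)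
          have "g1 (s \<otimes> u) \<in> F.ext (ideal_pow R I (Suc n))"
            by (rule F.hom_in_ext[OF ideal_carr[OF pI s(3)] s(3)])
          then have "g s \<odot>\<^bsub>M\<^esub> ?C (g1 u) = \<zero>\<^bsub>M\<^esub>" using act[OF s(1)] by blast
          moreover have "g s \<in> carrier A - p" using s(1,2) by (simp add: Q_def)
          ultimately show "\<exists>v\<in>carrier A - p. v \<odot>\<^bsub>M\<^esub> ?C (g1 u) = \<zero>\<^bsub>M\<^esub>" by blast
        qed
        finally show ?thesis .
      qed
    qed
    moreover have "H.ext Q = local_max A p"
    proof -
      have "local_max A p = Z.ext p" unfolding loc_ideal_def using Z.genideal_image[OF pA] by (simp add: l_def)
      then show ?thesis using H.maximal_ext[of "H.ext Q"] Z.maximal_ext[of "H.ext Q"] by simp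
    qed
    ultimately show ?thesis by simp
  qed
  then have "cohen_macaulay_module A M"
    unfolding cohen_macaulay_module_def Let_def A_def[symmetric]
    using noeth_cring.gr_fg_module[OF Bn J, of n] unfolding A_def[symmetric] M_def[symmetric] by blast
  then show "cohen_macaulay_module (localization R ?S Quot loc_ideal R ?S I) (gr_component (localization R ?S) (loc_ideal R ?S I) n)"
    unfolding A_def M_def J_def B_def .
qed

theorem corollary12:
  fixes R :: "('a, 'm) ring_scheme" and I :: "'a set"
  assumes "excellent_ring R"
    and "ideal I R"
    and "I \<noteq> carrier R"
  shows "(\<exists>f\<in>carrier R. f \<notin> radical R I \<and>
            gr_cohen_macaulay (localization R (powers R f)) (loc_ideal R (powers R f) I)) \<and>
         (locally_equidimensional R \<longrightarrow>
          (\<exists>f\<in>carrier R. f \<notin> radical R I \<and> f \<notin> \<Union>(Minh R I) \<and>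
            gr_cohen_macaulay (localization R (powers R f)) (loc_ideal R (powers R f) I)))"
proof -
  have ex: "cring R" "noetherian_ring R" "J2_ring R" using assms(1) by (auto simp: excellent_ring_def)
  interpret noeth_cring R using ex by (simp add: noeth_cring_def)
  obtain f where f: "f \<in> carrier R" "\<forall>P\<in>minimal_primes R I. f \<notin> P"
    and good: "\<forall>Q. primeideal Q R \<longrightarrow> I \<subseteq> Q \<longrightarrow> f \<notin> Q \<longrightarrow>
      (\<exists>as. set as \<subseteq> Q \<and> (\<forall>n. loc_regular Q (ideal_pow R I (Suc n)) (ideal_pow R I n) as) \<and>
        (\<forall>Ps. prime_chain R Ps \<longrightarrow> I \<subseteq> hd Ps \<longrightarrow> last Ps \<subseteq> Q \<longrightarrow> length Ps \<le> length as + 1))"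
    using generic_gr_loc_regular[OF ex(3) assms(2)] by (elim bexE conjE)
  have "\<one>\<^bsub>R\<^esub> \<notin> I" using ideal.one_imp_carrier[OF assms(2)] assms(3) by blast
  then obtain Q where "primeideal Q R" "I \<subseteq> Q" using proper_ideal_in_prime[OF assms(2)] by blast
  then obtain P where P: "P \<in> minimal_primes R I" using minimal_primes_finite(2)[OF assms(2)] by blast
  have "f \<notin> radical R I"
  proof
    assume "f \<in> radical R I"
    then obtain n :: nat where "f [^]\<^bsub>R\<^esub> n \<in> I" by (auto simp: radical_def)
    then have "f \<in> P" using P prime_power_mem[of P f n] f(1) by (auto simp: minimal_primes_def)
    then show False using f(2) P by blast
  qed
  moreover have "f \<notin> \<Union>(Minh R I)" using f(2) by (auto simp: Minh_def)
  moreover have "gr_cohen_macaulay (localization R (powers R f)) (loc_ideal R (powers R f) I)"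
    by (rule gr_cohen_macaulay_away_from[OF assms(2) f(1)]) (rule good[rule_format])
  ultimately show ?thesis using f(1) by blast
qed

end
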